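(* Let $\Lambda$ be a finitely aligned $k$-graph and let $R$ be a commutative ring with $1$. (a) There is a universal $R$-algebra $\operatorname{KP}_R(\Lambda)$ generated by a Kumjian-Pask $\Lambda$-family $\{s_\lambda, s_{\mu^*} : \lambda,\mu\in\Lambda\}$ such that whenever $\{S_\lambda, S_{\mu^*} : \lambda,\mu\in\Lambda\}$ is a Kumjian-Pask $\Lambda$-family in an $R$-algebra $A$, there exists a unique $R$-algebra homomorphism $\pi_S : \operatorname{KP}_R(\Lambda)\to A$ such that $\pi_S(s_\lambda)=S_\lambda$ and $\pi_S(s_{\mu^*})=S_{\mu^*}$ for all $\lambda,\mu\in\Lambda$. (b) We have $r s_v\neq 0$ for all $r\in R\setminus\{0\}$ and $v\in\Lambda^0$. (c) The subsets $$\operatorname{KP}_R(\Lambda)_n := \operatorname{span}_R\{ s_\lambda s_{\mu^*} : \lambda,\mu\in\Lambda,\ d(\lambda)-d(\mu)=n\}\qquad (n\in\mathbb{Z}^k)$$ form a $\mathbb{Z}^k$-grading of $\operatorname{KP}_R(\Lambda)$.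
   Context: $\mathbb{N}$ contains $0$; for $m,n\in\mathbb{N}^k$ ($k\ge 1$), $m\le n$ and $m\vee n$ (maximum) are taken coordinatewise. A $k$-graph $\Lambda$ is a countable small category with a functor $d:\Lambda\to\mathbb{N}^k$ ($\mathbb{N}^k$ viewed as a category with one object) satisfying the factorisation property: if $d(\lambda)=m+n$ there are unique $\mu,\nu\in\Lambda$ with $\lambda=\mu\nu$, $d(\mu)=m$, $d(\nu)=n$; write $\lambda(0,m)=\mu$, $\lambda(m,m+n)=\nu$. $\Lambda^0$ denotes the objects (vertices), identified with the identity morphisms, i.e. the morphisms of degree $0$. $r(\lambda), s(\lambda)$ are the range (codomain) and source (domain); $\lambda\mu$ is defined when $s(\lambda)=r(\mu)$. $v\Lambda=\{\lambda\in\Lambda: r(\lambda)=v\}$. For $\lambda,\mu\in\Lambda$, $\operatorname{MCE}(\lambda,\mu)$ is the set of $\tau\in\Lambda$ with $d(\tau)=d(\lambda)\vee d(\mu)$, $\tau(0,d(\lambda))=\lambda$, $\tau(0,d(\mu))=\mu$, and $\Lambda^{\min}(\lambda,\mu)=\{(\rho,\tau)\in\Lambda\times\Lambda:\lambda\rho=\mu\tau\in\operatorname{MCE}(\lambda,\mu)\}$. $\Lambda$ is finitely aligned if every $\Lambda^{\min}(\lambda,\mu)$ is finite (possibly empty). A set $E\subseteq v\Lambda$ is exhaustive if for every $\lambda\in v\Lambda$ there is $\mu\in E$ with $\Lambda^{\min}(\lambda,\mu)\ne\emptyset$. $\operatorname{FE}(\Lambda)$ is the collection of all finite exhaustive sets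 $E\subseteq v\Lambda\setminus\{v\}$, $v\in\Lambda^0$; for such $E$, $r(E):=v$. Ghost paths: for each $\lambda\in\Lambda$ there is a formal symbol $\lambda^*$, with $v^*:=v$ for $v\in\Lambda^0$; $G(\Lambda^{\ne0})$ is the set of $\lambda^*$ with $\lambda\notin\Lambda^0$. $R$-algebras are associative and not assumed unital. A Kumjian-Pask $\Lambda$-family $\{S_\lambda,S_{\mu^*}:\lambda,\mu\in\Lambda\}$ in an $R$-algebra $A$ is a map $S:\Lambda\cup G(\Lambda^{\neq0})\to A$ such that: (KP1) $\{S_v:v\in\Lambda^0\}$ are mutually orthogonal idempotents; (KP2) if $s(\lambda)=r(\mu)$ then $S_\lambda S_\mu=S_{\lambda\mu}$ and $S_{\mu^*}S_{\lambda^*}=S_{(\lambda\mu)^*}$; (KP3) $S_{\lambda^*}S_\mu=\sum_{(\rho,\tau)\in\Lambda^{\min}(\lambda,\mu)}S_\rho S_{\tau^*}$ for all $\lambda,\mu\in\Lambda$ (empty sum is $0$); (KP4) $\prod_{\lambda\in E}(S_{r(E)}-S_\lambda S_{\lambda^*})=0$ for all $E\in\operatorname{FE}(\Lambda)$ (the factors commute as a consequence of (KP1)-(KP3)). A $\mathbb{Z}^k$-grading of a ring $A$ is a family of additive subgroups $\{A_n:n\in\mathbb{Z}^k\}$ with $A=\bigoplus_n A_n$ and $A_mA_n\subseteq A_{m+n}$. *)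

theory Defs
  imports
    "HOL-Analysis.Finite_Cartesian_Product"
    "HOL-Library.Countable_Set"
    "HOL-Algebra.Module"
    "HOL-Algebra.QuotRing"
begin

section \<open>Higher-rank graphs\<close>

text \<open>
  The rank \<open>k\<close> is the cardinality of the index type \<open>'k\<close>, so degrees live in \<open>nat ^ 'k\<close>.
  A category is given by its morphisms alone, objects being identified with identity
  morphisms: \<open>Rng \<Lambda> \<alpha>\<close> and \<open>Src \<Lambda> \<alpha>\<close> are the identity morphisms at the codomain and at the
  domain of \<open>\<alpha>\<close>, and \<open>Comp \<Lambda> \<alpha> \<mu>\<close> is meaningful only if \<open>Src \<Lambda> \<alpha> = Rng \<Lambda> \<mu>\<close>.
\<close>

record ('a, 'k::finite) kgraph =
  Mor :: "'a set"
  Rng :: "'a \<Rightarrow> 'a"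
  Src :: "'a \<Rightarrow> 'a"
  Comp :: "'a \<Rightarrow> 'a \<Rightarrow> 'a"
  Deg :: "'a \<Rightarrow> nat ^ 'k"

locale kgraph =
  fixes \<Lambda> :: "('a, 'k::finite) kgraph"
  assumes countable_Mor: "countable (Mor \<Lambda>)"
    and Rng_closed: "\<alpha> \<in> Mor \<Lambda> \<Longrightarrow> Rng \<Lambda> \<alpha> \<in> Mor \<Lambda>"
    and Src_closed: "\<alpha> \<in> Mor \<Lambda> \<Longrightarrow> Src \<Lambda> \<alpha> \<in> Mor \<Lambda>"
    and Rng_Rng: "\<alpha> \<in> Mor \<Lambda> \<Longrightarrow> Rng \<Lambda> (Rng \<Lambda> \<alpha>) = Rng \<Lambda> \<alpha>"
    and Src_Rng: "\<alpha> \<in> Mor \<Lambda> \<Longrightarrow> Src \<Lambda> (Rng \<Lambda> \<alpha>) = Rng \<Lambda> \<alpha>"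
    and Rng_Src: "\<alpha> \<in> Mor \<Lambda> \<Longrightarrow> Rng \<Lambda> (Src \<Lambda> \<alpha>) = Src \<Lambda> \<alpha>"
    and Src_Src: "\<alpha> \<in> Mor \<Lambda> \<Longrightarrow> Src \<Lambda> (Src \<Lambda> \<alpha>) = Src \<Lambda> \<alpha>"
    and Comp_closed:
      "\<lbrakk>\<alpha> \<in> Mor \<Lambda>; \<mu> \<in> Mor \<Lambda>; Src \<Lambda> \<alpha> = Rng \<Lambda> \<mu>\<rbrakk> \<Longrightarrow> Comp \<Lambda> \<alpha> \<mu> \<in> Mor \<Lambda>"
    and Rng_Comp:
      "\<lbrakk>\<alpha> \<in> Mor \<Lambda>; \<mu> \<in> Mor \<Lambda>; Src \<Lambda> \<alpha> = Rng \<Lambda> \<mu>\<rbrakk> \<Longrightarrow> Rng \<Lambda> (Comp \<Lambda> \<alpha> \<mu>) = Rng \<Lambda> \<alpha>"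
    and Src_Comp:
      "\<lbrakk>\<alpha> \<in> Mor \<Lambda>; \<mu> \<in> Mor \<Lambda>; Src \<Lambda> \<alpha> = Rng \<Lambda> \<mu>\<rbrakk> \<Longrightarrow> Src \<Lambda> (Comp \<Lambda> \<alpha> \<mu>) = Src \<Lambda> \<mu>"
    and Comp_assoc:
      "\<lbrakk>\<alpha> \<in> Mor \<Lambda>; \<mu> \<in> Mor \<Lambda>; \<nu> \<in> Mor \<Lambda>; Src \<Lambda> \<alpha> = Rng \<Lambda> \<mu>; Src \<Lambda> \<mu> = Rng \<Lambda> \<nu>\<rbrakk>
        \<Longrightarrow> Comp \<Lambda> (Comp \<Lambda> \<alpha> \<mu>) \<nu> = Comp \<Lambda> \<alpha> (Comp \<Lambda> \<mu> \<nu>)"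
    and Comp_Rng_left: "\<alpha> \<in> Mor \<Lambda> \<Longrightarrow> Comp \<Lambda> (Rng \<Lambda> \<alpha>) \<alpha> = \<alpha>"
    and Comp_Src_right: "\<alpha> \<in> Mor \<Lambda> \<Longrightarrow> Comp \<Lambda> \<alpha> (Src \<Lambda> \<alpha>) = \<alpha>"
    and Deg_Rng: "\<alpha> \<in> Mor \<Lambda> \<Longrightarrow> Deg \<Lambda> (Rng \<Lambda> \<alpha>) = 0"
    and Deg_Src: "\<alpha> \<in> Mor \<Lambda> \<Longrightarrow> Deg \<Lambda> (Src \<Lambda> \<alpha>) = 0"
    and Deg_Comp:
      "\<lbrakk>\<alpha> \<in> Mor \<Lambda>; \<mu> \<in> Mor \<Lambda>; Src \<Lambda> \<alpha> = Rng \<Lambda> \<mu>\<rbrakk>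
        \<Longrightarrow> Deg \<Lambda> (Comp \<Lambda> \<alpha> \<mu>) = Deg \<Lambda> \<alpha> + Deg \<Lambda> \<mu>"
    and factorisation:
      "\<lbrakk>\<alpha> \<in> Mor \<Lambda>; Deg \<Lambda> \<alpha> = m + n\<rbrakk>
        \<Longrightarrow> \<exists>!(\<mu>, \<nu>). \<mu> \<in> Mor \<Lambda> \<and> \<nu> \<in> Mor \<Lambda> \<and> Src \<Lambda> \<mu> = Rng \<Lambda> \<nu> \<and> \<alpha> = Comp \<Lambda> \<mu> \<nu> \<and>
              Deg \<Lambda> \<mu> = m \<and> Deg \<Lambda> \<nu> = n"

definition vertices :: "('a, 'k::finite) kgraph \<Rightarrow> 'a set" where
  "vertices \<Lambda> = {v \<in> Mor \<Lambda>. Deg \<Lambda> v = 0}"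

lemma (in kgraph) vertices_eq_identities: "vertices \<Lambda> = Rng \<Lambda> ` Mor \<Lambda>"
proof
  show "Rng \<Lambda> ` Mor \<Lambda> \<subseteq> vertices \<Lambda>"
    using Rng_closed Deg_Rng by (auto simp: vertices_def)
  show "vertices \<Lambda> \<subseteq> Rng \<Lambda> ` Mor \<Lambda>"
  proof
    fix v assume v: "v \<in> vertices \<Lambda>"
    then have vM: "v \<in> Mor \<Lambda>" and d: "Deg \<Lambda> v = 0 + 0" by (auto simp: vertices_def)
    let ?P = "\<lambda>(\<mu>, \<nu>). \<mu> \<in> Mor \<Lambda> \<and> \<nu> \<in> Mor \<Lambda> \<and> Src \<Lambda> \<mu> = Rng \<Lambda> \<nu> \<and> v = Comp \<Lambda> \<mu> \<nu> \<and>
              Deg \<Lambda> \<mu> = 0 \<and> Deg \<Lambda> \<nu> = 0"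
    have ex: "\<exists>!p. ?P p" using factorisation[OF vM d] .
    have "?P (Rng \<Lambda> v, v)"
      using vM d Rng_closed Src_Rng Comp_Rng_left Deg_Rng by auto
    moreover have "?P (v, Src \<Lambda> v)"
      using vM d Src_closed Rng_Src Comp_Src_right Deg_Src by auto
    ultimately have "(Rng \<Lambda> v, v) = (v, Src \<Lambda> v)" using ex by blast
    then show "v \<in> Rng \<Lambda> ` Mor \<Lambda>" using vM by force
  qed
qed

definition paths_to :: "('a, 'k::finite) kgraph \<Rightarrow> 'a \<Rightarrow> 'a set" where
  "paths_to \<Lambda> v = {\<alpha> \<in> Mor \<Lambda>. Rng \<Lambda> \<alpha> = v}"

text \<open>\<open>initial_segment \<Lambda> \<alpha> m\<close> is \<open>\<alpha>(0, m)\<close>; it is determined only for \<open>m \<le> Deg \<Lambda> \<alpha>\<close>.\<close>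

definition initial_segment :: "('a, 'k::finite) kgraph \<Rightarrow> 'a \<Rightarrow> nat ^ 'k \<Rightarrow> 'a" where
  "initial_segment \<Lambda> \<alpha> m =
    (THE \<mu>. \<mu> \<in> Mor \<Lambda> \<and> Deg \<Lambda> \<mu> = m \<and>
       (\<exists>\<nu> \<in> Mor \<Lambda>. Src \<Lambda> \<mu> = Rng \<Lambda> \<nu> \<and> \<alpha> = Comp \<Lambda> \<mu> \<nu>))"

definition deg_join :: "nat ^ 'k \<Rightarrow> nat ^ 'k \<Rightarrow> nat ^ 'k::finite" where
  "deg_join m n = (\<chi> i. max (m $ i) (n $ i))"

definition MCE :: "('a, 'k::finite) kgraph \<Rightarrow> 'a \<Rightarrow> 'a \<Rightarrow> 'a set" where
  "MCE \<Lambda> \<alpha> \<mu> =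
    {\<tau> \<in> Mor \<Lambda>. Deg \<Lambda> \<tau> = deg_join (Deg \<Lambda> \<alpha>) (Deg \<Lambda> \<mu>) \<and>
       initial_segment \<Lambda> \<tau> (Deg \<Lambda> \<alpha>) = \<alpha> \<and> initial_segment \<Lambda> \<tau> (Deg \<Lambda> \<mu>) = \<mu>}"

definition Lmin :: "('a, 'k::finite) kgraph \<Rightarrow> 'a \<Rightarrow> 'a \<Rightarrow> ('a \<times> 'a) set" where
  "Lmin \<Lambda> \<alpha> \<mu> =
    {(\<rho>, \<tau>) \<in> Mor \<Lambda> \<times> Mor \<Lambda>. Src \<Lambda> \<alpha> = Rng \<Lambda> \<rho> \<and> Src \<Lambda> \<mu> = Rng \<Lambda> \<tau> \<and>
       Comp \<Lambda> \<alpha> \<rho> = Comp \<Lambda> \<mu> \<tau> \<and> Comp \<Lambda> \<alpha> \<rho> \<in> MCE \<Lambda> \<alpha> \<mu>}"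

locale finitely_aligned_kgraph = kgraph +
  assumes finitely_aligned:
    "\<lbrakk>\<alpha> \<in> Mor \<Lambda>; \<mu> \<in> Mor \<Lambda>\<rbrakk> \<Longrightarrow> finite (Lmin \<Lambda> \<alpha> \<mu>)"

definition exhaustive :: "('a, 'k::finite) kgraph \<Rightarrow> 'a \<Rightarrow> 'a set \<Rightarrow> bool" where
  "exhaustive \<Lambda> v E \<longleftrightarrow>
    E \<subseteq> paths_to \<Lambda> v \<and> (\<forall>\<alpha> \<in> paths_to \<Lambda> v. \<exists>\<mu> \<in> E. Lmin \<Lambda> \<alpha> \<mu> \<noteq> {})"

text \<open>
  \<open>FE \<Lambda> v\<close> consists of the finite exhaustive sets \<open>E\<close> with \<open>r(E) = v\<close>.  These are nonempty
  when \<open>v\<close> is a vertex, because \<open>v\<close> itself has range \<open>v\<close>.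
\<close>

definition FE :: "('a, 'k::finite) kgraph \<Rightarrow> 'a \<Rightarrow> 'a set set" where
  "FE \<Lambda> v = {E. finite E \<and> E \<subseteq> paths_to \<Lambda> v - {v} \<and> exhaustive \<Lambda> v E}"

definition int_deg :: "('a, 'k::finite) kgraph \<Rightarrow> 'a \<Rightarrow> int ^ 'k" where
  "int_deg \<Lambda> \<alpha> = (\<chi> i. int (Deg \<Lambda> \<alpha> $ i))"


section \<open>Algebras that need not be unital\<close>

text \<open>
  The \<open>one\<close> field of the record carrying a non-unital algebra is never constrained nor used.
\<close>

locale nonunital_algebra = module R A for R (structure) and A (structure) +
  assumes mult_closed: "\<lbrakk>x \<in> carrier A; y \<in> carrier A\<rbrakk> \<Longrightarrow> x \<otimes>\<^bsub>A\<^esub> y \<in> carrier A"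
    and mult_assoc:
      "\<lbrakk>x \<in> carrier A; y \<in> carrier A; z \<in> carrier A\<rbrakk>
        \<Longrightarrow> (x \<otimes>\<^bsub>A\<^esub> y) \<otimes>\<^bsub>A\<^esub> z = x \<otimes>\<^bsub>A\<^esub> (y \<otimes>\<^bsub>A\<^esub> z)"
    and mult_distrib_right:
      "\<lbrakk>x \<in> carrier A; y \<in> carrier A; z \<in> carrier A\<rbrakk>
        \<Longrightarrow> (x \<oplus>\<^bsub>A\<^esub> y) \<otimes>\<^bsub>A\<^esub> z = (x \<otimes>\<^bsub>A\<^esub> z) \<oplus>\<^bsub>A\<^esub> (y \<otimes>\<^bsub>A\<^esub> z)"
    and mult_distrib_left:
      "\<lbrakk>x \<in> carrier A; y \<in> carrier A; z \<in> carrier A\<rbrakk>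
        \<Longrightarrow> x \<otimes>\<^bsub>A\<^esub> (y \<oplus>\<^bsub>A\<^esub> z) = (x \<otimes>\<^bsub>A\<^esub> y) \<oplus>\<^bsub>A\<^esub> (x \<otimes>\<^bsub>A\<^esub> z)"
    and smult_mult_left:
      "\<lbrakk>r \<in> carrier R; x \<in> carrier A; y \<in> carrier A\<rbrakk>
        \<Longrightarrow> (r \<odot>\<^bsub>A\<^esub> x) \<otimes>\<^bsub>A\<^esub> y = r \<odot>\<^bsub>A\<^esub> (x \<otimes>\<^bsub>A\<^esub> y)"
    and smult_mult_right:
      "\<lbrakk>r \<in> carrier R; x \<in> carrier A; y \<in> carrier A\<rbrakk>
        \<Longrightarrow> x \<otimes>\<^bsub>A\<^esub> (r \<odot>\<^bsub>A\<^esub> y) = r \<odot>\<^bsub>A\<^esub> (x \<otimes>\<^bsub>A\<^esub> y)"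

definition alg_hom ::
    "('r, 'm) ring_scheme \<Rightarrow> ('r, 'b, 'n) module_scheme \<Rightarrow> ('r, 'c, 'p) module_scheme \<Rightarrow> ('b \<Rightarrow> 'c) set"
  where
  "alg_hom R A B =
    {h. h \<in> hom A B \<and> h \<in> hom (add_monoid A) (add_monoid B) \<and>
        (\<forall>r \<in> carrier R. \<forall>x \<in> carrier A. h (r \<odot>\<^bsub>A\<^esub> x) = r \<odot>\<^bsub>B\<^esub> h x)}"

definition subalg :: "('r, 'm) ring_scheme \<Rightarrow> ('r, 'b, 'n) module_scheme \<Rightarrow> 'b set \<Rightarrow> bool" where
  "subalg R A B \<longleftrightarrow> submodule B R A \<and> (\<forall>x \<in> B. \<forall>y \<in> B. x \<otimes>\<^bsub>A\<^esub> y \<in> B)"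

definition subalg_generated ::
    "('r, 'm) ring_scheme \<Rightarrow> ('r, 'b, 'n) module_scheme \<Rightarrow> 'b set \<Rightarrow> 'b set" where
  "subalg_generated R A X = \<Inter>{B. subalg R A B \<and> X \<subseteq> B}"

definition alg_ideal :: "('r, 'm) ring_scheme \<Rightarrow> ('r, 'b, 'n) module_scheme \<Rightarrow> 'b set \<Rightarrow> bool" where
  "alg_ideal R A I \<longleftrightarrow>
    submodule I R A \<and> (\<forall>x \<in> I. \<forall>a \<in> carrier A. a \<otimes>\<^bsub>A\<^esub> x \<in> I \<and> x \<otimes>\<^bsub>A\<^esub> a \<in> I)"

definition alg_ideal_generated ::
    "('r, 'm) ring_scheme \<Rightarrow> ('r, 'b, 'n) module_scheme \<Rightarrow> 'b set \<Rightarrow> 'b set" where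
  "alg_ideal_generated R A X = \<Inter>{I. alg_ideal R A I \<and> X \<subseteq> I}"

definition quotient_alg :: "('r, 'b, 'n) module_scheme \<Rightarrow> 'b set \<Rightarrow> ('r, 'b set) module" where
  "quotient_alg A I =
    \<lparr>carrier = carrier (A Quot I), mult = mult (A Quot I), one = one (A Quot I),
     zero = zero (A Quot I), add = add (A Quot I),
     smult = (\<lambda>r X. \<Union>x \<in> X. I +>\<^bsub>A\<^esub> (r \<odot>\<^bsub>A\<^esub> x))\<rparr>"

definition linear_span ::
    "('r, 'm) ring_scheme \<Rightarrow> ('r, 'b, 'n) module_scheme \<Rightarrow> 'b set \<Rightarrow> 'b set" where
  "linear_span R A X =
    {finsum A (\<lambda>x. c x \<odot>\<^bsub>A\<^esub> x) F | c F. finite F \<and> F \<subseteq> X \<and> c \<in> F \<rightarrow> carrier R}"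

definition is_grading :: "('b, 'n) ring_scheme \<Rightarrow> ('g::ab_group_add \<Rightarrow> 'b set) \<Rightarrow> bool" where
  "is_grading A G \<longleftrightarrow>
    (\<forall>n. additive_subgroup (G n) A) \<and>
    (\<forall>a \<in> carrier A. \<exists>!f. (\<forall>n. f n \<in> G n) \<and> finite {n. f n \<noteq> \<zero>\<^bsub>A\<^esub>} \<and>
       a = finsum A f {n. f n \<noteq> \<zero>\<^bsub>A\<^esub>}) \<and>
    (\<forall>m n. \<forall>a \<in> G m. \<forall>b \<in> G n. a \<otimes>\<^bsub>A\<^esub> b \<in> G (m + n))"

text \<open>
  The free non-unital algebra on \<open>X\<close> has the nonempty words over \<open>X\<close> as a basis; its elements
  are the finitely supported coefficient functions on words.
\<close>

definition free_alg ::
    "('r, 'm) ring_scheme \<Rightarrow> 'x set \<Rightarrow> ('r, 'x list \<Rightarrow> 'r) module" where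
  "free_alg R X =
    \<lparr>carrier = {f. (\<forall>w. f w \<in> carrier R) \<and> finite {w. f w \<noteq> \<zero>\<^bsub>R\<^esub>} \<and>
                   {w. f w \<noteq> \<zero>\<^bsub>R\<^esub>} \<subseteq> {w. w \<noteq> [] \<and> set w \<subseteq> X}},
     mult = (\<lambda>f g w. finsum R (\<lambda>i. f (take i w) \<otimes>\<^bsub>R\<^esub> g (drop i w)) {..length w}),
     one = undefined,
     zero = (\<lambda>w. \<zero>\<^bsub>R\<^esub>),
     add = (\<lambda>f g w. f w \<oplus>\<^bsub>R\<^esub> g w),
     smult = (\<lambda>r f w. r \<otimes>\<^bsub>R\<^esub> f w)\<rparr>"

definition free_gen :: "('r, 'm) ring_scheme \<Rightarrow> 'x \<Rightarrow> 'x list \<Rightarrow> 'r" where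
  "free_gen R x = (\<lambda>w. if w = [x] then \<one>\<^bsub>R\<^esub> else \<zero>\<^bsub>R\<^esub>)"

fun list_product :: "('b, 'n) monoid_scheme \<Rightarrow> 'b list \<Rightarrow> 'b" where
  "list_product A [] = undefined"
| "list_product A [x] = x"
| "list_product A (x # y # zs) = x \<otimes>\<^bsub>A\<^esub> list_product A (y # zs)"


section \<open>Kumjian-Pask families and the Kumjian-Pask algebra\<close>

datatype 'a symbol = Path 'a | Ghost 'a

definition symbols :: "('a, 'k::finite) kgraph \<Rightarrow> 'a symbol set" where
  "symbols \<Lambda> = Path ` Mor \<Lambda> \<union> Ghost ` (Mor \<Lambda> - vertices \<Lambda>)"

definition star :: "('a, 'k::finite) kgraph \<Rightarrow> 'a \<Rightarrow> 'a symbol" where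
  "star \<Lambda> \<alpha> = (if \<alpha> \<in> vertices \<Lambda> then Path \<alpha> else Ghost \<alpha>)"

text \<open>
  In \<open>KP4\<close> the product over \<open>E\<close> is asserted to vanish for every enumeration of \<open>E\<close>; by
  \<open>KP1\<close>--\<open>KP3\<close> the factors commute, so that the order is immaterial.
\<close>

locale kumjian_pask_family =
  finitely_aligned_kgraph \<Lambda> + nonunital_algebra R A
  for \<Lambda> :: "('a, 'k::finite) kgraph" and R (structure) and A (structure) +
  fixes S :: "'a symbol \<Rightarrow> _"
  assumes S_closed: "S \<in> symbols \<Lambda> \<rightarrow> carrier A"
    and KP1:
      "\<lbrakk>v \<in> vertices \<Lambda>; w \<in> vertices \<Lambda>\<rbrakk>
        \<Longrightarrow> S (Path v) \<otimes>\<^bsub>A\<^esub> S (Path w) = (if v = w then S (Path v) else \<zero>\<^bsub>A\<^esub>)"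
    and KP2_path:
      "\<lbrakk>\<alpha> \<in> Mor \<Lambda>; \<mu> \<in> Mor \<Lambda>; Src \<Lambda> \<alpha> = Rng \<Lambda> \<mu>\<rbrakk>
        \<Longrightarrow> S (Path \<alpha>) \<otimes>\<^bsub>A\<^esub> S (Path \<mu>) = S (Path (Comp \<Lambda> \<alpha> \<mu>))"
    and KP2_ghost:
      "\<lbrakk>\<alpha> \<in> Mor \<Lambda>; \<mu> \<in> Mor \<Lambda>; Src \<Lambda> \<alpha> = Rng \<Lambda> \<mu>\<rbrakk>
        \<Longrightarrow> S (star \<Lambda> \<mu>) \<otimes>\<^bsub>A\<^esub> S (star \<Lambda> \<alpha>) = S (star \<Lambda> (Comp \<Lambda> \<alpha> \<mu>))"
    and KP3:
      "\<lbrakk>\<alpha> \<in> Mor \<Lambda>; \<mu> \<in> Mor \<Lambda>\<rbrakk>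
        \<Longrightarrow> S (star \<Lambda> \<alpha>) \<otimes>\<^bsub>A\<^esub> S (Path \<mu>) =
            finsum A (\<lambda>(\<rho>, \<tau>). S (Path \<rho>) \<otimes>\<^bsub>A\<^esub> S (star \<Lambda> \<tau>)) (Lmin \<Lambda> \<alpha> \<mu>)"
    and KP4:
      "\<lbrakk>v \<in> vertices \<Lambda>; E \<in> FE \<Lambda> v; distinct \<alpha>s; set \<alpha>s = E\<rbrakk>
        \<Longrightarrow> list_product A
              (map (\<lambda>\<alpha>. S (Path v) \<ominus>\<^bsub>A\<^esub> S (Path \<alpha>) \<otimes>\<^bsub>A\<^esub> S (star \<Lambda> \<alpha>)) \<alpha>s) = \<zero>\<^bsub>A\<^esub>"

text \<open>The differences of the two sides of \<open>KP1\<close>--\<open>KP4\<close>.\<close>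

inductive_set kp_relators ::
    "('a, 'k::finite) kgraph \<Rightarrow> ('b, 'n) ring_scheme \<Rightarrow> ('a symbol \<Rightarrow> 'b) \<Rightarrow> 'b set"
  for \<Lambda> A S where
  KP1:
    "\<lbrakk>v \<in> vertices \<Lambda>; w \<in> vertices \<Lambda>\<rbrakk>
      \<Longrightarrow> S (Path v) \<otimes>\<^bsub>A\<^esub> S (Path w) \<ominus>\<^bsub>A\<^esub> (if v = w then S (Path v) else \<zero>\<^bsub>A\<^esub>)
            \<in> kp_relators \<Lambda> A S"
| KP2_path:
    "\<lbrakk>\<alpha> \<in> Mor \<Lambda>; \<mu> \<in> Mor \<Lambda>; Src \<Lambda> \<alpha> = Rng \<Lambda> \<mu>\<rbrakk>
      \<Longrightarrow> S (Path \<alpha>) \<otimes>\<^bsub>A\<^esub> S (Path \<mu>) \<ominus>\<^bsub>A\<^esub> S (Path (Comp \<Lambda> \<alpha> \<mu>)) \<in> kp_relators \<Lambda> A S"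
| KP2_ghost:
    "\<lbrakk>\<alpha> \<in> Mor \<Lambda>; \<mu> \<in> Mor \<Lambda>; Src \<Lambda> \<alpha> = Rng \<Lambda> \<mu>\<rbrakk>
      \<Longrightarrow> S (star \<Lambda> \<mu>) \<otimes>\<^bsub>A\<^esub> S (star \<Lambda> \<alpha>) \<ominus>\<^bsub>A\<^esub> S (star \<Lambda> (Comp \<Lambda> \<alpha> \<mu>))
            \<in> kp_relators \<Lambda> A S"
| KP3:
    "\<lbrakk>\<alpha> \<in> Mor \<Lambda>; \<mu> \<in> Mor \<Lambda>\<rbrakk>
      \<Longrightarrow> S (star \<Lambda> \<alpha>) \<otimes>\<^bsub>A\<^esub> S (Path \<mu>) \<ominus>\<^bsub>A\<^esub>
            finsum A (\<lambda>(\<rho>, \<tau>). S (Path \<rho>) \<otimes>\<^bsub>A\<^esub> S (star \<Lambda> \<tau>)) (Lmin \<Lambda> \<alpha> \<mu>)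
            \<in> kp_relators \<Lambda> A S"
| KP4:
    "\<lbrakk>v \<in> vertices \<Lambda>; E \<in> FE \<Lambda> v; distinct \<alpha>s; set \<alpha>s = E\<rbrakk>
      \<Longrightarrow> list_product A (map (\<lambda>\<alpha>. S (Path v) \<ominus>\<^bsub>A\<^esub> S (Path \<alpha>) \<otimes>\<^bsub>A\<^esub> S (star \<Lambda> \<alpha>)) \<alpha>s)
            \<in> kp_relators \<Lambda> A S"

definition KP_ideal ::
    "('r, 'm) ring_scheme \<Rightarrow> ('a, 'k::finite) kgraph \<Rightarrow> ('a symbol list \<Rightarrow> 'r) set" where
  "KP_ideal R \<Lambda> =
    alg_ideal_generated R (free_alg R (symbols \<Lambda>))
      (kp_relators \<Lambda> (free_alg R (symbols \<Lambda>)) (free_gen R))"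

definition KP ::
    "('r, 'm) ring_scheme \<Rightarrow> ('a, 'k::finite) kgraph \<Rightarrow> ('r, ('a symbol list \<Rightarrow> 'r) set) module" where
  "KP R \<Lambda> = quotient_alg (free_alg R (symbols \<Lambda>)) (KP_ideal R \<Lambda>)"

definition KP_gen ::
    "('r, 'm) ring_scheme \<Rightarrow> ('a, 'k::finite) kgraph \<Rightarrow> 'a symbol \<Rightarrow> ('a symbol list \<Rightarrow> 'r) set" where
  "KP_gen R \<Lambda> x = KP_ideal R \<Lambda> +>\<^bsub>free_alg R (symbols \<Lambda>)\<^esub> free_gen R x"

definition KP_component ::
    "('r, 'm) ring_scheme \<Rightarrow> ('a, 'k::finite) kgraph \<Rightarrow> int ^ 'k \<Rightarrow> ('a symbol list \<Rightarrow> 'r) set set" where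
  "KP_component R \<Lambda> n =
    linear_span R (KP R \<Lambda>)
      {KP_gen R \<Lambda> (Path \<alpha>) \<otimes>\<^bsub>KP R \<Lambda>\<^esub> KP_gen R \<Lambda> (star \<Lambda> \<mu>) | \<alpha> \<mu>.
         \<alpha> \<in> Mor \<Lambda> \<and> \<mu> \<in> Mor \<Lambda> \<and> int_deg \<Lambda> \<alpha> - int_deg \<Lambda> \<mu> = n}"

end

theory Submission
  imports Defs
begin

text \<open>
  The algebra is, by its definition, a quotient of a free algebra; (a) is formal.

  For (b) one needs a single family with nonzero multiples of vertices.  Call a nonempty set of
  paths compatible if each of its finite subsets has a common extension.  The maximal compatible
  sets play the role of boundary paths: by finite alignment, any two members of such a set \<open>x\<close>
  have a minimal common extension in \<open>x\<close>, and by maximality \<open>x\<close> meets every finite exhaustive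
  set at each of its vertices.  A path \<open>\<alpha>\<close> acts on these sets by prepending \<open>\<alpha>\<close>, its ghost by
  removing it; pulling back functions with values in \<open>R\<close> along these partial bijections is a
  Kumjian-Pask family.  Zorn's lemma puts every vertex into a maximal compatible set.

  For (c), the relators are homogeneous for the degree of words, so the ideal contains the
  homogeneous parts of its elements and the quotient is graded by degree of words.  The relations
  (KP2) and (KP3) turn every word into a combination of \<open>s\<^sub>\<alpha> s\<^sub>\<mu>\<^sup>*\<close> of the same degree.
\<close>

section \<open>Algebras and their quotients\<close>

text \<open>Boundary paths are usually degree-preserving functors. With sets of paths instead,
  existence is cheap, but that a path lies in such a set can be seen only through maximality. One
  criterion, \<open>boundary_prime\<close>, extracts all of this: a finite set \<open>E\<close> of
  paths meets a maximal \<open>x\<close> as soon as every finite part of \<open>x\<close> has a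
  common extension that also extends a member of \<open>E\<close>. With \<open>E\<close> a single
  prefix, the minimal common extensions of two members, or a finite exhaustive set, it yields the
  facts behind (KP2), (KP3) and (KP4). In (c) the obstacle is directness of the sum, since no linear
  independence of the spanning products is available. The components are therefore identified with
  images of homogeneous submodules of the free algebra, where different degrees have disjoint
  supports; a relation between components lifts to an element of the ideal and is split there. For
  the spans, words grow on the left by one symbol at a time, so that no formula for the product of
  two spanning elements has to be computed.\<close>

context module begin

lemma submodule_finsum:
  assumes "submodule H R M" and "f \<in> F \<rightarrow> H"
  shows "finsum M f F \<in> H"
  using assms(2)
proof (induction F rule: infinite_finite_induct)
  \<comment> \<open>\<open>finsum\<close> over an infinite index set is zero, and zero lies in
    \<open>H\<close> as the sum of an element and its negative.\<close>
  case (infinite F)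
  then show ?case
    using submoduleE[OF assms(1)] M.finsum_infinite[of F f] by (metis M.l_neg equals0I subsetD)
next
  case empty
  then show ?case
    using submoduleE[OF assms(1)] by (metis M.l_neg M.finsum_empty equals0I subsetD)
next
  case (insert x F)
  have "f \<in> F \<rightarrow> carrier M" "f x \<in> carrier M"
    using insert.prems submoduleE(1)[OF assms(1)] by auto
  then show ?case
    using insert submoduleE(5)[OF assms(1)] by (simp add: M.finsum_insert)
qed

lemma submodule_zero: "submodule H R M \<Longrightarrow> \<zero>\<^bsub>M\<^esub> \<in> H"
  using submodule_finsum[of H "\<lambda>_. \<zero>\<^bsub>M\<^esub>" "{}"] by simp

lemma submodule_diff:
  assumes "submodule H R M" "x \<in> H" "y \<in> H"
  shows "x \<ominus>\<^bsub>M\<^esub> y \<in> H"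
  using submoduleE[OF assms(1)] assms(2,3) by (simp add: a_minus_def)

lemma linear_span_incl:
  assumes "X \<subseteq> carrier M" "x \<in> X"
  shows "x \<in> linear_span R M X"
proof -
  have "x \<in> carrier M" using assms by auto
  then have "x = finsum M (\<lambda>x. \<one> \<odot>\<^bsub>M\<^esub> x) {x}"
    by (simp add: M.finsum_insert)
  then show ?thesis
    using assms unfolding linear_span_def by (auto intro!: exI[of _ "\<lambda>_. \<one>"] exI[of _ "{x}"])
qed

lemma linear_span_minimal:
  assumes "submodule B R M" "X \<subseteq> B"
  shows "linear_span R M X \<subseteq> B"
proof
  fix y assume "y \<in> linear_span R M X"
  then obtain c F where y: "y = finsum M (\<lambda>x. c x \<odot>\<^bsub>M\<^esub> x) F" "F \<subseteq> X" "c \<in> F \<rightarrow> carrier R"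
    unfolding linear_span_def by auto
  show "y \<in> B" unfolding y(1)
    by (rule submodule_finsum[OF assms(1)]) (use y assms submoduleE(4)[OF assms(1)] in \<open>auto simp: Pi_iff subset_iff\<close>)
qed

text \<open>Padding with zero coefficients brings two combinations with different index sets to a
  common one, so that they can be added coefficientwise.\<close>

lemma linear_span_extend:
  assumes "X \<subseteq> carrier M" "finite F" "F \<subseteq> G" "finite G" "G \<subseteq> X" "c \<in> F \<rightarrow> carrier R"
  shows "finsum M (\<lambda>x. c x \<odot>\<^bsub>M\<^esub> x) F = finsum M (\<lambda>x. (if x \<in> F then c x else \<zero>) \<odot>\<^bsub>M\<^esub> x) G"
  by (rule M.add.finprod_mono_neutral_cong_left) (use assms in \<open>auto simp: Pi_def subset_iff\<close>)

lemma linear_span_submodule: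
  assumes X: "X \<subseteq> carrier M"
  shows "submodule (linear_span R M X) R M"
proof (rule submoduleI)
  show "linear_span R M X \<subseteq> carrier M"
    using linear_span_minimal[OF carrier_is_submodule X] .
  show "\<zero>\<^bsub>M\<^esub> \<in> linear_span R M X"
    unfolding linear_span_def by (auto intro!: exI[of _ "{}"])
  show smult: "a \<odot>\<^bsub>M\<^esub> x \<in> linear_span R M X"
    if a: "a \<in> carrier R" and x: "x \<in> linear_span R M X" for a x
  proof -
    obtain c F where y: "x = finsum M (\<lambda>x. c x \<odot>\<^bsub>M\<^esub> x) F" "finite F" "F \<subseteq> X" "c \<in> F \<rightarrow> carrier R"
      using x unfolding linear_span_def by auto
    have "a \<odot>\<^bsub>M\<^esub> x = finsum M (\<lambda>x. a \<odot>\<^bsub>M\<^esub> (c x \<odot>\<^bsub>M\<^esub> x)) F"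
      unfolding y(1) by (rule finsum_smult_ldistr) (use y X a in auto)
    also have "\<dots> = finsum M (\<lambda>x. (a \<otimes> c x) \<odot>\<^bsub>M\<^esub> x) F"
      by (rule M.finsum_cong') (use y X a in \<open>auto simp: smult_assoc1 Pi_iff subset_iff\<close>)
    finally show ?thesis
      unfolding linear_span_def using y a
      by (auto intro!: exI[of _ "\<lambda>x. a \<otimes> c x"] exI[of _ F])
  qed
  show "x \<oplus>\<^bsub>M\<^esub> y \<in> linear_span R M X"
    if x: "x \<in> linear_span R M X" and y: "y \<in> linear_span R M X" for x y
  proof -
    obtain c F where x: "x = finsum M (\<lambda>x. c x \<odot>\<^bsub>M\<^esub> x) F" "finite F" "F \<subseteq> X" "c \<in> F \<rightarrow> carrier R"
      using x unfolding linear_span_def by auto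
    obtain d G where y: "y = finsum M (\<lambda>x. d x \<odot>\<^bsub>M\<^esub> x) G" "finite G" "G \<subseteq> X" "d \<in> G \<rightarrow> carrier R"
      using y unfolding linear_span_def by auto
    define c' where "c' = (\<lambda>x. if x \<in> F then c x else \<zero>)"
    define d' where "d' = (\<lambda>x. if x \<in> G then d x else \<zero>)"
    have c': "c' \<in> F \<union> G \<rightarrow> carrier R" and d': "d' \<in> F \<union> G \<rightarrow> carrier R"
      using x y by (auto simp: c'_def d'_def)
    have "x = finsum M (\<lambda>x. c' x \<odot>\<^bsub>M\<^esub> x) (F \<union> G)" "y = finsum M (\<lambda>x. d' x \<odot>\<^bsub>M\<^esub> x) (F \<union> G)"
      unfolding x(1) y(1) c'_def d'_def
      by (rule linear_span_extend[OF X]; use x y in auto)+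
    then have "x \<oplus>\<^bsub>M\<^esub> y = finsum M (\<lambda>x. c' x \<odot>\<^bsub>M\<^esub> x \<oplus>\<^bsub>M\<^esub> d' x \<odot>\<^bsub>M\<^esub> x) (F \<union> G)"
      using c' d' x y X by (subst M.finsum_addf) (auto simp: Pi_iff subset_iff)
    also have "\<dots> = finsum M (\<lambda>x. (c' x \<oplus> d' x) \<odot>\<^bsub>M\<^esub> x) (F \<union> G)"
      by (rule M.finsum_cong') (use c' d' x y X in \<open>auto simp: smult_l_distr Pi_iff subset_iff\<close>)
    finally show ?thesis
      unfolding linear_span_def using x y c' d'
      by (auto intro!: exI[of _ "\<lambda>x. c' x \<oplus> d' x"] exI[of _ "F \<union> G"])
  qed
  show "\<ominus>\<^bsub>M\<^esub> x \<in> linear_span R M X" if x: "x \<in> linear_span R M X" for x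
  proof -
    have "x \<in> carrier M" using x linear_span_minimal[OF carrier_is_submodule X] by auto
    then have "\<ominus>\<^bsub>M\<^esub> x = (\<ominus> \<one>) \<odot>\<^bsub>M\<^esub> x" by (simp add: smult_l_minus)
    then show ?thesis using smult[OF _ x] by simp
  qed
qed

lemma submodule_Int:
  assumes "\<And>B. B \<in> \<B> \<Longrightarrow> submodule B R M" "\<B> \<noteq> {}"
  shows "submodule (\<Inter>\<B>) R M"
proof (rule submoduleI)
  obtain B where "B \<in> \<B>" using assms by auto
  then show "\<Inter>\<B> \<subseteq> carrier M" using submoduleE(1)[OF assms(1)] by auto
qed (auto simp: submoduleE[OF assms(1)] submodule_zero[OF assms(1)])

end

lemma nonunital_algebraI:
  fixes R (structure) and A (structure)
  assumes "module R A"
    and "\<And>x y. \<lbrakk>x \<in> carrier A; y \<in> carrier A\<rbrakk> \<Longrightarrow> x \<otimes>\<^bsub>A\<^esub> y \<in> carrier A"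
    and "\<And>x y z. \<lbrakk>x \<in> carrier A; y \<in> carrier A; z \<in> carrier A\<rbrakk>
        \<Longrightarrow> (x \<otimes>\<^bsub>A\<^esub> y) \<otimes>\<^bsub>A\<^esub> z = x \<otimes>\<^bsub>A\<^esub> (y \<otimes>\<^bsub>A\<^esub> z)"
    and "\<And>x y z. \<lbrakk>x \<in> carrier A; y \<in> carrier A; z \<in> carrier A\<rbrakk>
        \<Longrightarrow> (x \<oplus>\<^bsub>A\<^esub> y) \<otimes>\<^bsub>A\<^esub> z = (x \<otimes>\<^bsub>A\<^esub> z) \<oplus>\<^bsub>A\<^esub> (y \<otimes>\<^bsub>A\<^esub> z)"
    and "\<And>x y z. \<lbrakk>x \<in> carrier A; y \<in> carrier A; z \<in> carrier A\<rbrakk>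
        \<Longrightarrow> x \<otimes>\<^bsub>A\<^esub> (y \<oplus>\<^bsub>A\<^esub> z) = (x \<otimes>\<^bsub>A\<^esub> y) \<oplus>\<^bsub>A\<^esub> (x \<otimes>\<^bsub>A\<^esub> z)"
    and "\<And>r x y. \<lbrakk>r \<in> carrier R; x \<in> carrier A; y \<in> carrier A\<rbrakk>
        \<Longrightarrow> (r \<odot>\<^bsub>A\<^esub> x) \<otimes>\<^bsub>A\<^esub> y = r \<odot>\<^bsub>A\<^esub> (x \<otimes>\<^bsub>A\<^esub> y)"
    and "\<And>r x y. \<lbrakk>r \<in> carrier R; x \<in> carrier A; y \<in> carrier A\<rbrakk>
        \<Longrightarrow> x \<otimes>\<^bsub>A\<^esub> (r \<odot>\<^bsub>A\<^esub> y) = r \<odot>\<^bsub>A\<^esub> (x \<otimes>\<^bsub>A\<^esub> y)"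
  shows "nonunital_algebra R A"
  using assms by (intro nonunital_algebra.intro nonunital_algebra_axioms.intro)

context nonunital_algebra begin

text \<open>Zero is its own zero multiple, and scalars move out of products.\<close>

lemma mult_zero_left [simp]:
  assumes "x \<in> carrier A" shows "\<zero>\<^bsub>A\<^esub> \<otimes>\<^bsub>A\<^esub> x = \<zero>\<^bsub>A\<^esub>"
  using smult_mult_left[of \<zero> "\<zero>\<^bsub>A\<^esub>" x] assms mult_closed by simp

lemma mult_zero_right [simp]:
  assumes "x \<in> carrier A" shows "x \<otimes>\<^bsub>A\<^esub> \<zero>\<^bsub>A\<^esub> = \<zero>\<^bsub>A\<^esub>"
  using smult_mult_right[of \<zero> x "\<zero>\<^bsub>A\<^esub>"] assms mult_closed by simp

lemma mult_finsum_left: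
  assumes "f \<in> F \<rightarrow> carrier A" "x \<in> carrier A" "finite F"
  shows "finsum A f F \<otimes>\<^bsub>A\<^esub> x = finsum A (\<lambda>i. f i \<otimes>\<^bsub>A\<^esub> x) F"
  using assms(3,1)
  by (induction F rule: finite_induct)
     (use assms(2) in \<open>simp_all add: Pi_iff mult_distrib_right mult_closed\<close>)

lemma list_product_Cons: "xs \<noteq> [] \<Longrightarrow> list_product A (x # xs) = x \<otimes>\<^bsub>A\<^esub> list_product A xs"
  by (cases xs) auto

lemma list_product_closed:
  "\<lbrakk>xs \<noteq> []; set xs \<subseteq> carrier A\<rbrakk> \<Longrightarrow> list_product A xs \<in> carrier A"
proof (induction xs)
  case (Cons x xs)
  then show ?case
    by (cases "xs = []") (auto simp: list_product_Cons mult_closed)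
qed simp

lemma list_product_append:
  "\<lbrakk>xs \<noteq> []; ys \<noteq> []; set xs \<subseteq> carrier A; set ys \<subseteq> carrier A\<rbrakk>
    \<Longrightarrow> list_product A (xs @ ys) = list_product A xs \<otimes>\<^bsub>A\<^esub> list_product A ys"
proof (induction xs)
  case (Cons x xs)
  then show ?case
    by (cases "xs = []") (simp_all add: list_product_Cons mult_assoc list_product_closed)
qed simp

lemma alg_idealD:
  assumes "alg_ideal R A I"
  shows "submodule I R A" and "\<And>x a. \<lbrakk>x \<in> I; a \<in> carrier A\<rbrakk> \<Longrightarrow> a \<otimes>\<^bsub>A\<^esub> x \<in> I"
    and "\<And>x a. \<lbrakk>x \<in> I; a \<in> carrier A\<rbrakk> \<Longrightarrow> x \<otimes>\<^bsub>A\<^esub> a \<in> I"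
  using assms by (auto simp: alg_ideal_def)

lemma alg_ideal_generated_alg_ideal:
  assumes "X \<subseteq> carrier A"
  shows "alg_ideal R A (alg_ideal_generated R A X)"
proof -
  have ne: "alg_ideal R A (carrier A)"
    using carrier_is_submodule mult_closed by (auto simp: alg_ideal_def)
  have "submodule (alg_ideal_generated R A X) R A"
    unfolding alg_ideal_generated_def
    by (rule submodule_Int) (use ne assms alg_idealD(1) in auto)
  then show ?thesis
    by (auto simp: alg_ideal_def alg_ideal_generated_def)
qed

lemma alg_ideal_generated_incl: "X \<subseteq> alg_ideal_generated R A X"
  by (auto simp: alg_ideal_generated_def)

lemma alg_ideal_generated_minimal:
  "\<lbrakk>alg_ideal R A I; X \<subseteq> I\<rbrakk> \<Longrightarrow> alg_ideal_generated R A X \<subseteq> I"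
  by (auto simp: alg_ideal_generated_def)

lemma subalg_carrier: "subalg R A (carrier A)"
  using carrier_is_submodule mult_closed by (auto simp: subalg_def)

end

section \<open>Homomorphisms of algebras: kernels, images and preimages\<close>

locale alg_morphism = A: nonunital_algebra R A + B: nonunital_algebra R B
  for R (structure) and A and B +
  fixes h
  assumes alg_hom: "h \<in> alg_hom R A B"
begin

lemma map_closed [simp]: "x \<in> carrier A \<Longrightarrow> h x \<in> carrier B"
  and map_mult: "\<lbrakk>x \<in> carrier A; y \<in> carrier A\<rbrakk> \<Longrightarrow> h (x \<otimes>\<^bsub>A\<^esub> y) = h x \<otimes>\<^bsub>B\<^esub> h y"
  and map_add: "\<lbrakk>x \<in> carrier A; y \<in> carrier A\<rbrakk> \<Longrightarrow> h (x \<oplus>\<^bsub>A\<^esub> y) = h x \<oplus>\<^bsub>B\<^esub> h y"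
  and map_smult: "\<lbrakk>r \<in> carrier R; x \<in> carrier A\<rbrakk> \<Longrightarrow> h (r \<odot>\<^bsub>A\<^esub> x) = r \<odot>\<^bsub>B\<^esub> h x"
  using alg_hom by (auto simp: alg_hom_def hom_def Pi_iff)

lemma map_zero [simp]: "h \<zero>\<^bsub>A\<^esub> = \<zero>\<^bsub>B\<^esub>"
  using map_smult[of \<zero> "\<zero>\<^bsub>A\<^esub>"] by simp

lemma map_neg: "x \<in> carrier A \<Longrightarrow> h (\<ominus>\<^bsub>A\<^esub> x) = \<ominus>\<^bsub>B\<^esub> h x"
  using map_smult[of "\<ominus> \<one>" x] by (simp add: A.smult_l_minus B.smult_l_minus)

lemma map_minus: "\<lbrakk>x \<in> carrier A; y \<in> carrier A\<rbrakk> \<Longrightarrow> h (x \<ominus>\<^bsub>A\<^esub> y) = h x \<ominus>\<^bsub>B\<^esub> h y"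
  by (simp add: a_minus_def map_add map_neg)

lemma map_finsum:
  "f \<in> F \<rightarrow> carrier A \<Longrightarrow> h (finsum A f F) = finsum B (\<lambda>i. h (f i)) F"
proof (induction F rule: infinite_finite_induct)
  case (insert x F)
  then show ?case by (simp add: Pi_iff map_add)
qed simp_all

lemma map_list_product:
  "\<lbrakk>xs \<noteq> []; set xs \<subseteq> carrier A\<rbrakk> \<Longrightarrow> h (list_product A xs) = list_product B (map h xs)"
proof (induction xs)
  case (Cons x xs)
  then show ?case
    by (cases "xs = []")
       (simp_all add: A.list_product_Cons B.list_product_Cons map_mult A.list_product_closed)
qed simp

lemma kernel_alg_ideal: "alg_ideal R A {x \<in> carrier A. h x = \<zero>\<^bsub>B\<^esub>}"
  unfolding alg_ideal_def
  by (auto intro!: A.submoduleI simp: map_neg map_add map_smult map_mult A.mult_closed)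

lemma vimage_submodule:
  assumes "submodule H R B"
  shows "submodule {x \<in> carrier A. h x \<in> H} R A"
  by (rule A.submoduleI)
     (use B.submoduleE[OF assms] B.submodule_zero[OF assms] in \<open>auto simp: map_neg map_add map_smult\<close>)

lemma image_submodule:
  assumes H: "submodule H R A"
  shows "submodule (h ` H) R B"
proof (rule B.submoduleI)
  note E = A.submoduleE[OF H]
  show "h ` H \<subseteq> carrier B" using E(1) by auto
  show "\<zero>\<^bsub>B\<^esub> \<in> h ` H" using A.submodule_zero[OF H] map_zero by (metis imageI)
  show "\<ominus>\<^bsub>B\<^esub> a \<in> h ` H" if a: "a \<in> h ` H" for a
  proof -
    obtain x where "x \<in> H" "a = h x" using a by auto
    then have "\<ominus>\<^bsub>B\<^esub> a = h (\<ominus>\<^bsub>A\<^esub> x)" using E(1) map_neg by auto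
    then show ?thesis using E(3) \<open>x \<in> H\<close> by auto
  qed
  show "a \<oplus>\<^bsub>B\<^esub> b \<in> h ` H" if ab: "a \<in> h ` H" "b \<in> h ` H" for a b
  proof -
    obtain x y where "x \<in> H" "y \<in> H" "a = h x" "b = h y" using ab by auto
    then have "a \<oplus>\<^bsub>B\<^esub> b = h (x \<oplus>\<^bsub>A\<^esub> y)" using map_add[of x y] subsetD[OF E(1)] by simp
    then show ?thesis using E(5) \<open>x \<in> H\<close> \<open>y \<in> H\<close> by auto
  qed
  show "r \<odot>\<^bsub>B\<^esub> a \<in> h ` H" if ra: "r \<in> carrier R" "a \<in> h ` H" for r a
  proof -
    obtain x where "x \<in> H" "a = h x" using ra by auto
    then have "r \<odot>\<^bsub>B\<^esub> a = h (r \<odot>\<^bsub>A\<^esub> x)" using E(1) map_smult ra by auto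
    then show ?thesis using E(4) \<open>x \<in> H\<close> ra by auto
  qed
qed

end

text \<open>The laws of an algebra are equations between expressions in the operations, so they pass
  to every structure onto which \<open>A\<close> maps compatibly. For a quotient this leaves only
  the computation of the operations on representatives.\<close>

lemma nonunital_algebra_surj_image:
  fixes R (structure)
  assumes A: "nonunital_algebra R A"
    and surj: "carrier B = q ` carrier A"
    and zero: "\<zero>\<^bsub>B\<^esub> = q \<zero>\<^bsub>A\<^esub>"
    and add: "\<And>x y. \<lbrakk>x \<in> carrier A; y \<in> carrier A\<rbrakk> \<Longrightarrow> q x \<oplus>\<^bsub>B\<^esub> q y = q (x \<oplus>\<^bsub>A\<^esub> y)"
    and mult: "\<And>x y. \<lbrakk>x \<in> carrier A; y \<in> carrier A\<rbrakk> \<Longrightarrow> q x \<otimes>\<^bsub>B\<^esub> q y = q (x \<otimes>\<^bsub>A\<^esub> y)"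
    and smult: "\<And>r x. \<lbrakk>r \<in> carrier R; x \<in> carrier A\<rbrakk> \<Longrightarrow> r \<odot>\<^bsub>B\<^esub> q x = q (r \<odot>\<^bsub>A\<^esub> x)"
  shows "nonunital_algebra R B" and "q \<in> alg_hom R A B"
proof -
  interpret A: nonunital_algebra R A by fact
  have B: "abelian_group B"
  proof (rule abelian_groupI)
    show "\<exists>y\<in>carrier B. y \<oplus>\<^bsub>B\<^esub> x = \<zero>\<^bsub>B\<^esub>" if x: "x \<in> carrier B" for x
    proof -
      obtain a where a: "a \<in> carrier A" "x = q a" using x surj by auto
      then have "q (\<ominus>\<^bsub>A\<^esub> a) \<oplus>\<^bsub>B\<^esub> x = \<zero>\<^bsub>B\<^esub>" by (simp add: add zero A.M.l_neg)
      then show ?thesis using a surj by auto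
    qed
  qed (auto simp: surj zero add A.M.add.m_ac)
  show "nonunital_algebra R B"
  proof (rule nonunital_algebraI, rule moduleI)
    show "cring R" ..
  qed (use B in \<open>auto simp: surj zero add mult smult A.smult_l_distr A.smult_r_distr A.smult_assoc1
         A.mult_closed A.mult_assoc A.mult_distrib_left A.mult_distrib_right
         A.smult_mult_left A.smult_mult_right\<close>)
  show "q \<in> alg_hom R A B"
    by (auto simp: alg_hom_def hom_def surj add mult smult)
qed

context nonunital_algebra begin

lemma quotient_alg_ideal:
  assumes I: "alg_ideal R A I"
  shows "nonunital_algebra R (quotient_alg A I)"
    and "(\<lambda>x. I +>\<^bsub>A\<^esub> x) \<in> alg_hom R A (quotient_alg A I)"
    and "carrier (quotient_alg A I) = (\<lambda>x. I +>\<^bsub>A\<^esub> x) ` carrier A"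
    and "\<And>x. x \<in> carrier A \<Longrightarrow> I +>\<^bsub>A\<^esub> x = \<zero>\<^bsub>quotient_alg A I\<^esub> \<longleftrightarrow> x \<in> I"
proof -
  note S = submoduleE[OF alg_idealD(1)[OF I]]
  have sub: "subgroup I (add_monoid A)"
    using alg_idealD(1)[OF I] by (auto simp: submodule_def)
  interpret abelian_subgroup I A
    using sub M.a_comm_group by (intro abelian_subgroupI2)
  have eq: "I +>\<^bsub>A\<^esub> x = I +>\<^bsub>A\<^esub> y" if "x \<in> carrier A" "y \<in> carrier A" "i \<in> I" "x = i \<oplus>\<^bsub>A\<^esub> y" for x y i
    using a_repr_independence'[of x y] that by (auto simp: a_r_coset_def r_coset_def)
  have elem: "\<exists>i\<in>I. x' = i \<oplus>\<^bsub>A\<^esub> x" if "x' \<in> I +>\<^bsub>A\<^esub> x" for x x'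
    using that by (auto simp: a_r_coset_def r_coset_def)
  have self: "x \<in> I +>\<^bsub>A\<^esub> x" if "x \<in> carrier A" for x
    using a_rcos_self that by auto
  show carr: "carrier (quotient_alg A I) = (\<lambda>x. I +>\<^bsub>A\<^esub> x) ` carrier A"
    by (auto simp: quotient_alg_def FactRing_def A_RCOSETS_defs a_r_coset_def)
  have zero: "\<zero>\<^bsub>quotient_alg A I\<^esub> = I +>\<^bsub>A\<^esub> \<zero>\<^bsub>A\<^esub>"
    using S(1) by (simp add: quotient_alg_def FactRing_def)
  have add: "(I +>\<^bsub>A\<^esub> x) \<oplus>\<^bsub>quotient_alg A I\<^esub> (I +>\<^bsub>A\<^esub> y) = I +>\<^bsub>A\<^esub> (x \<oplus>\<^bsub>A\<^esub> y)"
    if "x \<in> carrier A" "y \<in> carrier A" for x y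
    using that by (simp add: quotient_alg_def FactRing_def a_rcos_sum)
  have mult: "(I +>\<^bsub>A\<^esub> x) \<otimes>\<^bsub>quotient_alg A I\<^esub> (I +>\<^bsub>A\<^esub> y) = I +>\<^bsub>A\<^esub> (x \<otimes>\<^bsub>A\<^esub> y)"
    if xy: "x \<in> carrier A" "y \<in> carrier A" for x y
  proof -
    have "I +>\<^bsub>A\<^esub> (x' \<otimes>\<^bsub>A\<^esub> y') = I +>\<^bsub>A\<^esub> (x \<otimes>\<^bsub>A\<^esub> y)"
      if x': "x' \<in> I +>\<^bsub>A\<^esub> x" and y': "y' \<in> I +>\<^bsub>A\<^esub> y" for x' y'
    proof -
      obtain i j where ij: "i \<in> I" "x' = i \<oplus>\<^bsub>A\<^esub> x" "j \<in> I" "y' = j \<oplus>\<^bsub>A\<^esub> y" using elem[OF x'] elem[OF y'] by blast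
      have c: "i \<in> carrier A" "j \<in> carrier A" using ij S(1) by auto
      \<comment> \<open>In the expansion of \<open>(i + x)(j + y)\<close> every term except
        \<open>x y\<close> has a factor in the ideal; the grouping uses absorption from the right
        for \<open>i\<close> and from the left for \<open>j\<close>.\<close>
      have e: "x' \<otimes>\<^bsub>A\<^esub> y' = (i \<otimes>\<^bsub>A\<^esub> (j \<oplus>\<^bsub>A\<^esub> y) \<oplus>\<^bsub>A\<^esub> x \<otimes>\<^bsub>A\<^esub> j) \<oplus>\<^bsub>A\<^esub> x \<otimes>\<^bsub>A\<^esub> y"
        unfolding ij(2,4) using xy c
        by (simp add: mult_distrib_left mult_distrib_right mult_closed M.add.m_ac)
      then show ?thesis
        using ij xy c by (intro eq[OF _ _ _ e] S(5) alg_idealD(2,3)[OF I]) (simp_all add: mult_closed)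
    qed
    \<comment> \<open>The product of two cosets is a union over all pairs of representatives. All
      members of the union are the same coset, and \<open>self\<close> provides a pair, so the union
      is not empty.\<close>
    then have "(\<Union>a\<in>I +>\<^bsub>A\<^esub> x. \<Union>b\<in>I +>\<^bsub>A\<^esub> y. I +>\<^bsub>A\<^esub> (a \<otimes>\<^bsub>A\<^esub> b)) = I +>\<^bsub>A\<^esub> (x \<otimes>\<^bsub>A\<^esub> y)"
      using self[OF xy(1)] self[OF xy(2)] by (metis (no_types, lifting) UN_constant_eq)
    then show ?thesis
      by (simp add: quotient_alg_def FactRing_def rcoset_mult_def)
  qed
  have smult: "r \<odot>\<^bsub>quotient_alg A I\<^esub> (I +>\<^bsub>A\<^esub> x) = I +>\<^bsub>A\<^esub> (r \<odot>\<^bsub>A\<^esub> x)"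
    if rx: "r \<in> carrier R" "x \<in> carrier A" for r x
  proof -
    have "I +>\<^bsub>A\<^esub> (r \<odot>\<^bsub>A\<^esub> x') = I +>\<^bsub>A\<^esub> (r \<odot>\<^bsub>A\<^esub> x)" if x': "x' \<in> I +>\<^bsub>A\<^esub> x" for x'
    proof -
      obtain i where i: "i \<in> I" "x' = i \<oplus>\<^bsub>A\<^esub> x" using elem[OF x'] by blast
      then show ?thesis
        using S(1) rx S(4)[of r i] by (intro eq[of _ _ "r \<odot>\<^bsub>A\<^esub> i"]) (auto simp: smult_r_distr)
    qed
    then have "(\<Union>x'\<in>I +>\<^bsub>A\<^esub> x. I +>\<^bsub>A\<^esub> (r \<odot>\<^bsub>A\<^esub> x')) = I +>\<^bsub>A\<^esub> (r \<odot>\<^bsub>A\<^esub> x)"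
      using self[OF rx(2)] by (metis (no_types, lifting) UN_constant_eq)
    then show ?thesis
      by (simp add: quotient_alg_def)
  qed
  show "nonunital_algebra R (quotient_alg A I)"
    and "(\<lambda>x. I +>\<^bsub>A\<^esub> x) \<in> alg_hom R A (quotient_alg A I)"
    using nonunital_algebra_surj_image[OF nonunital_algebra_axioms carr zero add mult smult] by auto
  show "I +>\<^bsub>A\<^esub> x = \<zero>\<^bsub>quotient_alg A I\<^esub> \<longleftrightarrow> x \<in> I" if "x \<in> carrier A" for x
    using a_rcos_const[of x] self[OF that] by (auto simp: quotient_alg_def FactRing_def)
qed

end


section \<open>The free algebra\<close>

definition word_elem :: "('r, 'm) ring_scheme \<Rightarrow> 'x list \<Rightarrow> 'x list \<Rightarrow> 'r" where
  "word_elem R w = (\<lambda>w'. if w' = w then \<one>\<^bsub>R\<^esub> else \<zero>\<^bsub>R\<^esub>)"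

lemma free_gen_eq: "free_gen R x = word_elem R [x]"
  by (simp add: free_gen_def word_elem_def)

locale free_algebra = cring R for R (structure) +
  fixes X :: "'x set"
begin

abbreviation FA where "FA \<equiv> free_alg R X"

lemma free_carrier_iff:
  "f \<in> carrier FA \<longleftrightarrow> (\<forall>w. f w \<in> carrier R) \<and> finite {w. f w \<noteq> \<zero>} \<and>
    (\<forall>w. f w \<noteq> \<zero> \<longrightarrow> w \<noteq> [] \<and> set w \<subseteq> X)"
  by (auto simp: free_alg_def)

lemma free_zero: "\<zero>\<^bsub>FA\<^esub> = (\<lambda>w. \<zero>)"
  and free_add: "f \<oplus>\<^bsub>FA\<^esub> g = (\<lambda>w. f w \<oplus> g w)"
  and free_smult: "r \<odot>\<^bsub>FA\<^esub> f = (\<lambda>w. r \<otimes> f w)"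
  and free_mult: "f \<otimes>\<^bsub>FA\<^esub> g = (\<lambda>w. finsum R (\<lambda>i. f (take i w) \<otimes> g (drop i w)) {..length w})"
  by (simp_all add: free_alg_def)

lemma free_coeff [simp]: "f \<in> carrier FA \<Longrightarrow> f w \<in> carrier R"
  by (simp add: free_carrier_iff)

lemma free_zero_closed: "(\<lambda>w. \<zero>) \<in> carrier FA"
  by (simp add: free_carrier_iff)

lemma free_add_closed:
  assumes "f \<in> carrier FA" "g \<in> carrier FA"
  shows "f \<oplus>\<^bsub>FA\<^esub> g \<in> carrier FA"
proof -
  have "{w. f w \<oplus> g w \<noteq> \<zero>} \<subseteq> {w. f w \<noteq> \<zero>} \<union> {w. g w \<noteq> \<zero>}" by auto
  then have "finite {w. f w \<oplus> g w \<noteq> \<zero>}"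
    by (rule finite_subset) (use assms in \<open>auto simp: free_carrier_iff\<close>)
  moreover have "w \<noteq> [] \<and> set w \<subseteq> X" if "f w \<oplus> g w \<noteq> \<zero>" for w
    using that assms by (cases "f w = \<zero>"; cases "g w = \<zero>") (auto simp: free_carrier_iff)
  ultimately show ?thesis
    using assms by (simp add: free_carrier_iff free_add)
qed

lemma free_smult_closed:
  assumes "r \<in> carrier R" "f \<in> carrier FA"
  shows "r \<odot>\<^bsub>FA\<^esub> f \<in> carrier FA"
proof -
  have "{w. r \<otimes> f w \<noteq> \<zero>} \<subseteq> {w. f w \<noteq> \<zero>}" using assms by auto
  then have "finite {w. r \<otimes> f w \<noteq> \<zero>}"
    by (rule finite_subset) (use assms in \<open>auto simp: free_carrier_iff\<close>)
  moreover have "w \<noteq> [] \<and> set w \<subseteq> X" if "r \<otimes> f w \<noteq> \<zero>" for w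
    using that assms by (cases "f w = \<zero>") (auto simp: free_carrier_iff)
  ultimately show ?thesis
    using assms by (simp add: free_carrier_iff free_smult)
qed

lemma free_module: "module R FA"
proof (rule moduleI)
  show "abelian_group FA"
  proof (rule abelian_groupI)
    show "\<exists>g\<in>carrier FA. g \<oplus>\<^bsub>FA\<^esub> f = \<zero>\<^bsub>FA\<^esub>" if f: "f \<in> carrier FA" for f
      using free_smult_closed[of "\<ominus> \<one>" f] f
      by (intro bexI[of _ "(\<ominus> \<one>) \<odot>\<^bsub>FA\<^esub> f"]) (simp_all add: free_add free_smult free_zero l_minus l_neg)
  qed (use free_add_closed free_zero_closed in \<open>auto simp: free_add free_zero a_ac\<close>)
  show "cring R" ..
qed (use free_smult_closed in \<open>auto simp: free_smult free_add l_distr r_distr m_assoc\<close>)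

lemma free_mult_coeff [simp]:
  assumes "f \<in> carrier FA" "g \<in> carrier FA"
  shows "(f \<otimes>\<^bsub>FA\<^esub> g) w \<in> carrier R"
  unfolding free_mult by (rule finsum_closed) (use assms in auto)

text \<open>The coefficient at \<open>w\<close> is a sum over the ways to cut \<open>w\<close> in
  two, so some cut has two nonzero factors. This bounds the support of a product here and makes
  degrees additive in the grading.\<close>

lemma free_mult_nonzero:
  assumes f: "f \<in> carrier FA" and g: "g \<in> carrier FA" and w: "(f \<otimes>\<^bsub>FA\<^esub> g) w \<noteq> \<zero>"
  shows "\<exists>u v. w = u @ v \<and> f u \<noteq> \<zero> \<and> g v \<noteq> \<zero>"
proof (rule ccontr)
  assume no: "\<nexists>u v. w = u @ v \<and> f u \<noteq> \<zero> \<and> g v \<noteq> \<zero>"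
  have z: "f (take i w) = \<zero> \<or> g (drop i w) = \<zero>" for i
    using no append_take_drop_id[of i w] by metis
  have "f (take i w) \<otimes> g (drop i w) = \<zero>" for i
    using z[of i] f g by auto
  then have "(f \<otimes>\<^bsub>FA\<^esub> g) w = \<zero>"
    by (simp add: free_mult)
  then show False using w by simp
qed

lemma free_mult_closed:
  assumes f: "f \<in> carrier FA" and g: "g \<in> carrier FA"
  shows "f \<otimes>\<^bsub>FA\<^esub> g \<in> carrier FA"
proof -
  have "{w. (f \<otimes>\<^bsub>FA\<^esub> g) w \<noteq> \<zero>} \<subseteq> (\<lambda>(u, v). u @ v) ` ({w. f w \<noteq> \<zero>} \<times> {w. g w \<noteq> \<zero>})"
    using free_mult_nonzero[OF f g] by force
  then have "finite {w. (f \<otimes>\<^bsub>FA\<^esub> g) w \<noteq> \<zero>}"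
    by (rule finite_subset) (use assms in \<open>auto simp: free_carrier_iff\<close>)
  moreover have "w \<noteq> [] \<and> set w \<subseteq> X" if w: "(f \<otimes>\<^bsub>FA\<^esub> g) w \<noteq> \<zero>" for w
  proof -
    obtain u v where "w = u @ v" "f u \<noteq> \<zero>" "g v \<noteq> \<zero>" using free_mult_nonzero[OF f g w] by blast
    then show ?thesis using f g by (simp add: free_carrier_iff)
  qed
  ultimately show ?thesis
    using free_mult_coeff[OF f g] by (simp add: free_carrier_iff)
qed

lemma free_distrib_right:
  assumes "f \<in> carrier FA" "g \<in> carrier FA" "h \<in> carrier FA"
  shows "(f \<oplus>\<^bsub>FA\<^esub> g) \<otimes>\<^bsub>FA\<^esub> h = (f \<otimes>\<^bsub>FA\<^esub> h) \<oplus>\<^bsub>FA\<^esub> (g \<otimes>\<^bsub>FA\<^esub> h)"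
  using assms by (auto simp: fun_eq_iff free_mult free_add l_distr)

lemma free_distrib_left:
  assumes "f \<in> carrier FA" "g \<in> carrier FA" "h \<in> carrier FA"
  shows "f \<otimes>\<^bsub>FA\<^esub> (g \<oplus>\<^bsub>FA\<^esub> h) = (f \<otimes>\<^bsub>FA\<^esub> g) \<oplus>\<^bsub>FA\<^esub> (f \<otimes>\<^bsub>FA\<^esub> h)"
  using assms by (auto simp: fun_eq_iff free_mult free_add r_distr)

lemma free_smult_mult_left:
  assumes "r \<in> carrier R" "f \<in> carrier FA" "g \<in> carrier FA"
  shows "(r \<odot>\<^bsub>FA\<^esub> f) \<otimes>\<^bsub>FA\<^esub> g = r \<odot>\<^bsub>FA\<^esub> (f \<otimes>\<^bsub>FA\<^esub> g)"
  using assms by (auto simp: fun_eq_iff free_mult free_smult finsum_rdistr m_assoc intro!: finsum_cong')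

lemma free_smult_mult_right:
  assumes "r \<in> carrier R" "f \<in> carrier FA" "g \<in> carrier FA"
  shows "f \<otimes>\<^bsub>FA\<^esub> (r \<odot>\<^bsub>FA\<^esub> g) = r \<odot>\<^bsub>FA\<^esub> (f \<otimes>\<^bsub>FA\<^esub> g)"
  using assms by (auto simp: fun_eq_iff free_mult free_smult finsum_rdistr m_lcomm intro!: finsum_cong')

lemma word_elem_closed: "\<lbrakk>w \<noteq> []; set w \<subseteq> X\<rbrakk> \<Longrightarrow> word_elem R w \<in> carrier FA"
  by (auto simp: free_carrier_iff word_elem_def split: if_splits)

text \<open>Each element is a combination of the words in its finite support; the induction erases
  one word \<open>u\<close> of the support at a time. It reduces multilinear identities to
  words.\<close>

lemma free_induct [consumes 1, case_names zero word add smult]: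
  assumes f: "f \<in> carrier FA"
    and zero: "P \<zero>\<^bsub>FA\<^esub>"
    and word: "\<And>w. \<lbrakk>w \<noteq> []; set w \<subseteq> X\<rbrakk> \<Longrightarrow> P (word_elem R w)"
    and add: "\<And>f g. \<lbrakk>f \<in> carrier FA; g \<in> carrier FA; P f; P g\<rbrakk> \<Longrightarrow> P (f \<oplus>\<^bsub>FA\<^esub> g)"
    and smult: "\<And>r f. \<lbrakk>r \<in> carrier R; f \<in> carrier FA; P f\<rbrakk> \<Longrightarrow> P (r \<odot>\<^bsub>FA\<^esub> f)"
  shows "P f"
proof -
  have "P f" if "finite T" "{w. f w \<noteq> \<zero>} \<subseteq> T" "f \<in> carrier FA" for T f
    using that
  proof (induction T arbitrary: f rule: finite_induct)
    case empty
    then have "f = \<zero>\<^bsub>FA\<^esub>" by (auto simp: free_zero fun_eq_iff)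
    then show ?case using zero by simp
  next
    case (insert u T)
    show ?case
    proof (cases "f u = \<zero>")
      case True
      then show ?thesis using insert by blast
    next
      case False
      define g where "g = f(u := \<zero>)"
      have u: "u \<noteq> []" "set u \<subseteq> X" using False insert.prems by (auto simp: free_carrier_iff)
      have "finite {w. g w \<noteq> \<zero>}"
        by (rule finite_subset[of _ "{w. f w \<noteq> \<zero>}"])
           (use insert.prems(2) in \<open>auto simp: free_carrier_iff g_def\<close>)
      then have g: "g \<in> carrier FA"
        using insert.prems(2) by (auto simp: free_carrier_iff g_def)
      have "P g" using insert.prems by (intro insert.IH g) (auto simp: g_def)
      moreover have "f = (f u \<odot>\<^bsub>FA\<^esub> word_elem R u) \<oplus>\<^bsub>FA\<^esub> g"
        using insert.prems(2) by (auto simp: fun_eq_iff free_add free_smult word_elem_def g_def)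
      ultimately show ?thesis
        using add[of "f u \<odot>\<^bsub>FA\<^esub> word_elem R u" g] smult[of "f u" "word_elem R u"] word[OF u]
          word_elem_closed[OF u] free_smult_closed insert.prems(2) g by simp
    qed
  qed
  then show ?thesis using f by (auto simp: free_carrier_iff)
qed

lemma word_elem_mult: "word_elem R u \<otimes>\<^bsub>FA\<^esub> word_elem R v = word_elem R (u @ v)"
proof
  fix w
  let ?t = "\<lambda>i. word_elem R u (take i w) \<otimes> word_elem R v (drop i w)"
  show "(word_elem R u \<otimes>\<^bsub>FA\<^esub> word_elem R v) w = word_elem R (u @ v) w"
  proof (cases "w = u @ v")
    case True
    have "finsum R ?t {..length w} = finsum R (\<lambda>i. if i = length u then \<one> else \<zero>) {..length w}"
    proof (rule finsum_cong')
      fix i assume "i \<in> {..length w}"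
      then have "length (take i w) = i" by simp
      \<comment> \<open>Every cut other than the one after \<open>length u\<close> letters yields a
        prefix of the wrong length.\<close>
      then have "take i w = u \<longleftrightarrow> i = length u" using True by (metis append_eq_conv_conj)
      then show "?t i = (if i = length u then \<one> else \<zero>)" by (auto simp: True word_elem_def)
    qed (auto simp: word_elem_def)
    also have "\<dots> = \<one>"
      using add.finprod_singleton_swap[of "length u" "{..length w}" "\<lambda>_. \<one>"] True by simp
    finally show ?thesis by (simp add: free_mult True word_elem_def)
  next
    case False
    have "?t i = \<zero>" for i
      using False append_take_drop_id[of i w] by (auto simp: word_elem_def)
    then show ?thesis using False by (simp add: free_mult word_elem_def)
  qed
qed

text \<open>A comparison of coefficients would need a double sum over two cuts. Both sides are
  linear in each argument, so the three arguments are reduced to words one after the other, and for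
  words the claim is associativity of append.\<close>

lemma free_mult_assoc:
  assumes f: "f \<in> carrier FA" and g: "g \<in> carrier FA" and h: "h \<in> carrier FA"
  shows "(f \<otimes>\<^bsub>FA\<^esub> g) \<otimes>\<^bsub>FA\<^esub> h = f \<otimes>\<^bsub>FA\<^esub> (g \<otimes>\<^bsub>FA\<^esub> h)"
proof -
  interpret F: module R FA by (rule free_module)
  note simps = free_mult_closed free_smult_closed word_elem_closed
    free_distrib_left free_distrib_right free_smult_mult_left free_smult_mult_right
  have zl: "\<zero>\<^bsub>FA\<^esub> \<otimes>\<^bsub>FA\<^esub> f = \<zero>\<^bsub>FA\<^esub>" and zr: "f \<otimes>\<^bsub>FA\<^esub> \<zero>\<^bsub>FA\<^esub> = \<zero>\<^bsub>FA\<^esub>" if "f \<in> carrier FA" for f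
    using that by (simp_all add: fun_eq_iff free_mult free_zero)
  have 1: "(word_elem R u \<otimes>\<^bsub>FA\<^esub> word_elem R v) \<otimes>\<^bsub>FA\<^esub> h = word_elem R u \<otimes>\<^bsub>FA\<^esub> (word_elem R v \<otimes>\<^bsub>FA\<^esub> h)"
    if uv: "u \<noteq> []" "set u \<subseteq> X" "v \<noteq> []" "set v \<subseteq> X" for u v
    using h
  proof (induction h rule: free_induct)
    case (word w)
    then show ?case by (simp add: word_elem_mult)
  qed (use uv in \<open>simp_all add: simps zr\<close>)
  have 2: "(word_elem R u \<otimes>\<^bsub>FA\<^esub> g) \<otimes>\<^bsub>FA\<^esub> h = word_elem R u \<otimes>\<^bsub>FA\<^esub> (g \<otimes>\<^bsub>FA\<^esub> h)"
    if uv: "u \<noteq> []" "set u \<subseteq> X" for u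
    using g
  proof (induction g rule: free_induct)
    case (word w)
    then show ?case using 1 uv by simp
  qed (use uv h in \<open>simp_all add: simps zl zr\<close>)
  show ?thesis
    using f
  proof (induction f rule: free_induct)
    case (word w)
    then show ?case using 2 by simp
  qed (use g h in \<open>simp_all add: simps zl\<close>)
qed

lemma free_nonunital_algebra: "nonunital_algebra R FA"
  using free_module free_mult_closed free_mult_assoc free_distrib_right free_distrib_left
    free_smult_mult_left free_smult_mult_right
  by (intro nonunital_algebraI)

sublocale F: nonunital_algebra R FA by (rule free_nonunital_algebra)

lemma word_elem_list_product:
  "\<lbrakk>w \<noteq> []; set w \<subseteq> X\<rbrakk> \<Longrightarrow> word_elem R w = list_product FA (map (free_gen R) w)"
proof (induction w)
  case (Cons x w)
  then show ?case
    by (cases "w = []")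
       (use word_elem_mult[of "[x]" w] in \<open>auto simp: free_gen_eq F.list_product_Cons\<close>)
qed simp

lemma free_gen_closed: "x \<in> X \<Longrightarrow> free_gen R x \<in> carrier FA"
  by (simp add: free_gen_eq word_elem_closed)

lemma free_generated: "subalg R FA B \<Longrightarrow> free_gen R ` X \<subseteq> B \<Longrightarrow> carrier FA \<subseteq> B"
proof
  fix f assume B: "subalg R FA B" "free_gen R ` X \<subseteq> B" and f: "f \<in> carrier FA"
  have sub: "submodule B R FA" and mult: "\<And>x y. x \<in> B \<Longrightarrow> y \<in> B \<Longrightarrow> x \<otimes>\<^bsub>FA\<^esub> y \<in> B"
    using B(1) by (auto simp: subalg_def)
  show "f \<in> B" using f
  proof (induction f rule: free_induct)
    case zero
    then show ?case using F.submodule_zero[OF sub] .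
  next
    case (word w)
    then show ?case
    proof (induction w)
      case (Cons x w)
      then have "word_elem R [x] \<in> B" using B(2) by (auto simp: free_gen_eq)
      then show ?case using Cons mult[of "word_elem R [x]" "word_elem R w"]
        by (cases "w = []") (auto simp: word_elem_mult)
    qed simp
  qed (use F.submoduleE(4,5)[OF sub] in auto)
qed

end

section \<open>Extending a map on letters to a homomorphism on the free algebra\<close>

locale free_algebra_lift = nonunital_algebra R A + free_algebra R X
  for R (structure) and A (structure) and X :: "'x set" +
  fixes S :: "'x \<Rightarrow> _"
  assumes S_carrier: "S \<in> X \<rightarrow> carrier A"
begin

definition lift where
  "lift f = finsum A (\<lambda>w. f w \<odot>\<^bsub>A\<^esub> list_product A (map S w)) {w. f w \<noteq> \<zero>}"

lemma list_product_map_closed: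
  "\<lbrakk>w \<noteq> []; set w \<subseteq> X\<rbrakk> \<Longrightarrow> list_product A (map S w) \<in> carrier A"
  using S_carrier by (intro list_product_closed) auto

text \<open>Elements to be compared have different supports, so the defining sum must be movable to
  a common finite set. That set may contain only nonempty words, because \<open>list_product\<close>
  has no meaningful value at the empty list.\<close>

lemma lift_superset:
  assumes f: "f \<in> carrier FA" and T: "finite T" "{w. f w \<noteq> \<zero>} \<subseteq> T" "T \<subseteq> {w. w \<noteq> [] \<and> set w \<subseteq> X}"
  shows "lift f = finsum A (\<lambda>w. f w \<odot>\<^bsub>A\<^esub> list_product A (map S w)) T"
  unfolding lift_def
  by (rule M.add.finprod_mono_neutral_cong_left) (use f T list_product_map_closed in auto)

lemma free_support: "f \<in> carrier FA \<Longrightarrow> finite {w. f w \<noteq> \<zero>} \<and> {w. f w \<noteq> \<zero>} \<subseteq> {w. w \<noteq> [] \<and> set w \<subseteq> X}"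
  by (auto simp: free_carrier_iff)

lemma lift_closed:
  assumes "f \<in> carrier FA"
  shows "lift f \<in> carrier A"
  unfolding lift_def
  by (rule M.finsum_closed)
     (use assms free_support[OF assms] list_product_map_closed in \<open>auto intro!: smult_closed\<close>)

lemma lift_add:
  assumes f: "f \<in> carrier FA" and g: "g \<in> carrier FA"
  shows "lift (f \<oplus>\<^bsub>FA\<^esub> g) = lift f \<oplus>\<^bsub>A\<^esub> lift g"
proof -
  let ?T = "{w. f w \<noteq> \<zero>} \<union> {w. g w \<noteq> \<zero>}"
  have T: "finite ?T" "?T \<subseteq> {w. w \<noteq> [] \<and> set w \<subseteq> X}"
    using free_support[OF f] free_support[OF g] by auto
  have "{w. (f \<oplus>\<^bsub>FA\<^esub> g) w \<noteq> \<zero>} \<subseteq> ?T" by (auto simp: free_add)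
  then have "lift (f \<oplus>\<^bsub>FA\<^esub> g) = finsum A (\<lambda>w. (f \<oplus>\<^bsub>FA\<^esub> g) w \<odot>\<^bsub>A\<^esub> list_product A (map S w)) ?T"
    using lift_superset[OF free_add_closed[OF f g]] T by blast
  also have "\<dots> = finsum A (\<lambda>w. f w \<odot>\<^bsub>A\<^esub> list_product A (map S w) \<oplus>\<^bsub>A\<^esub> g w \<odot>\<^bsub>A\<^esub> list_product A (map S w)) ?T"
    using T f g list_product_map_closed
    by (intro M.finsum_cong') (auto simp: free_add smult_l_distr)
  also have "\<dots> = finsum A (\<lambda>w. f w \<odot>\<^bsub>A\<^esub> list_product A (map S w)) ?T \<oplus>\<^bsub>A\<^esub> finsum A (\<lambda>w. g w \<odot>\<^bsub>A\<^esub> list_product A (map S w)) ?T"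
    by (rule M.finsum_addf) (use T f g list_product_map_closed in auto)
  also have "\<dots> = lift f \<oplus>\<^bsub>A\<^esub> lift g"
    using lift_superset[OF f T(1) _ T(2)] lift_superset[OF g T(1) _ T(2)] by simp
  finally show ?thesis .
qed

lemma lift_smult:
  assumes r: "r \<in> carrier R" and f: "f \<in> carrier FA"
  shows "lift (r \<odot>\<^bsub>FA\<^esub> f) = r \<odot>\<^bsub>A\<^esub> lift f"
proof -
  let ?T = "{w. f w \<noteq> \<zero>}"
  have T: "finite ?T" "?T \<subseteq> {w. w \<noteq> [] \<and> set w \<subseteq> X}"
    using free_support[OF f] by auto
  have "{w. (r \<odot>\<^bsub>FA\<^esub> f) w \<noteq> \<zero>} \<subseteq> ?T" using r by (auto simp: free_smult)
  then have "lift (r \<odot>\<^bsub>FA\<^esub> f) = finsum A (\<lambda>w. (r \<odot>\<^bsub>FA\<^esub> f) w \<odot>\<^bsub>A\<^esub> list_product A (map S w)) ?T"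
    using lift_superset[OF free_smult_closed[OF r f]] T by blast
  also have "\<dots> = finsum A (\<lambda>w. r \<odot>\<^bsub>A\<^esub> (f w \<odot>\<^bsub>A\<^esub> list_product A (map S w))) ?T"
    using T f r list_product_map_closed
    by (intro M.finsum_cong') (auto simp: free_smult smult_assoc1)
  also have "\<dots> = r \<odot>\<^bsub>A\<^esub> lift f"
    unfolding lift_def
    by (rule finsum_smult_ldistr[symmetric]) (use T f r list_product_map_closed in auto)
  finally show ?thesis .
qed

lemma lift_word:
  assumes "w \<noteq> []" "set w \<subseteq> X"
  shows "lift (word_elem R w) = list_product A (map S w)"
proof -
  have "lift (word_elem R w) = finsum A (\<lambda>u. word_elem R w u \<odot>\<^bsub>A\<^esub> list_product A (map S u)) {w}"
    using assms by (intro lift_superset word_elem_closed) (auto simp: word_elem_def)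
  then show ?thesis using list_product_map_closed[OF assms] by (simp add: word_elem_def)
qed

lemma lift_gen: "x \<in> X \<Longrightarrow> lift (free_gen R x) = S x"
  by (simp add: free_gen_eq lift_word)

lemma lift_zero: "lift \<zero>\<^bsub>FA\<^esub> = \<zero>\<^bsub>A\<^esub>"
  by (simp add: lift_def free_zero)

text \<open>By bilinearity only two words have to be multiplied, which is
  \<open>list_product_append\<close>.\<close>

lemma lift_mult:
  assumes f: "f \<in> carrier FA" and g: "g \<in> carrier FA"
  shows "lift (f \<otimes>\<^bsub>FA\<^esub> g) = lift f \<otimes>\<^bsub>A\<^esub> lift g"
proof -
  note simps = lift_add lift_smult lift_zero lift_closed F.mult_closed word_elem_closed
    mult_distrib_left mult_distrib_right smult_mult_left smult_mult_right
    F.mult_distrib_left F.mult_distrib_right F.smult_mult_left F.smult_mult_right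
  have 1: "lift (word_elem R u \<otimes>\<^bsub>FA\<^esub> g) = lift (word_elem R u) \<otimes>\<^bsub>A\<^esub> lift g"
    if u: "u \<noteq> []" "set u \<subseteq> X" for u
    using g
  proof (induction g rule: free_induct)
    case (word v)
    have "set (map S u) \<subseteq> carrier A" "set (map S v) \<subseteq> carrier A"
      using S_carrier u word by auto
    then show ?case
      using u word lift_word[of "u @ v"] lift_word[OF u] lift_word[OF word]
        list_product_append[of "map S u" "map S v"]
      by (simp add: word_elem_mult)
  qed (use u in \<open>simp_all add: simps\<close>)
  show ?thesis
    using f
  proof (induction f rule: free_induct)
    case (word u)
    then show ?case using 1 by simp
  qed (use g in \<open>simp_all add: simps\<close>)
qed

lemma lift_alg_hom: "lift \<in> alg_hom R FA A"
  by (auto simp: alg_hom_def hom_def lift_closed lift_mult lift_add lift_smult)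

end


section \<open>Maximal compatible sets of paths\<close>

context kgraph
begin

section \<open>Unique factorisation and the prefix order\<close>

definition prefix_of :: "'a \<Rightarrow> 'a \<Rightarrow> bool" (infix \<open>\<preceq>\<close> 50) where
  "\<alpha> \<preceq> \<tau> \<longleftrightarrow> \<alpha> \<in> Mor \<Lambda> \<and> (\<exists>\<nu>\<in>Mor \<Lambda>. Src \<Lambda> \<alpha> = Rng \<Lambda> \<nu> \<and> \<tau> = Comp \<Lambda> \<alpha> \<nu>)"

text \<open>Degrees add and cancel, so equal degrees on the left force equal degrees on the right,
  and the factorisation property applies to both pairs.\<close>

lemma factorisation_unique:
  assumes "\<mu> \<in> Mor \<Lambda>" "\<nu> \<in> Mor \<Lambda>" "Src \<Lambda> \<mu> = Rng \<Lambda> \<nu>"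
    and "\<mu>' \<in> Mor \<Lambda>" "\<nu>' \<in> Mor \<Lambda>" "Src \<Lambda> \<mu>' = Rng \<Lambda> \<nu>'"
    and eq: "Comp \<Lambda> \<mu> \<nu> = Comp \<Lambda> \<mu>' \<nu>'" and deg: "Deg \<Lambda> \<mu> = Deg \<Lambda> \<mu>'"
  shows "\<mu> = \<mu>' \<and> \<nu> = \<nu>'"
proof -
  let ?P = "\<lambda>(\<kappa>, \<xi>). \<kappa> \<in> Mor \<Lambda> \<and> \<xi> \<in> Mor \<Lambda> \<and> Src \<Lambda> \<kappa> = Rng \<Lambda> \<xi> \<and> Comp \<Lambda> \<mu> \<nu> = Comp \<Lambda> \<kappa> \<xi> \<and>
              Deg \<Lambda> \<kappa> = Deg \<Lambda> \<mu> \<and> Deg \<Lambda> \<xi> = Deg \<Lambda> \<nu>"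
  have "Deg \<Lambda> \<mu> + Deg \<Lambda> \<nu> = Deg \<Lambda> \<mu>' + Deg \<Lambda> \<nu>'"
    using assms Deg_Comp by metis
  then have "Deg \<Lambda> \<nu> = Deg \<Lambda> \<nu>'" using deg by simp
  then have "?P (\<mu>', \<nu>')" using assms by simp
  moreover have "?P (\<mu>, \<nu>)" using assms by simp
  moreover have "\<exists>!p. ?P p"
    by (rule factorisation[OF Comp_closed[OF assms(1-3)] Deg_Comp[OF assms(1-3)]])
  ultimately have "(\<mu>, \<nu>) = (\<mu>', \<nu>')" by blast
  then show ?thesis by simp
qed

lemma factorisation_ex:
  assumes "\<alpha> \<in> Mor \<Lambda>" "Deg \<Lambda> \<alpha> = m + n"
  obtains \<mu> \<nu> where "\<mu> \<in> Mor \<Lambda>" "\<nu> \<in> Mor \<Lambda>" "Src \<Lambda> \<mu> = Rng \<Lambda> \<nu>" "\<alpha> = Comp \<Lambda> \<mu> \<nu>"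
    "Deg \<Lambda> \<mu> = m" "Deg \<Lambda> \<nu> = n"
  using ex1_implies_ex[OF factorisation[OF assms]] by auto

lemma Comp_cancel_left:
  assumes "\<mu> \<in> Mor \<Lambda>" "\<nu> \<in> Mor \<Lambda>" "Src \<Lambda> \<mu> = Rng \<Lambda> \<nu>" "\<nu>' \<in> Mor \<Lambda>" "Src \<Lambda> \<mu> = Rng \<Lambda> \<nu>'"
    and "Comp \<Lambda> \<mu> \<nu> = Comp \<Lambda> \<mu> \<nu>'"
  shows "\<nu> = \<nu>'"
  using factorisation_unique assms by blast

lemma prefixI:
  "\<lbrakk>\<alpha> \<in> Mor \<Lambda>; \<nu> \<in> Mor \<Lambda>; Src \<Lambda> \<alpha> = Rng \<Lambda> \<nu>\<rbrakk> \<Longrightarrow> \<alpha> \<preceq> Comp \<Lambda> \<alpha> \<nu>"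
  by (auto simp: prefix_of_def)

lemma prefixD: "\<alpha> \<preceq> \<tau> \<Longrightarrow> \<alpha> \<in> Mor \<Lambda> \<and> \<tau> \<in> Mor \<Lambda> \<and> Rng \<Lambda> \<alpha> = Rng \<Lambda> \<tau>"
  by (auto simp: prefix_of_def Comp_closed Rng_Comp)

lemma prefix_refl: "\<alpha> \<in> Mor \<Lambda> \<Longrightarrow> \<alpha> \<preceq> \<alpha>"
  using prefixI[of \<alpha> "Src \<Lambda> \<alpha>"] by (simp add: Src_closed Rng_Src Comp_Src_right)

lemma Rng_prefix: "\<alpha> \<in> Mor \<Lambda> \<Longrightarrow> Rng \<Lambda> \<alpha> \<preceq> \<alpha>"
  using prefixI[of "Rng \<Lambda> \<alpha>" \<alpha>] by (simp add: Rng_closed Src_Rng Comp_Rng_left)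

lemma prefix_trans:
  assumes "\<alpha> \<preceq> \<beta>" "\<beta> \<preceq> \<gamma>"
  shows "\<alpha> \<preceq> \<gamma>"
proof -
  obtain \<mu> where \<mu>: "\<alpha> \<in> Mor \<Lambda>" "\<mu> \<in> Mor \<Lambda>" "Src \<Lambda> \<alpha> = Rng \<Lambda> \<mu>" "\<beta> = Comp \<Lambda> \<alpha> \<mu>"
    using assms(1) by (auto simp: prefix_of_def)
  obtain \<nu> where \<nu>: "\<nu> \<in> Mor \<Lambda>" "Src \<Lambda> \<beta> = Rng \<Lambda> \<nu>" "\<gamma> = Comp \<Lambda> \<beta> \<nu>"
    using assms(2) by (auto simp: prefix_of_def)
  have s: "Src \<Lambda> \<mu> = Rng \<Lambda> \<nu>" using Src_Comp[OF \<mu>(1-3)] \<mu>(4) \<nu>(2) by simp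
  have "\<gamma> = Comp \<Lambda> \<alpha> (Comp \<Lambda> \<mu> \<nu>)"
    using Comp_assoc[OF \<mu>(1,2) \<nu>(1) \<mu>(3) s] \<mu>(4) \<nu>(3) by simp
  then show ?thesis
    using prefixI[OF \<mu>(1) Comp_closed[OF \<mu>(2) \<nu>(1) s]] Rng_Comp[OF \<mu>(2) \<nu>(1) s] \<mu>(3) by simp
qed

text \<open>Left composition is injective by unique factorisation, so it reflects prefixes as well
  as preserving them. Common extensions can thus be moved through \<open>prepend\<close> and
  \<open>chop\<close>.\<close>

lemma prefix_Comp_iff:
  assumes "\<alpha> \<in> Mor \<Lambda>" "\<nu> \<in> Mor \<Lambda>" "Src \<Lambda> \<alpha> = Rng \<Lambda> \<nu>" "\<mu> \<in> Mor \<Lambda>" "Src \<Lambda> \<alpha> = Rng \<Lambda> \<mu>"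
  shows "Comp \<Lambda> \<alpha> \<mu> \<preceq> Comp \<Lambda> \<alpha> \<nu> \<longleftrightarrow> \<mu> \<preceq> \<nu>"
proof
  note c = Comp_closed[OF assms(1,4,5)] Src_Comp[OF assms(1,4,5)]
  {
    assume "Comp \<Lambda> \<alpha> \<mu> \<preceq> Comp \<Lambda> \<alpha> \<nu>"
    then obtain \<xi> where \<xi>: "\<xi> \<in> Mor \<Lambda>" "Src \<Lambda> \<mu> = Rng \<Lambda> \<xi>" "Comp \<Lambda> \<alpha> \<nu> = Comp \<Lambda> (Comp \<Lambda> \<alpha> \<mu>) \<xi>"
      using c(2) by (auto simp: prefix_of_def)
    have "Comp \<Lambda> \<alpha> \<nu> = Comp \<Lambda> \<alpha> (Comp \<Lambda> \<mu> \<xi>)"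
      using \<xi>(3) Comp_assoc[OF assms(1,4) \<xi>(1) assms(5) \<xi>(2)] by (rule trans)
    then have "\<nu> = Comp \<Lambda> \<mu> \<xi>"
      using Comp_cancel_left[OF assms(1-3) Comp_closed[OF assms(4) \<xi>(1,2)]]
        Rng_Comp[OF assms(4) \<xi>(1,2)] assms(5) by metis
    then show "\<mu> \<preceq> \<nu>" using prefixI[OF assms(4) \<xi>(1,2)] by metis
  next
    assume "\<mu> \<preceq> \<nu>"
    then obtain \<xi> where \<xi>: "\<xi> \<in> Mor \<Lambda>" "Src \<Lambda> \<mu> = Rng \<Lambda> \<xi>" "\<nu> = Comp \<Lambda> \<mu> \<xi>"
      by (auto simp: prefix_of_def)
    then show "Comp \<Lambda> \<alpha> \<mu> \<preceq> Comp \<Lambda> \<alpha> \<nu>"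
      using prefixI[OF c(1) \<xi>(1)] c(2) Comp_assoc[OF assms(1,4) \<xi>(1) assms(5) \<xi>(2)] by metis
  }
qed

lemma prefix_Deg: "\<alpha> \<preceq> \<tau> \<Longrightarrow> \<exists>n. Deg \<Lambda> \<tau> = Deg \<Lambda> \<alpha> + n"
  using Deg_Comp by (auto simp: prefix_of_def)

lemma prefix_same_Deg:
  assumes "\<alpha> \<preceq> \<tau>" "\<beta> \<preceq> \<tau>" "Deg \<Lambda> \<alpha> = Deg \<Lambda> \<beta>"
  shows "\<alpha> = \<beta>"
proof -
  obtain \<mu> where \<mu>: "\<alpha> \<in> Mor \<Lambda>" "\<mu> \<in> Mor \<Lambda>" "Src \<Lambda> \<alpha> = Rng \<Lambda> \<mu>" "\<tau> = Comp \<Lambda> \<alpha> \<mu>"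
    using assms(1) by (auto simp: prefix_of_def)
  obtain \<nu> where \<nu>: "\<beta> \<in> Mor \<Lambda>" "\<nu> \<in> Mor \<Lambda>" "Src \<Lambda> \<beta> = Rng \<Lambda> \<nu>" "\<tau> = Comp \<Lambda> \<beta> \<nu>"
    using assms(2) by (auto simp: prefix_of_def)
  show ?thesis
    using factorisation_unique[OF \<mu>(1-3) \<nu>(1-3) _ assms(3)] \<mu>(4) \<nu>(4) by simp
qed

text \<open>Cut \<beta> at the degree of \<alpha>. The initial piece is a prefix of \<tau> with the
  degree of \<alpha>, hence it is \<alpha>: among the prefixes of one path the order is read off
  from degrees.\<close>

lemma prefix_Deg_add:
  assumes "\<alpha> \<preceq> \<tau>" "\<beta> \<preceq> \<tau>" "Deg \<Lambda> \<beta> = Deg \<Lambda> \<alpha> + n"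
  shows "\<alpha> \<preceq> \<beta>"
proof -
  have "\<beta> \<in> Mor \<Lambda>" using assms(2) prefixD by blast
  then obtain \<mu> \<nu> where
    *: "\<mu> \<in> Mor \<Lambda>" "\<nu> \<in> Mor \<Lambda>" "Src \<Lambda> \<mu> = Rng \<Lambda> \<nu>" "\<beta> = Comp \<Lambda> \<mu> \<nu>" "Deg \<Lambda> \<mu> = Deg \<Lambda> \<alpha>"
    by (rule factorisation_ex[OF _ assms(3)])
  have \<mu>: "\<mu> \<preceq> \<beta>" unfolding *(4) using *(1-3) by (rule prefixI)
  have "\<mu> = \<alpha>" using prefix_same_Deg[OF prefix_trans[OF \<mu> assms(2)] assms(1) *(5)] .
  then show ?thesis using \<mu> by simp
qed

lemma initial_segment_prefix:
  assumes "\<alpha> \<preceq> \<tau>"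
  shows "initial_segment \<Lambda> \<tau> (Deg \<Lambda> \<alpha>) = \<alpha>"
  unfolding initial_segment_def
proof (rule the_equality)
  fix \<mu> assume "\<mu> \<in> Mor \<Lambda> \<and> Deg \<Lambda> \<mu> = Deg \<Lambda> \<alpha> \<and> (\<exists>\<nu>\<in>Mor \<Lambda>. Src \<Lambda> \<mu> = Rng \<Lambda> \<nu> \<and> \<tau> = Comp \<Lambda> \<mu> \<nu>)"
  then have "\<mu> \<preceq> \<tau>" "Deg \<Lambda> \<mu> = Deg \<Lambda> \<alpha>" by (auto simp: prefix_of_def)
  then show "\<mu> = \<alpha>" using prefix_same_Deg[OF _ assms] by simp
qed (use assms in \<open>auto simp: prefix_of_def\<close>)

text \<open>Once the two composites agree, both initial-segment conditions of \<open>MCE\<close>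
  hold automatically and only the degree remains. This removes the definite description in
  \<open>initial_segment\<close> from all later arguments.\<close>

lemma Lmin_iff:
  assumes "\<alpha> \<in> Mor \<Lambda>" "\<beta> \<in> Mor \<Lambda>"
  shows "(\<rho>, \<tau>) \<in> Lmin \<Lambda> \<alpha> \<beta> \<longleftrightarrow> \<rho> \<in> Mor \<Lambda> \<and> \<tau> \<in> Mor \<Lambda> \<and> Src \<Lambda> \<alpha> = Rng \<Lambda> \<rho> \<and> Src \<Lambda> \<beta> = Rng \<Lambda> \<tau> \<and>
    Comp \<Lambda> \<alpha> \<rho> = Comp \<Lambda> \<beta> \<tau> \<and> Deg \<Lambda> (Comp \<Lambda> \<alpha> \<rho>) = deg_join (Deg \<Lambda> \<alpha>) (Deg \<Lambda> \<beta>)"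
proof -
  have "Comp \<Lambda> \<alpha> \<rho> \<in> MCE \<Lambda> \<alpha> \<beta> \<longleftrightarrow> Deg \<Lambda> (Comp \<Lambda> \<alpha> \<rho>) = deg_join (Deg \<Lambda> \<alpha>) (Deg \<Lambda> \<beta>)"
    if "\<rho> \<in> Mor \<Lambda>" "\<tau> \<in> Mor \<Lambda>" "Src \<Lambda> \<alpha> = Rng \<Lambda> \<rho>" "Src \<Lambda> \<beta> = Rng \<Lambda> \<tau>" "Comp \<Lambda> \<alpha> \<rho> = Comp \<Lambda> \<beta> \<tau>"
  proof -
    have "\<alpha> \<preceq> Comp \<Lambda> \<alpha> \<rho>" "\<beta> \<preceq> Comp \<Lambda> \<alpha> \<rho>" using prefixI[of \<alpha> \<rho>] prefixI[of \<beta> \<tau>] that assms by auto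
    then show ?thesis
      using that assms by (auto simp: MCE_def initial_segment_prefix Comp_closed)
  qed
  then show ?thesis unfolding Lmin_def by auto
qed

text \<open>Cutting \<sigma> at the join of the two degrees gives a path \<kappa> that extends both
  \<alpha> and \<beta>, because prefixes of \<sigma> are ordered by degree.\<close>

lemma Lmin_below:
  assumes "\<alpha> \<preceq> \<sigma>" "\<beta> \<preceq> \<sigma>"
  shows "\<exists>(\<rho>, \<tau>)\<in>Lmin \<Lambda> \<alpha> \<beta>. Comp \<Lambda> \<alpha> \<rho> \<preceq> \<sigma>"
proof -
  let ?j = "deg_join (Deg \<Lambda> \<alpha>) (Deg \<Lambda> \<beta>)"
  have M: "\<sigma> \<in> Mor \<Lambda>" "\<alpha> \<in> Mor \<Lambda>" "\<beta> \<in> Mor \<Lambda>" using assms prefixD by auto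
  obtain a b where ab: "Deg \<Lambda> \<sigma> = Deg \<Lambda> \<alpha> + a" "Deg \<Lambda> \<sigma> = Deg \<Lambda> \<beta> + b"
    using prefix_Deg[OF assms(1)] prefix_Deg[OF assms(2)] by auto
  \<comment> \<open>The subtraction of natural numbers is exact: the degree of \<sigma> dominates
    those of \<alpha> and \<beta> and hence their join.\<close>
  have d: "Deg \<Lambda> \<sigma> = ?j + (\<chi> i. Deg \<Lambda> \<sigma> $ i - ?j $ i)"
  proof (subst vec_eq_iff, intro allI)
    fix i
    have "Deg \<Lambda> \<sigma> $ i = Deg \<Lambda> \<alpha> $ i + a $ i" "Deg \<Lambda> \<sigma> $ i = Deg \<Lambda> \<beta> $ i + b $ i"
      using ab by (metis vector_add_component)+
    then show "Deg \<Lambda> \<sigma> $ i = (?j + (\<chi> i. Deg \<Lambda> \<sigma> $ i - ?j $ i)) $ i"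
      by (simp add: deg_join_def)
  qed
  obtain \<kappa> \<nu> where
    \<kappa>: "\<kappa> \<in> Mor \<Lambda>" "\<nu> \<in> Mor \<Lambda>" "Src \<Lambda> \<kappa> = Rng \<Lambda> \<nu>" "\<sigma> = Comp \<Lambda> \<kappa> \<nu>" "Deg \<Lambda> \<kappa> = ?j"
    by (rule factorisation_ex[OF M(1) d])
  have "\<kappa> \<preceq> \<sigma>" unfolding \<kappa>(4) using \<kappa>(1-3) by (rule prefixI)
  have d': "Deg \<Lambda> \<kappa> = Deg \<Lambda> \<alpha> + (\<chi> i. ?j $ i - Deg \<Lambda> \<alpha> $ i)"
    "Deg \<Lambda> \<kappa> = Deg \<Lambda> \<beta> + (\<chi> i. ?j $ i - Deg \<Lambda> \<beta> $ i)"
    unfolding \<kappa>(5) by (simp_all add: vec_eq_iff deg_join_def)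
  note p = prefix_Deg_add[OF assms(1) \<open>\<kappa> \<preceq> \<sigma>\<close> d'(1)] prefix_Deg_add[OF assms(2) \<open>\<kappa> \<preceq> \<sigma>\<close> d'(2)]
  obtain \<rho> where \<rho>: "\<rho> \<in> Mor \<Lambda>" "Src \<Lambda> \<alpha> = Rng \<Lambda> \<rho>" "\<kappa> = Comp \<Lambda> \<alpha> \<rho>"
    using p(1) by (auto simp: prefix_of_def)
  obtain \<tau> where \<tau>: "\<tau> \<in> Mor \<Lambda>" "Src \<Lambda> \<beta> = Rng \<Lambda> \<tau>" "\<kappa> = Comp \<Lambda> \<beta> \<tau>"
    using p(2) by (auto simp: prefix_of_def)
  have "(\<rho>, \<tau>) \<in> Lmin \<Lambda> \<alpha> \<beta>"
    unfolding Lmin_iff[OF M(2,3)]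
    using \<rho>(1,2) \<tau>(1,2) \<rho>(3)[symmetric] \<tau>(3)[symmetric] \<kappa>(5) by (intro conjI) simp_all
  then show ?thesis using \<open>\<kappa> \<preceq> \<sigma>\<close> \<rho>(3) by blast
qed

lemma vertex_simps:
  assumes "v \<in> vertices \<Lambda>"
  shows "v \<in> Mor \<Lambda>" "Rng \<Lambda> v = v" "Src \<Lambda> v = v" "Deg \<Lambda> v = 0"
proof -
  obtain \<alpha> where \<alpha>: "v = Rng \<Lambda> \<alpha>" "\<alpha> \<in> Mor \<Lambda>"
    using assms unfolding vertices_eq_identities by blast
  then show "v \<in> Mor \<Lambda>" "Rng \<Lambda> v = v" "Src \<Lambda> v = v" "Deg \<Lambda> v = 0"
    by (simp_all add: Rng_closed Rng_Rng Src_Rng Deg_Rng)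
qed

lemma Rng_vertex: "\<alpha> \<in> Mor \<Lambda> \<Longrightarrow> Rng \<Lambda> \<alpha> \<in> vertices \<Lambda>"
  using vertices_eq_identities by auto

lemma Src_vertex: "\<alpha> \<in> Mor \<Lambda> \<Longrightarrow> Src \<Lambda> \<alpha> \<in> vertices \<Lambda>"
  using Rng_vertex[of "Src \<Lambda> \<alpha>"] by (simp add: Src_closed Rng_Src)

section \<open>Compatible sets and the criterion for membership in maximal ones\<close>

definition compatible :: "'a set \<Rightarrow> bool" where
  "compatible x \<longleftrightarrow> x \<noteq> {} \<and> x \<subseteq> Mor \<Lambda> \<and> (\<forall>F. finite F \<longrightarrow> F \<subseteq> x \<longrightarrow> (\<exists>\<tau>\<in>Mor \<Lambda>. \<forall>\<alpha>\<in>F. \<alpha> \<preceq> \<tau>))"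

text \<open>The common extensions required by \<open>compatible\<close> may lie outside the set.
  That a maximal set contains minimal common extensions of its members is a consequence of
  maximality, proved in \<open>boundary_Lmin\<close>.\<close>

definition boundary :: "'a set set" where
  "boundary = {x. compatible x \<and> (\<forall>y. compatible y \<longrightarrow> x \<subseteq> y \<longrightarrow> y = x)}"

lemma compatibleD: "\<lbrakk>compatible x; finite F; F \<subseteq> x\<rbrakk> \<Longrightarrow> \<exists>\<tau>\<in>Mor \<Lambda>. \<forall>\<alpha>\<in>F. \<alpha> \<preceq> \<tau>"
  by (auto simp: compatible_def)

lemma compatible_Mor: "\<lbrakk>compatible x; \<alpha> \<in> x\<rbrakk> \<Longrightarrow> \<alpha> \<in> Mor \<Lambda>"
  by (auto simp: compatible_def)

lemma compatible_two:
  assumes "compatible x" "\<alpha> \<in> x" "\<beta> \<in> x"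
  shows "\<exists>\<tau>. \<alpha> \<preceq> \<tau> \<and> \<beta> \<preceq> \<tau>"
  using compatibleD[OF assms(1), of "{\<alpha>, \<beta>}"] assms by auto

lemma compatible_Rng:
  assumes "compatible x" "\<alpha> \<in> x" "\<beta> \<in> x"
  shows "Rng \<Lambda> \<alpha> = Rng \<Lambda> \<beta>"
proof -
  obtain \<tau> where "\<alpha> \<preceq> \<tau>" "\<beta> \<preceq> \<tau>" using compatible_two[OF assms] by auto
  then show ?thesis using prefixD[of \<alpha> \<tau>] prefixD[of \<beta> \<tau>] by simp
qed

lemma boundary_compatible: "x \<in> boundary \<Longrightarrow> compatible x"
  by (simp add: boundary_def)

lemma boundary_maximal: "\<lbrakk>x \<in> boundary; compatible y; x \<subseteq> y\<rbrakk> \<Longrightarrow> y = x"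
  by (simp add: boundary_def)

text \<open>Compatibility tests finite subsets only, and a finite subset of the union of a chain
  lies in one of its members. So Zorn's lemma applies to the compatible sets above
  \<open>y\<close>.\<close>

lemma boundary_extends:
  assumes "compatible y"
  shows "\<exists>x\<in>boundary. y \<subseteq> x"
proof -
  have "\<exists>M\<in>{z. compatible z \<and> y \<subseteq> z}. \<forall>X\<in>{z. compatible z \<and> y \<subseteq> z}. M \<subseteq> X \<longrightarrow> X = M"
  proof (rule subset_Zorn_nonempty)
    show "{z. compatible z \<and> y \<subseteq> z} \<noteq> {}" using assms by auto
    fix C assume C: "C \<noteq> {}" "subset.chain {z. compatible z \<and> y \<subseteq> z} C"
    have c: "compatible z" "y \<subseteq> z" if "z \<in> C" for z
      using C(2) that by (auto simp: subset_chain_def)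
    have "\<exists>\<tau>\<in>Mor \<Lambda>. \<forall>\<alpha>\<in>F. \<alpha> \<preceq> \<tau>" if F: "finite F" "F \<subseteq> \<Union>C" for F
    proof -
      obtain z where "z \<in> C" "F \<subseteq> z"
        using finite_subset_Union_chain[OF F C] by blast
      then show ?thesis using compatibleD[OF c(1) F(1)] by blast
    qed
    moreover obtain z where z: "z \<in> C" using C(1) by blast
    moreover have "z \<noteq> {}" using c(1)[OF z] by (simp add: compatible_def)
    moreover have "\<Union>C \<subseteq> Mor \<Lambda>" using c(1) compatible_Mor by blast
    ultimately have "compatible (\<Union>C)"
      unfolding compatible_def by (intro conjI allI impI) auto
    moreover have "y \<subseteq> \<Union>C" using c(2)[OF z] z by blast
    ultimately have "compatible (\<Union>C)" "y \<subseteq> \<Union>C" .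
    then show "\<Union>C \<in> {z. compatible z \<and> y \<subseteq> z}" by blast
  qed
  then obtain M where M: "compatible M" "y \<subseteq> M" "\<forall>X\<in>{z. compatible z \<and> y \<subseteq> z}. M \<subseteq> X \<longrightarrow> X = M"
    by blast
  have "M \<in> boundary" unfolding boundary_def using M by (auto dest: order_trans)
  then show ?thesis using M(2) by blast
qed

text \<open>Suppose no member of \<open>E\<close> lies in \<open>x\<close>. By maximality, inserting
  \<epsilon> destroys compatibility, so some finite \<open>F \<epsilon> \<subseteq> x\<close> has no
  common extension together with \<epsilon>. As \<open>E\<close> is finite, the union of these sets
  is a finite part of \<open>x\<close>, and its common extensions extend no member of
  \<open>E\<close>, contrary to \<open>ext\<close>.\<close>

lemma boundary_prime:
  assumes x: "x \<in> boundary" and E: "finite E" "E \<subseteq> Mor \<Lambda>"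
    and ext: "\<And>F. \<lbrakk>finite F; F \<subseteq> x; F \<noteq> {}\<rbrakk> \<Longrightarrow> \<exists>\<tau>\<in>Mor \<Lambda>. (\<forall>\<alpha>\<in>F. \<alpha> \<preceq> \<tau>) \<and> (\<exists>\<epsilon>\<in>E. \<epsilon> \<preceq> \<tau>)"
  shows "E \<inter> x \<noteq> {}"
proof
  assume disj: "E \<inter> x = {}"
  let ?P = "\<lambda>\<epsilon> F. finite F \<and> F \<subseteq> x \<and> (\<forall>\<tau>\<in>Mor \<Lambda>. \<epsilon> \<preceq> \<tau> \<longrightarrow> (\<exists>\<alpha>\<in>F. \<not> \<alpha> \<preceq> \<tau>))"
  have ex: "\<exists>F. ?P \<epsilon> F" if \<epsilon>: "\<epsilon> \<in> E" for \<epsilon>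
  proof (rule ccontr)
    assume no: "\<not> (\<exists>F. ?P \<epsilon> F)"
    have "\<exists>\<tau>\<in>Mor \<Lambda>. \<forall>\<alpha>\<in>F. \<alpha> \<preceq> \<tau>" if F: "finite F" "F \<subseteq> insert \<epsilon> x" for F
    proof -
      have "finite (F - {\<epsilon>})" "F - {\<epsilon>} \<subseteq> x" using F by auto
      moreover have "\<not> ?P \<epsilon> (F - {\<epsilon>})" using no by (rule contrapos_nn) (rule exI)
      ultimately obtain \<tau> where "\<tau> \<in> Mor \<Lambda>" "\<epsilon> \<preceq> \<tau>" "\<forall>\<alpha>\<in>F - {\<epsilon>}. \<alpha> \<preceq> \<tau>" by auto
      then show ?thesis by (intro bexI[of _ \<tau>]) auto
    qed
    moreover have "insert \<epsilon> x \<subseteq> Mor \<Lambda>"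
      using compatible_Mor[OF boundary_compatible[OF x]] \<epsilon> E(2) by auto
    ultimately have "compatible (insert \<epsilon> x)" unfolding compatible_def by simp
    then have "insert \<epsilon> x = x" using boundary_maximal[OF x] by blast
    then show False using disj \<epsilon> by auto
  qed
  have "\<forall>\<epsilon>\<in>E. \<exists>F. ?P \<epsilon> F" using ex by (rule ballI)
  from bchoice[OF this] obtain F where F: "\<forall>\<epsilon>\<in>E. ?P \<epsilon> (F \<epsilon>)" by (rule exE)
  \<comment> \<open>The union of the sets \<open>F \<epsilon>\<close> may be empty, for instance if
    \<open>E\<close> is, whereas \<open>ext\<close> speaks of nonempty sets; \<beta> is added to
    it.\<close>
  obtain \<beta> where \<beta>: "\<beta> \<in> x" using boundary_compatible[OF x] by (auto simp: compatible_def)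
  have "finite (insert \<beta> (\<Union>(F ` E)))" "insert \<beta> (\<Union>(F ` E)) \<subseteq> x"
    using F E(1) \<beta> by auto
  from ext[OF this] obtain \<tau> \<epsilon> where
    "\<tau> \<in> Mor \<Lambda>" "\<epsilon> \<in> E" "\<epsilon> \<preceq> \<tau>" "\<forall>\<alpha>\<in>\<Union>(F ` E). \<alpha> \<preceq> \<tau>" by auto
  moreover then obtain \<alpha> where "\<alpha> \<in> F \<epsilon>" "\<not> \<alpha> \<preceq> \<tau>" using F by blast
  ultimately show False by blast
qed

lemma boundary_prefix:
  assumes x: "x \<in> boundary" and \<alpha>: "\<alpha> \<in> x" and \<beta>: "\<beta> \<preceq> \<alpha>"
  shows "\<beta> \<in> x"
proof -
  have "{\<beta>} \<inter> x \<noteq> {}"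
  proof (rule boundary_prime[OF x])
    fix F assume F: "finite F" "F \<subseteq> x"
    then obtain \<tau> where "\<tau> \<in> Mor \<Lambda>" "\<forall>\<alpha>'\<in>insert \<alpha> F. \<alpha>' \<preceq> \<tau>"
      using compatibleD[OF boundary_compatible[OF x], of "insert \<alpha> F"] \<alpha> by auto
    then show "\<exists>\<tau>\<in>Mor \<Lambda>. (\<forall>\<alpha>\<in>F. \<alpha> \<preceq> \<tau>) \<and> (\<exists>\<epsilon>\<in>{\<beta>}. \<epsilon> \<preceq> \<tau>)"
      using \<beta> prefix_trans by blast
  qed (use \<beta> prefixD in auto)
  then show ?thesis by auto
qed

text \<open>Two members of a compatible set have a common extension and hence the same range, and
  maximal sets are closed under prefixes. So each boundary set contains exactly one vertex.\<close>

lemma boundary_vertex_iff: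
  assumes x: "x \<in> boundary" and v: "v \<in> vertices \<Lambda>" and \<alpha>: "\<alpha> \<in> x"
  shows "v \<in> x \<longleftrightarrow> Rng \<Lambda> \<alpha> = v"
proof
  assume "v \<in> x"
  then show "Rng \<Lambda> \<alpha> = v"
    using compatible_Rng[OF boundary_compatible[OF x] \<alpha>] vertex_simps[OF v] by metis
next
  assume "Rng \<Lambda> \<alpha> = v"
  then show "v \<in> x"
    using boundary_prefix[OF x \<alpha>] Rng_prefix compatible_Mor[OF boundary_compatible[OF x] \<alpha>] by blast
qed

lemma boundary_exhaustive:
  assumes x: "x \<in> boundary" and v: "v \<in> vertices \<Lambda>" "v \<in> x" and E: "finite E" "exhaustive \<Lambda> v E"
  shows "E \<inter> x \<noteq> {}"
proof (rule boundary_prime[OF x E(1)])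
  show EM: "E \<subseteq> Mor \<Lambda>" using E(2) by (auto simp: exhaustive_def paths_to_def)
  fix F assume F: "finite F" "F \<subseteq> x"
  \<comment> \<open>Adding \<open>v\<close> to \<open>F\<close> forces the range of \<sigma> to be
    \<open>v\<close>. Exhaustiveness then provides a member of \<open>E\<close> that has a common
    extension with \<sigma>, as \<open>boundary_prime\<close> demands.\<close>
  then obtain \<sigma> where \<sigma>: "\<sigma> \<in> Mor \<Lambda>" "\<forall>\<alpha>\<in>insert v F. \<alpha> \<preceq> \<sigma>"
    using compatibleD[OF boundary_compatible[OF x], of "insert v F"] v by auto
  then have "Rng \<Lambda> \<sigma> = v" using prefixD[of v \<sigma>] vertex_simps[OF v(1)] by auto
  then obtain \<epsilon> \<rho> \<tau> where "\<epsilon> \<in> E" "(\<rho>, \<tau>) \<in> Lmin \<Lambda> \<sigma> \<epsilon>"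
    using E(2) \<sigma>(1) by (fastforce simp: exhaustive_def paths_to_def)
  moreover then have "\<sigma> \<preceq> Comp \<Lambda> \<sigma> \<rho>" "\<epsilon> \<preceq> Comp \<Lambda> \<sigma> \<rho>"
    using \<sigma>(1) EM prefixI[of \<sigma> \<rho>] prefixI[of \<epsilon> \<tau>] Lmin_iff[of \<sigma> \<epsilon>] by auto
  ultimately show "\<exists>\<tau>\<in>Mor \<Lambda>. (\<forall>\<alpha>\<in>F. \<alpha> \<preceq> \<tau>) \<and> (\<exists>\<epsilon>\<in>E. \<epsilon> \<preceq> \<tau>)"
    using \<sigma>(2) prefix_trans prefixD by blast
qed

section \<open>Prepending and removing a path\<close>

definition prepend :: "'a \<Rightarrow> 'a set \<Rightarrow> 'a set" where
  "prepend \<alpha> x = {\<beta>. \<exists>\<mu>\<in>x. Rng \<Lambda> \<mu> = Src \<Lambda> \<alpha> \<and> \<beta> \<preceq> Comp \<Lambda> \<alpha> \<mu>}"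

text \<open>Closure under prefixes is inherited here, since left composition preserves prefixes. In
  \<open>prepend\<close> it is imposed, because a maximal set through \<alpha> also contains paths
  that do not start with \<alpha>, such as proper prefixes of \<alpha>.\<close>

definition chop :: "'a \<Rightarrow> 'a set \<Rightarrow> 'a set" where
  "chop \<alpha> x = {\<mu> \<in> Mor \<Lambda>. Rng \<Lambda> \<mu> = Src \<Lambda> \<alpha> \<and> Comp \<Lambda> \<alpha> \<mu> \<in> x}"

lemma prepend_mem:
  assumes x: "compatible x" and \<alpha>: "\<alpha> \<in> Mor \<Lambda>" "Src \<Lambda> \<alpha> \<in> x" and \<mu>: "\<mu> \<in> x"
  shows "Rng \<Lambda> \<mu> = Src \<Lambda> \<alpha>" "Comp \<Lambda> \<alpha> \<mu> \<in> prepend \<alpha> x"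
proof -
  show *: "Rng \<Lambda> \<mu> = Src \<Lambda> \<alpha>"
    using compatible_Rng[OF x \<mu> \<alpha>(2)] \<alpha>(1) by (simp add: Rng_Src)
  show "Comp \<Lambda> \<alpha> \<mu> \<in> prepend \<alpha> x"
    using * \<mu> \<alpha> compatible_Mor[OF x \<mu>] by (auto simp: prepend_def intro!: bexI[of _ \<mu>] prefix_refl Comp_closed)
qed

lemma self_in_prepend:
  "\<lbrakk>compatible x; \<alpha> \<in> Mor \<Lambda>; Src \<Lambda> \<alpha> \<in> x\<rbrakk> \<Longrightarrow> \<alpha> \<in> prepend \<alpha> x"
  using prepend_mem(2)[of x \<alpha> "Src \<Lambda> \<alpha>"] by (simp add: Comp_Src_right)

lemma Src_in_chop: "\<lbrakk>\<alpha> \<in> Mor \<Lambda>; \<alpha> \<in> x\<rbrakk> \<Longrightarrow> Src \<Lambda> \<alpha> \<in> chop \<alpha> x"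
  by (simp add: chop_def Src_closed Rng_Src Comp_Src_right)

lemma prepend_compatible:
  assumes x: "compatible x" and \<alpha>: "\<alpha> \<in> Mor \<Lambda>" "Src \<Lambda> \<alpha> \<in> x"
  shows "compatible (prepend \<alpha> x)"
  unfolding compatible_def
proof (intro conjI allI impI)
  show "prepend \<alpha> x \<noteq> {}" using self_in_prepend[OF x \<alpha>] by auto
  show "prepend \<alpha> x \<subseteq> Mor \<Lambda>" using prefixD by (auto simp: prepend_def)
  fix F assume F: "finite F" "F \<subseteq> prepend \<alpha> x"
  then obtain \<mu> where \<mu>: "\<And>\<beta>. \<beta> \<in> F \<Longrightarrow> \<mu> \<beta> \<in> x \<and> Rng \<Lambda> (\<mu> \<beta>) = Src \<Lambda> \<alpha> \<and> \<beta> \<preceq> Comp \<Lambda> \<alpha> (\<mu> \<beta>)"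
    unfolding prepend_def subset_iff mem_Collect_eq by metis
  \<comment> \<open>The source of \<alpha> is included so that \<tau> can be composed with \<alpha>,
    even if \<open>F\<close> is empty.\<close>
  obtain \<tau> where \<tau>: "\<tau> \<in> Mor \<Lambda>" "\<forall>\<nu>\<in>insert (Src \<Lambda> \<alpha>) (\<mu> ` F). \<nu> \<preceq> \<tau>"
    using compatibleD[OF x, of "insert (Src \<Lambda> \<alpha>) (\<mu> ` F)"] F \<mu> \<alpha> by auto
  then have r: "Src \<Lambda> \<alpha> = Rng \<Lambda> \<tau>" using prefixD[of "Src \<Lambda> \<alpha>" \<tau>] \<alpha> by (simp add: Rng_Src)
  have "\<beta> \<preceq> Comp \<Lambda> \<alpha> \<tau>" if "\<beta> \<in> F" for \<beta>
  proof -
    have "Comp \<Lambda> \<alpha> (\<mu> \<beta>) \<preceq> Comp \<Lambda> \<alpha> \<tau>"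
      using prefix_Comp_iff[of \<alpha> \<tau> "\<mu> \<beta>"] \<tau> r \<mu>[OF that] \<alpha> compatible_Mor[OF x] that by simp
    then show ?thesis using \<mu>[OF that] prefix_trans by blast
  qed
  then show "\<exists>\<tau>\<in>Mor \<Lambda>. \<forall>\<beta>\<in>F. \<beta> \<preceq> \<tau>" using \<tau>(1) \<alpha>(1) r Comp_closed by blast
qed

lemma chop_compatible:
  assumes x: "compatible x" and \<alpha>: "\<alpha> \<in> x"
  shows "compatible (chop \<alpha> x)"
  unfolding compatible_def
proof (intro conjI allI impI)
  have \<alpha>M: "\<alpha> \<in> Mor \<Lambda>" using compatible_Mor[OF x \<alpha>] .
  show "chop \<alpha> x \<noteq> {}" using Src_in_chop[OF \<alpha>M \<alpha>] by auto
  show "chop \<alpha> x \<subseteq> Mor \<Lambda>" by (auto simp: chop_def)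
  fix F assume F: "finite F" "F \<subseteq> chop \<alpha> x"
  \<comment> \<open>With \<alpha> among its prefixes, \<sigma> has the form \<alpha>\<tau>;
    cancelling \<alpha> makes \<tau> a common extension of \<open>F\<close>.\<close>
  then obtain \<sigma> where \<sigma>: "\<sigma> \<in> Mor \<Lambda>" "\<forall>\<beta>\<in>insert \<alpha> (Comp \<Lambda> \<alpha> ` F). \<beta> \<preceq> \<sigma>"
    using compatibleD[OF x, of "insert \<alpha> (Comp \<Lambda> \<alpha> ` F)"] \<alpha> by (auto simp: chop_def)
  then obtain \<tau> where \<tau>: "\<tau> \<in> Mor \<Lambda>" "Src \<Lambda> \<alpha> = Rng \<Lambda> \<tau>" "\<sigma> = Comp \<Lambda> \<alpha> \<tau>"
    by (auto simp: prefix_of_def)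
  have "\<mu> \<preceq> \<tau>" if "\<mu> \<in> F" for \<mu>
    using prefix_Comp_iff[of \<alpha> \<tau> \<mu>] \<tau> \<alpha>M \<sigma>(2) F(2) that by (auto simp: chop_def)
  then show "\<exists>\<tau>\<in>Mor \<Lambda>. \<forall>\<mu>\<in>F. \<mu> \<preceq> \<tau>" using \<tau>(1) by blast
qed

lemma chop_mono: "x \<subseteq> y \<Longrightarrow> chop \<alpha> x \<subseteq> chop \<alpha> y"
  by (auto simp: chop_def)

lemma prepend_mono: "x \<subseteq> y \<Longrightarrow> prepend \<alpha> x \<subseteq> prepend \<alpha> y"
  by (auto simp: prepend_def)

lemma subset_chop_prepend:
  assumes "compatible x" "\<alpha> \<in> Mor \<Lambda>" "Src \<Lambda> \<alpha> \<in> x"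
  shows "x \<subseteq> chop \<alpha> (prepend \<alpha> x)"
  using prepend_mem[OF assms] compatible_Mor[OF assms(1)] by (auto simp: chop_def)

lemma chop_Comp:
  assumes "\<alpha> \<in> Mor \<Lambda>" "\<mu> \<in> Mor \<Lambda>" "Src \<Lambda> \<alpha> = Rng \<Lambda> \<mu>"
  shows "chop (Comp \<Lambda> \<alpha> \<mu>) x = chop \<mu> (chop \<alpha> x)"
  using assms by (auto simp: chop_def Src_Comp Comp_assoc Comp_closed Rng_Comp)

lemma prepend_Comp:
  assumes x: "x \<subseteq> Mor \<Lambda>" and "\<alpha> \<in> Mor \<Lambda>" "\<mu> \<in> Mor \<Lambda>" "Src \<Lambda> \<alpha> = Rng \<Lambda> \<mu>"
  shows "prepend (Comp \<Lambda> \<alpha> \<mu>) x = prepend \<alpha> (prepend \<mu> x)"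
proof (rule equalityI; rule subsetI)
  fix \<beta> assume "\<beta> \<in> prepend (Comp \<Lambda> \<alpha> \<mu>) x"
  then obtain \<nu> where "\<nu> \<in> x" "Rng \<Lambda> \<nu> = Src \<Lambda> \<mu>" "\<beta> \<preceq> Comp \<Lambda> \<alpha> (Comp \<Lambda> \<mu> \<nu>)" "\<nu> \<in> Mor \<Lambda>"
    using assms by (auto simp: prepend_def Src_Comp Comp_assoc)
  then show "\<beta> \<in> prepend \<alpha> (prepend \<mu> x)"
    using assms by (auto simp: prepend_def Rng_Comp Comp_closed intro!: bexI[of _ \<nu>] exI[of _ "Comp \<Lambda> \<mu> \<nu>"] prefix_refl)
next
  fix \<beta> assume "\<beta> \<in> prepend \<alpha> (prepend \<mu> x)"
  then obtain \<nu> \<kappa> where *: "\<nu> \<in> x" "Rng \<Lambda> \<nu> = Src \<Lambda> \<mu>" "\<kappa> \<preceq> Comp \<Lambda> \<mu> \<nu>" "Rng \<Lambda> \<kappa> = Src \<Lambda> \<alpha>" "\<beta> \<preceq> Comp \<Lambda> \<alpha> \<kappa>"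
      "\<nu> \<in> Mor \<Lambda>"
    using x by (auto simp: prepend_def)
  then have "Comp \<Lambda> \<alpha> \<kappa> \<preceq> Comp \<Lambda> \<alpha> (Comp \<Lambda> \<mu> \<nu>)"
    using assms prefixD[of \<kappa>] by (subst prefix_Comp_iff) (auto simp: Comp_closed Rng_Comp)
  then have "\<beta> \<preceq> Comp \<Lambda> (Comp \<Lambda> \<alpha> \<mu>) \<nu>"
    using * assms prefix_trans by (simp add: Comp_assoc)
  then show "\<beta> \<in> prepend (Comp \<Lambda> \<alpha> \<mu>) x"
    using * assms by (auto simp: prepend_def Src_Comp)
qed

end

section \<open>Prepending and removing as mutually inverse bijections of the boundary\<close>

context finitely_aligned_kgraph
begin

text \<open>A common extension of \<alpha>, \<beta> and a finite part of \<open>x\<close> lies above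
  some minimal common extension of \<alpha> and \<beta>. By finite alignment there are finitely many
  of these, so \<open>boundary_prime\<close> puts one of them into \<open>x\<close>.\<close>

lemma boundary_Lmin:
  assumes x: "x \<in> boundary" and \<alpha>: "\<alpha> \<in> x" and \<beta>: "\<beta> \<in> x"
  shows "\<exists>(\<rho>, \<tau>)\<in>Lmin \<Lambda> \<alpha> \<beta>. Comp \<Lambda> \<alpha> \<rho> \<in> x"
proof -
  have M: "\<alpha> \<in> Mor \<Lambda>" "\<beta> \<in> Mor \<Lambda>" using x \<alpha> \<beta> compatible_Mor boundary_compatible by auto
  let ?E = "(\<lambda>(\<rho>, \<tau>). Comp \<Lambda> \<alpha> \<rho>) ` Lmin \<Lambda> \<alpha> \<beta>"
  have "?E \<inter> x \<noteq> {}"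
  proof (rule boundary_prime[OF x])
    show "finite ?E" using finitely_aligned[OF M] by simp
    show "?E \<subseteq> Mor \<Lambda>" using M by (auto simp: Lmin_iff intro!: Comp_closed)
    fix F assume "finite F" "F \<subseteq> x"
    then obtain \<sigma> where \<sigma>: "\<sigma> \<in> Mor \<Lambda>" "\<forall>\<gamma>\<in>insert \<alpha> (insert \<beta> F). \<gamma> \<preceq> \<sigma>"
      using compatibleD[OF boundary_compatible[OF x], of "insert \<alpha> (insert \<beta> F)"] \<alpha> \<beta> by auto
    moreover from \<sigma> have "\<exists>\<epsilon>\<in>?E. \<epsilon> \<preceq> \<sigma>"
      using Lmin_below[of \<alpha> \<sigma> \<beta>] by force
    ultimately show "\<exists>\<tau>\<in>Mor \<Lambda>. (\<forall>\<alpha>\<in>F. \<alpha> \<preceq> \<tau>) \<and> (\<exists>\<epsilon>\<in>?E. \<epsilon> \<preceq> \<tau>)"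
      by (intro bexI[of _ \<sigma>]) auto
  qed
  then show ?thesis by auto
qed

text \<open>A member \<beta> of \<open>x\<close> need not start with \<alpha>. But \<open>x\<close>
  contains a minimal common extension \<alpha>\<rho> of both, so \<rho> survives the removal of
  \<alpha>, and \<beta> returns as a prefix of \<alpha>\<rho>.\<close>

lemma prepend_chop:
  assumes x: "x \<in> boundary" and \<alpha>: "\<alpha> \<in> x"
  shows "prepend \<alpha> (chop \<alpha> x) = x"
proof
  show "prepend \<alpha> (chop \<alpha> x) \<subseteq> x"
    using boundary_prefix[OF x] by (auto simp: prepend_def chop_def)
  show "x \<subseteq> prepend \<alpha> (chop \<alpha> x)"
  proof
    fix \<beta> assume \<beta>: "\<beta> \<in> x"
    have M: "\<alpha> \<in> Mor \<Lambda>" "\<beta> \<in> Mor \<Lambda>" using x \<alpha> \<beta> compatible_Mor boundary_compatible by auto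
    obtain \<rho> \<tau> where \<rho>: "(\<rho>, \<tau>) \<in> Lmin \<Lambda> \<alpha> \<beta>" "Comp \<Lambda> \<alpha> \<rho> \<in> x" using boundary_Lmin[OF x \<alpha> \<beta>] by auto
    then have "\<beta> \<preceq> Comp \<Lambda> \<alpha> \<rho>" "\<rho> \<in> chop \<alpha> x"
      using M by (auto simp: Lmin_iff chop_def prefixI)
    then show "\<beta> \<in> prepend \<alpha> (chop \<alpha> x)" by (auto simp: prepend_def chop_def)
  qed
qed

text \<open>A compatible set \<open>y\<close> above \<open>chop \<alpha> x\<close> becomes, after
  prepending \<alpha>, a compatible set above \<open>x\<close>, hence \<open>x\<close> itself.
  Removing \<alpha> again bounds \<open>y\<close> by \<open>chop \<alpha> x\<close>.\<close>

lemma chop_boundary: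
  assumes x: "x \<in> boundary" and \<alpha>: "\<alpha> \<in> x"
  shows "chop \<alpha> x \<in> boundary"
proof -
  have M: "\<alpha> \<in> Mor \<Lambda>" using x \<alpha> compatible_Mor boundary_compatible by auto
  have "y = chop \<alpha> x" if y: "compatible y" "chop \<alpha> x \<subseteq> y" for y
  proof
    have s: "Src \<Lambda> \<alpha> \<in> y" using Src_in_chop[OF M \<alpha>] y by auto
    have "x \<subseteq> prepend \<alpha> y" using prepend_mono[OF y(2), of \<alpha>] prepend_chop[OF x \<alpha>] by simp
    then have "prepend \<alpha> y = x" using boundary_maximal[OF x] prepend_compatible[OF y(1) M s] by blast
    then show "y \<subseteq> chop \<alpha> x" using subset_chop_prepend[OF y(1) M s] by simp
  qed (use y in simp)
  then show ?thesis
    using chop_compatible[OF boundary_compatible[OF x] \<alpha>] by (simp add: boundary_def)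
qed

text \<open>One inclusion is \<open>subset_chop_prepend\<close>; the larger set is compatible, so
  maximality of \<open>x\<close> turns the inclusion into an equality.\<close>

lemma chop_prepend:
  assumes x: "x \<in> boundary" and \<alpha>: "\<alpha> \<in> Mor \<Lambda>" "Src \<Lambda> \<alpha> \<in> x"
  shows "chop \<alpha> (prepend \<alpha> x) = x"
  using assms boundary_compatible[OF x]
  by (intro boundary_maximal subset_chop_prepend chop_compatible prepend_compatible self_in_prepend)

text \<open>Maximality is not tested directly. Take a maximal \<open>z\<close> above
  \<open>prepend \<alpha> x\<close>; then \<open>chop \<alpha> z\<close> contains \<open>x\<close>
  and so equals it, and prepending \<alpha> recovers \<open>z\<close> as
  \<open>prepend \<alpha> x\<close>.\<close>

lemma prepend_boundary:
  assumes x: "x \<in> boundary" and \<alpha>: "\<alpha> \<in> Mor \<Lambda>" "Src \<Lambda> \<alpha> \<in> x"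
  shows "prepend \<alpha> x \<in> boundary"
proof -
  note c = boundary_compatible[OF x]
  obtain z where z: "z \<in> boundary" "prepend \<alpha> x \<subseteq> z"
    using boundary_extends[OF prepend_compatible[OF c \<alpha>]] by auto
  have \<alpha>z: "\<alpha> \<in> z" using self_in_prepend[OF c \<alpha>] z by auto
  have "x \<subseteq> chop \<alpha> z" using chop_mono[OF z(2), of \<alpha>] chop_prepend[OF x \<alpha>] by simp
  then have "chop \<alpha> z = x"
    using boundary_maximal[OF x] chop_compatible[OF boundary_compatible[OF z(1)] \<alpha>z] by blast
  then show ?thesis using prepend_chop[OF z(1) \<alpha>z] z(1) by simp
qed

lemma boundary_vertex:
  assumes x: "x \<in> boundary" and v: "v \<in> vertices \<Lambda>" "v \<in> x"
  shows "prepend v x = x" "chop v x = x"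
proof -
  note s = vertex_simps[OF v(1)]
  have r: "Rng \<Lambda> \<mu> = v \<and> \<mu> \<in> Mor \<Lambda> \<and> Comp \<Lambda> v \<mu> = \<mu>" if "\<mu> \<in> x" for \<mu>
    using boundary_vertex_iff[OF x v(1) that] v(2) compatible_Mor[OF boundary_compatible[OF x] that]
      Comp_Rng_left[of \<mu>] by auto
  show "chop v x = x"
    using r s by (auto simp: chop_def) (metis Comp_Rng_left)
  then show "prepend v x = x" using prepend_chop[OF x v(2)] by simp
qed

lemma boundary_through:
  assumes "v \<in> vertices \<Lambda>"
  shows "\<exists>x\<in>boundary. v \<in> x"
proof -
  have "compatible {v}"
    using vertex_simps[OF assms] prefix_refl by (auto simp: compatible_def)
  then show ?thesis using boundary_extends by blast
qed

text \<open>In (KP3), at most one summand acts nontrivially at a given point of the boundary.\<close>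

lemma prepend_meets:
  assumes x: "x \<in> boundary" and M: "\<alpha> \<in> Mor \<Lambda>" "\<beta> \<in> Mor \<Lambda>" and s: "Src \<Lambda> \<alpha> \<in> x"
    and L: "(\<rho>, \<tau>) \<in> Lmin \<Lambda> \<alpha> \<beta>" and \<rho>: "\<rho> \<in> x"
  shows "\<beta> \<in> prepend \<alpha> x" and "Src \<Lambda> \<tau> \<in> chop \<rho> x" and "chop \<beta> (prepend \<alpha> x) = prepend \<tau> (chop \<rho> x)"
    and "\<And>\<rho>' \<tau>'. \<lbrakk>(\<rho>', \<tau>') \<in> Lmin \<Lambda> \<alpha> \<beta>; \<rho>' \<in> x\<rbrakk> \<Longrightarrow> \<rho>' = \<rho> \<and> \<tau>' = \<tau>"
proof -
  note c = boundary_compatible[OF x]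
  note l = L[unfolded Lmin_iff[OF M]]
  have z: "prepend \<alpha> x \<in> boundary" using prepend_boundary[OF x M(1) s] .
  have "Comp \<Lambda> \<beta> \<tau> \<in> prepend \<alpha> x" using prepend_mem(2)[OF c M(1) s \<rho>] l by simp
  then show "\<beta> \<in> prepend \<alpha> x" using boundary_prefix[OF z] l M prefixI by metis
  have "Src \<Lambda> \<tau> = Src \<Lambda> \<rho>" using l Src_Comp M by metis
  then show \<tau>: "Src \<Lambda> \<tau> \<in> chop \<rho> x" using Src_in_chop[of \<rho> x] \<rho> l by simp
  have y: "chop \<rho> x \<in> boundary" using chop_boundary[OF x \<rho>] .
  \<comment> \<open>Let \<open>y = chop \<rho> x\<close>. Since \<alpha>\<rho> = \<beta>\<tau>,
    prepending \<alpha>\<rho> to \<open>y\<close> amounts to prepending first \<tau> and then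
    \<beta>.\<close>
  have "prepend \<alpha> x = prepend \<alpha> (prepend \<rho> (chop \<rho> x))" using prepend_chop[OF x \<rho>] by simp
  also have "\<dots> = prepend (Comp \<Lambda> \<beta> \<tau>) (chop \<rho> x)"
    using l M by (subst prepend_Comp[symmetric]) (auto simp: chop_def)
  also have "\<dots> = prepend \<beta> (prepend \<tau> (chop \<rho> x))"
    using l M by (subst prepend_Comp) (auto simp: chop_def)
  finally have e: "prepend \<alpha> x = prepend \<beta> (prepend \<tau> (chop \<rho> x))" .
  have "Src \<Lambda> \<beta> \<in> prepend \<tau> (chop \<rho> x)"
    using prepend_boundary[OF y _ \<tau>] self_in_prepend[OF boundary_compatible[OF y] _ \<tau>] l Src_vertex[OF M(2)]
    by (subst boundary_vertex_iff[of _ _ \<tau>]) auto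
  then show "chop \<beta> (prepend \<alpha> x) = prepend \<tau> (chop \<rho> x)"
    unfolding e using chop_prepend[OF prepend_boundary[OF y _ \<tau>] M(2)] l by simp
  fix \<rho>' \<tau>' assume L': "(\<rho>', \<tau>') \<in> Lmin \<Lambda> \<alpha> \<beta>" and \<rho>': "\<rho>' \<in> x"
  note l' = L'[unfolded Lmin_iff[OF M]]
  obtain \<sigma> where "\<rho> \<preceq> \<sigma>" "\<rho>' \<preceq> \<sigma>" using compatible_two[OF c \<rho> \<rho>'] by auto
  \<comment> \<open>Both degrees equal the join minus the degree of \<alpha>, and a path has only
    one prefix of a given degree.\<close>
  moreover have "Deg \<Lambda> \<rho>' = Deg \<Lambda> \<rho>" using l l' M by (metis Deg_Comp add_left_cancel)
  ultimately have "\<rho>' = \<rho>" using prefix_same_Deg by metis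
  moreover then have "\<tau>' = \<tau>" using l l' M Comp_cancel_left[of \<beta> \<tau>' \<tau>] by metis
  ultimately show "\<rho>' = \<rho> \<and> \<tau>' = \<tau>" by simp
qed

text \<open>Both \<alpha> and \<beta> lie in the boundary set \<open>prepend \<alpha> x\<close>, so
  a minimal common extension \<alpha>\<rho> does too; removing \<alpha> puts \<rho> into
  \<open>x\<close>. Together with \<open>prepend_meets\<close>, exactly one summand of (KP3)
  contributes at \<open>x\<close> in this case.\<close>

lemma prepend_meets_ex:
  assumes x: "x \<in> boundary" and M: "\<alpha> \<in> Mor \<Lambda>" "\<beta> \<in> Mor \<Lambda>" and s: "Src \<Lambda> \<alpha> \<in> x"
    and \<beta>: "\<beta> \<in> prepend \<alpha> x"
  shows "\<exists>(\<rho>, \<tau>)\<in>Lmin \<Lambda> \<alpha> \<beta>. \<rho> \<in> x"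
proof -
  obtain \<rho> \<tau> where L: "(\<rho>, \<tau>) \<in> Lmin \<Lambda> \<alpha> \<beta>" "Comp \<Lambda> \<alpha> \<rho> \<in> prepend \<alpha> x"
    using boundary_Lmin[OF prepend_boundary[OF x M(1) s] self_in_prepend[OF boundary_compatible[OF x] M(1) s] \<beta>]
    by auto
  then have "\<rho> \<in> chop \<alpha> (prepend \<alpha> x)" using M by (simp add: Lmin_iff chop_def)
  then show ?thesis using chop_prepend[OF x M(1) s] L(1) by auto
qed

end


section \<open>The boundary representation\<close>

text \<open>
  Functions with values outside \<open>carrier R\<close> are admitted as arguments: linearity is demanded
  only for functions into \<open>carrier R\<close>, whereas all values of an operator are functions into
  \<open>carrier R\<close>.  Hence composition of operators needs no restriction of domains.
\<close>

definition operator_alg :: "('r, 'm) ring_scheme \<Rightarrow> ('r, ('x \<Rightarrow> 'r) \<Rightarrow> 'x \<Rightarrow> 'r) module" where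
  "operator_alg R =
    \<lparr>carrier = {T. (\<forall>f x. T f x \<in> carrier R) \<and>
       (\<forall>f g. range f \<subseteq> carrier R \<longrightarrow> range g \<subseteq> carrier R \<longrightarrow>
          T (\<lambda>x. f x \<oplus>\<^bsub>R\<^esub> g x) = (\<lambda>x. T f x \<oplus>\<^bsub>R\<^esub> T g x)) \<and>
       (\<forall>r f. r \<in> carrier R \<longrightarrow> range f \<subseteq> carrier R \<longrightarrow>
          T (\<lambda>x. r \<otimes>\<^bsub>R\<^esub> f x) = (\<lambda>x. r \<otimes>\<^bsub>R\<^esub> T f x))},
     mult = (\<lambda>T U f. T (U f)),
     one = (\<lambda>f. f),
     zero = (\<lambda>f x. \<zero>\<^bsub>R\<^esub>),
     add = (\<lambda>T U f x. T f x \<oplus>\<^bsub>R\<^esub> U f x),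
     smult = (\<lambda>r T f x. r \<otimes>\<^bsub>R\<^esub> T f x)\<rparr>"

text \<open>The test on the range of \<open>f\<close> makes every value an element of the carrier,
  as \<open>operator_alg\<close> demands for arbitrary arguments. The output of a pullback always
  passes the test, so it does not interfere with composition.\<close>

definition pullback :: "('r, 'm) ring_scheme \<Rightarrow> 'x set \<Rightarrow> ('x \<Rightarrow> 'x) \<Rightarrow> ('x \<Rightarrow> 'r) \<Rightarrow> 'x \<Rightarrow> 'r" where
  "pullback R D \<phi> f x = (if range f \<subseteq> carrier R \<and> x \<in> D then f (\<phi> x) else \<zero>\<^bsub>R\<^esub>)"

context cring
begin

abbreviation OA :: "('a, ('x \<Rightarrow> 'a) \<Rightarrow> 'x \<Rightarrow> 'a) module" where "OA \<equiv> operator_alg R"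

lemma operator_zero: "\<zero>\<^bsub>OA\<^esub> = (\<lambda>f x. \<zero>)"
  and operator_add: "T \<oplus>\<^bsub>OA\<^esub> U = (\<lambda>f x. T f x \<oplus> U f x)"
  and operator_mult: "T \<otimes>\<^bsub>OA\<^esub> U = (\<lambda>f. T (U f))"
  and operator_smult: "r \<odot>\<^bsub>OA\<^esub> T = (\<lambda>f x. r \<otimes> T f x)"
  by (simp_all add: operator_alg_def)

lemma operator_carrierD:
  assumes "T \<in> carrier OA"
  shows "T f x \<in> carrier R"
    and "\<lbrakk>range f \<subseteq> carrier R; range g \<subseteq> carrier R\<rbrakk> \<Longrightarrow> T (\<lambda>x. f x \<oplus> g x) = (\<lambda>x. T f x \<oplus> T g x)"
    and "\<lbrakk>r \<in> carrier R; range f \<subseteq> carrier R\<rbrakk> \<Longrightarrow> T (\<lambda>x. r \<otimes> f x) = (\<lambda>x. r \<otimes> T f x)"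
  using assms by (auto simp: operator_alg_def)

lemma operator_carrierI:
  assumes "\<And>f x. T f x \<in> carrier R"
    and "\<And>f g x. \<lbrakk>range f \<subseteq> carrier R; range g \<subseteq> carrier R\<rbrakk> \<Longrightarrow> T (\<lambda>x. f x \<oplus> g x) x = T f x \<oplus> T g x"
    and "\<And>r f x. \<lbrakk>r \<in> carrier R; range f \<subseteq> carrier R\<rbrakk> \<Longrightarrow> T (\<lambda>x. r \<otimes> f x) x = r \<otimes> T f x"
  shows "T \<in> carrier OA"
  using assms by (auto simp: operator_alg_def)

lemma operator_range: "T \<in> carrier OA \<Longrightarrow> range (T f) \<subseteq> carrier R"
  using operator_carrierD(1) by auto

lemma range_closed: "range f \<subseteq> carrier R \<Longrightarrow> f x \<in> carrier R"
  by auto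

lemma operator_nonunital_algebra: "nonunital_algebra R OA"
proof -
  have smult: "r \<odot>\<^bsub>OA\<^esub> T \<in> carrier OA" if "r \<in> carrier R" "T \<in> carrier OA" for r and T :: "('x \<Rightarrow> 'a) \<Rightarrow> 'x \<Rightarrow> 'a"
    unfolding operator_smult
    by (rule operator_carrierI) (use that in \<open>simp_all add: operator_carrierD r_distr m_lcomm\<close>)
  have add: "T \<oplus>\<^bsub>OA\<^esub> U \<in> carrier OA" if "T \<in> carrier OA" "U \<in> carrier OA" for T U :: "('x \<Rightarrow> 'a) \<Rightarrow> 'x \<Rightarrow> 'a"
    unfolding operator_add
    by (rule operator_carrierI) (use that in \<open>simp_all add: operator_carrierD r_distr a_ac\<close>)
  have mult: "T \<otimes>\<^bsub>OA\<^esub> U \<in> carrier OA" if "T \<in> carrier OA" "U \<in> carrier OA" for T U :: "('x \<Rightarrow> 'a) \<Rightarrow> 'x \<Rightarrow> 'a"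
    unfolding operator_mult
    by (rule operator_carrierI) (use that in \<open>simp_all add: operator_carrierD operator_range\<close>)
  have zero: "\<zero>\<^bsub>OA\<^esub> \<in> carrier (OA :: ('a, ('x \<Rightarrow> 'a) \<Rightarrow> 'x \<Rightarrow> 'a) module)"
    unfolding operator_zero by (rule operator_carrierI) simp_all
  have "abelian_group (OA :: ('a, ('x \<Rightarrow> 'a) \<Rightarrow> 'x \<Rightarrow> 'a) module)"
  proof (rule abelian_groupI)
    show "\<exists>U\<in>carrier OA. U \<oplus>\<^bsub>OA\<^esub> T = \<zero>\<^bsub>OA\<^esub>" if T: "T \<in> carrier OA" for T :: "('x \<Rightarrow> 'a) \<Rightarrow> 'x \<Rightarrow> 'a"
      using smult[of "\<ominus> \<one>" T] T
      by (intro bexI[of _ "(\<ominus> \<one>) \<odot>\<^bsub>OA\<^esub> T"])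
         (simp_all add: operator_add operator_smult operator_zero operator_carrierD l_minus l_neg)
  qed (use add zero in \<open>simp_all add: operator_add operator_zero operator_carrierD a_ac\<close>)
  then have "module R (OA :: ('a, ('x \<Rightarrow> 'a) \<Rightarrow> 'x \<Rightarrow> 'a) module)"
    using smult is_cring
    by (intro moduleI) (simp_all add: operator_add operator_smult operator_carrierD l_distr r_distr m_assoc)
  then show ?thesis
    using mult
    by (intro nonunital_algebraI)
       (simp_all add: operator_add operator_mult operator_smult operator_carrierD operator_range)
qed

lemma pullback_carrier: "pullback R D \<phi> \<in> carrier OA"
  by (rule operator_carrierI) (auto simp: pullback_def range_closed)

lemma pullback_closed: "pullback R D \<phi> f x \<in> carrier R"
  by (auto simp: pullback_def range_closed)

lemma pullback_cong:
  "\<lbrakk>D = E; \<And>x. x \<in> E \<Longrightarrow> \<phi> x = \<psi> x\<rbrakk> \<Longrightarrow> pullback R D \<phi> = pullback R E \<psi>"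
  by (auto simp: pullback_def fun_eq_iff)

lemma pullback_mult:
  "pullback R D \<phi> \<otimes>\<^bsub>OA\<^esub> pullback R E \<psi> = pullback R {x \<in> D. \<phi> x \<in> E} (\<lambda>x. \<psi> (\<phi> x))"
proof (intro ext)
  fix f x
  have "range (pullback R E \<psi> f) \<subseteq> carrier R"
    using pullback_closed by auto
  then have "(pullback R D \<phi> \<otimes>\<^bsub>OA\<^esub> pullback R E \<psi>) f x = (if x \<in> D then pullback R E \<psi> f (\<phi> x) else \<zero>)"
    by (simp add: operator_mult pullback_def[of R D])
  then show "(pullback R D \<phi> \<otimes>\<^bsub>OA\<^esub> pullback R E \<psi>) f x = pullback R {x \<in> D. \<phi> x \<in> E} (\<lambda>x. \<psi> (\<phi> x)) f x"
    by (simp add: pullback_def)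
qed

lemma operator_finsum:
  assumes "F \<in> I \<rightarrow> carrier (OA :: ('a, ('x \<Rightarrow> 'a) \<Rightarrow> 'x \<Rightarrow> 'a) module)"
  shows "finsum OA F I f x = finsum R (\<lambda>i. F i f x) I"
proof -
  interpret O: nonunital_algebra R "OA :: ('a, ('x \<Rightarrow> 'a) \<Rightarrow> 'x \<Rightarrow> 'a) module"
    by (rule operator_nonunital_algebra)
  show ?thesis using assms
  proof (induction I rule: infinite_finite_induct)
    case (insert i I)
    then show ?case by (simp add: operator_add Pi_iff operator_carrierD)
  qed (simp_all add: operator_zero)
qed

lemma operator_minus:
  assumes "T \<in> carrier (OA :: ('a, ('x \<Rightarrow> 'a) \<Rightarrow> 'x \<Rightarrow> 'a) module)" "U \<in> carrier OA"
  shows "(T \<ominus>\<^bsub>OA\<^esub> U) f x = T f x \<ominus> U f x"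
proof -
  interpret O: nonunital_algebra R "OA :: ('a, ('x \<Rightarrow> 'a) \<Rightarrow> 'x \<Rightarrow> 'a) module"
    by (rule operator_nonunital_algebra)
  have "\<ominus>\<^bsub>OA\<^esub> U = (\<ominus> \<one>) \<odot>\<^bsub>OA\<^esub> U" using assms by (simp add: O.smult_l_minus)
  then show ?thesis
    using assms by (simp add: a_minus_def operator_add operator_smult operator_carrierD l_minus)
qed

text \<open>Let one factor annihilate everything at \<open>x\<close>. The factors to its right
  change only its argument, and those to its left preserve vanishing at \<open>x\<close>. This
  settles (KP4) for every enumeration at once, without commuting the factors.\<close>

lemma list_product_vanishes:
  assumes "Ts \<noteq> []"
    and local: "\<And>T f. \<lbrakk>T \<in> set Ts; f x = \<zero>\<rbrakk> \<Longrightarrow> T f x = \<zero>"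
    and "\<exists>T\<in>set Ts. \<forall>f. T f x = \<zero>"
  shows "list_product OA Ts f x = \<zero>"
  using assms
proof (induction Ts arbitrary: f)
  case (Cons T Ts)
  show ?case
  proof (cases "Ts = []")
    case True
    then show ?thesis using Cons.prems by simp
  next
    case False
    then have e: "list_product OA (T # Ts) f x = T (list_product OA Ts f) x"
      by (cases Ts) (simp_all add: operator_mult)
    show ?thesis
    proof (cases "\<forall>f. T f x = \<zero>")
      case True
      then show ?thesis using e by simp
    next
      case False
      then have "list_product OA Ts f x = \<zero>"
        using Cons \<open>Ts \<noteq> []\<close> by auto
      then show ?thesis using e Cons.prems(2)[of T] by simp
    qed
  qed
qed simp

end

locale boundary_representation = finitely_aligned_kgraph \<Lambda> + cring R
  for \<Lambda> :: "('a, 'k::finite) kgraph" and R :: "('r, 'm) ring_scheme" (structure)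
begin

text \<open>Pulling back along removal means pushing forward along prepending: if the source of
  \<alpha> lies in the boundary set \<open>y\<close>, the indicator function of \<open>y\<close>
  goes to that of \<open>prepend \<alpha> y\<close>. As pullback is contravariant, the operators
  then compose in the order of (KP2).\<close>

definition path_op :: "'a \<Rightarrow> ('a set \<Rightarrow> 'r) \<Rightarrow> 'a set \<Rightarrow> 'r" where
  "path_op \<alpha> = pullback R {x \<in> boundary. \<alpha> \<in> x} (chop \<alpha>)"

definition ghost_op :: "'a \<Rightarrow> ('a set \<Rightarrow> 'r) \<Rightarrow> 'a set \<Rightarrow> 'r" where
  "ghost_op \<alpha> = pullback R {x \<in> boundary. Src \<Lambda> \<alpha> \<in> x} (prepend \<alpha>)"

fun boundary_rep :: "'a symbol \<Rightarrow> ('a set \<Rightarrow> 'r) \<Rightarrow> 'a set \<Rightarrow> 'r" where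
  "boundary_rep (Path \<alpha>) = path_op \<alpha>"
| "boundary_rep (Ghost \<alpha>) = ghost_op \<alpha>"

lemma op_carrier: "path_op \<alpha> \<in> carrier OA" "ghost_op \<alpha> \<in> carrier OA"
  by (simp_all add: path_op_def ghost_op_def pullback_carrier)

lemma boundary_rep_star: "boundary_rep (star \<Lambda> \<alpha>) = ghost_op \<alpha>"
proof (cases "\<alpha> \<in> vertices \<Lambda>")
  case True
  then have "path_op \<alpha> = ghost_op \<alpha>"
    unfolding path_op_def ghost_op_def
    using boundary_vertex[OF _ True] vertex_simps[OF True] by (intro pullback_cong) auto
  then show ?thesis using True by (simp add: star_def)
qed (simp add: star_def)

lemma path_ghost:
  assumes "\<rho> \<in> Mor \<Lambda>" "Src \<Lambda> \<tau> = Src \<Lambda> \<rho>"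
  shows "path_op \<rho> \<otimes>\<^bsub>OA\<^esub> ghost_op \<tau> = pullback R {x \<in> boundary. \<rho> \<in> x} (\<lambda>x. prepend \<tau> (chop \<rho> x))"
  unfolding path_op_def ghost_op_def pullback_mult
  using assms chop_boundary Src_in_chop by (intro pullback_cong) auto

text \<open>Prepending undoes removal, so the range projection of \<alpha> acts on functions into
  the carrier as multiplication by the indicator function of the boundary sets through
  \<alpha>.\<close>

lemma path_ghost_self:
  assumes "\<alpha> \<in> Mor \<Lambda>"
  shows "path_op \<alpha> \<otimes>\<^bsub>OA\<^esub> ghost_op \<alpha> = pullback R {x \<in> boundary. \<alpha> \<in> x} (\<lambda>x. x)"
  unfolding path_ghost[OF assms refl] using prepend_chop by (intro pullback_cong) auto

lemma vertex_op:
  assumes "v \<in> vertices \<Lambda>"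
  shows "path_op v = pullback R {x \<in> boundary. v \<in> x} (\<lambda>x. x)"
  unfolding path_op_def using boundary_vertex[OF _ assms] by (intro pullback_cong) auto

lemma path_op_Comp:
  assumes "\<alpha> \<in> Mor \<Lambda>" "\<mu> \<in> Mor \<Lambda>" "Src \<Lambda> \<alpha> = Rng \<Lambda> \<mu>"
  shows "path_op \<alpha> \<otimes>\<^bsub>OA\<^esub> path_op \<mu> = path_op (Comp \<Lambda> \<alpha> \<mu>)"
  unfolding path_op_def pullback_mult
proof (rule pullback_cong)
  have mem: "\<mu> \<in> chop \<alpha> x \<longleftrightarrow> Comp \<Lambda> \<alpha> \<mu> \<in> x" for x
    using assms by (simp add: chop_def)
  have "\<alpha> \<in> x" if "x \<in> boundary" "Comp \<Lambda> \<alpha> \<mu> \<in> x" for x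
    using boundary_prefix[OF that prefixI[OF assms]] .
  then show "{x \<in> {x \<in> boundary. \<alpha> \<in> x}. chop \<alpha> x \<in> {x \<in> boundary. \<mu> \<in> x}} = {x \<in> boundary. Comp \<Lambda> \<alpha> \<mu> \<in> x}"
    using chop_boundary mem by auto
qed (simp add: chop_Comp[OF assms])

lemma ghost_op_Comp:
  assumes "\<alpha> \<in> Mor \<Lambda>" "\<mu> \<in> Mor \<Lambda>" "Src \<Lambda> \<alpha> = Rng \<Lambda> \<mu>"
  shows "ghost_op \<mu> \<otimes>\<^bsub>OA\<^esub> ghost_op \<alpha> = ghost_op (Comp \<Lambda> \<alpha> \<mu>)"
  unfolding ghost_op_def pullback_mult
proof (rule pullback_cong)
  have "prepend \<mu> x \<in> boundary \<and> Src \<Lambda> \<alpha> \<in> prepend \<mu> x" if x: "x \<in> boundary" "Src \<Lambda> \<mu> \<in> x" for x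
  proof -
    have p: "prepend \<mu> x \<in> boundary" using prepend_boundary[OF x(1) assms(2) x(2)] .
    have "\<mu> \<in> prepend \<mu> x" using self_in_prepend[OF boundary_compatible[OF x(1)] assms(2) x(2)] .
    then have "Rng \<Lambda> \<mu> \<in> prepend \<mu> x"
      using boundary_prefix[OF p _ Rng_prefix[OF assms(2)]] by blast
    then show ?thesis using p assms(3) by simp
  qed
  then show "{x \<in> {x \<in> boundary. Src \<Lambda> \<mu> \<in> x}. prepend \<mu> x \<in> {x \<in> boundary. Src \<Lambda> \<alpha> \<in> x}} =
      {x \<in> boundary. Src \<Lambda> (Comp \<Lambda> \<alpha> \<mu>) \<in> x}"
    by (auto simp: Src_Comp[OF assms])
  show "prepend \<alpha> (prepend \<mu> x) = prepend (Comp \<Lambda> \<alpha> \<mu>) x"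
    if "x \<in> {x \<in> boundary. Src \<Lambda> (Comp \<Lambda> \<alpha> \<mu>) \<in> x}" for x
    using that compatible_Mor[OF boundary_compatible, of x]
    by (intro prepend_Comp[symmetric] assms) auto
qed

lemma ghost_path:
  assumes M: "\<alpha> \<in> Mor \<Lambda>" "\<mu> \<in> Mor \<Lambda>"
  shows "ghost_op \<alpha> \<otimes>\<^bsub>OA\<^esub> path_op \<mu> =
    finsum OA (\<lambda>(\<rho>, \<tau>). path_op \<rho> \<otimes>\<^bsub>OA\<^esub> ghost_op \<tau>) (Lmin \<Lambda> \<alpha> \<mu>)"
proof (intro ext)
  interpret O: nonunital_algebra R "OA :: ('r, ('a set \<Rightarrow> 'r) \<Rightarrow> 'a set \<Rightarrow> 'r) module"
    by (rule operator_nonunital_algebra)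
  fix f :: "'a set \<Rightarrow> 'r" and x
  let ?L = "Lmin \<Lambda> \<alpha> \<mu>"
  \<comment> \<open>Absorbs the test on the range of \<open>f\<close> once and for all, so that each
    pullback at a point becomes a single case distinction on the domain.\<close>
  define g where "g y = (if range f \<subseteq> carrier R then f y else \<zero>)" for y
  have g: "g y \<in> carrier R" for y by (auto simp: g_def)
  have pb: "pullback R D \<phi> f y = (if y \<in> D then g (\<phi> y) else \<zero>)" for D \<phi> y
    by (simp add: pullback_def g_def)
  let ?t = "\<lambda>(\<rho>, \<tau>). if x \<in> boundary \<and> \<rho> \<in> x then g (prepend \<tau> (chop \<rho> x)) else \<zero>"
  have summand: "(path_op \<rho> \<otimes>\<^bsub>OA\<^esub> ghost_op \<tau>) f x = ?t (\<rho>, \<tau>)" if L: "(\<rho>, \<tau>) \<in> ?L" for \<rho> \<tau>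
  proof -
    have l: "\<rho> \<in> Mor \<Lambda>" "\<tau> \<in> Mor \<Lambda>" "Src \<Lambda> \<alpha> = Rng \<Lambda> \<rho>" "Src \<Lambda> \<mu> = Rng \<Lambda> \<tau>" "Comp \<Lambda> \<alpha> \<rho> = Comp \<Lambda> \<mu> \<tau>"
      using L by (simp_all add: Lmin_iff[OF M])
    have "Src \<Lambda> \<tau> = Src \<Lambda> \<rho>"
      using Src_Comp[OF M(1) l(1,3)] Src_Comp[OF M(2) l(2,4)] l(5) by simp
    then show ?thesis by (simp add: path_ghost[OF l(1)] pb)
  qed
  have "finsum OA (\<lambda>(\<rho>, \<tau>). path_op \<rho> \<otimes>\<^bsub>OA\<^esub> ghost_op \<tau>) ?L f x =
      finsum R (\<lambda>p. (\<lambda>(\<rho>, \<tau>). path_op \<rho> \<otimes>\<^bsub>OA\<^esub> ghost_op \<tau>) p f x) ?L"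
    by (rule operator_finsum) (auto intro!: O.mult_closed op_carrier)
  also have "\<dots> = finsum R ?t ?L"
  proof (rule finsum_cong')
    show "?t \<in> ?L \<rightarrow> carrier R" using g by auto
  qed (use summand in auto)
  \<comment> \<open>The right side is the left side of (KP3) evaluated at \<open>x\<close>. When the
    condition holds exactly one summand survives, and otherwise none does.\<close>
  also have "\<dots> = (if x \<in> boundary \<and> Src \<Lambda> \<alpha> \<in> x \<and> \<mu> \<in> prepend \<alpha> x then g (chop \<mu> (prepend \<alpha> x)) else \<zero>)"
  proof (cases "x \<in> boundary \<and> Src \<Lambda> \<alpha> \<in> x \<and> \<mu> \<in> prepend \<alpha> x")
    case True
    then have x: "x \<in> boundary" "Src \<Lambda> \<alpha> \<in> x" "\<mu> \<in> prepend \<alpha> x" by auto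
    obtain \<rho> \<tau> where L: "(\<rho>, \<tau>) \<in> ?L" "\<rho> \<in> x"
      using prepend_meets_ex[OF x(1) M x(2,3)] by auto
    note m = prepend_meets[OF x(1) M x(2) L]
    have "finsum R ?t ?L = finsum R (\<lambda>p. if p = (\<rho>, \<tau>) then g (chop \<mu> (prepend \<alpha> x)) else \<zero>) ?L"
    proof (rule finsum_cong')
      fix p assume p: "p \<in> ?L"
      obtain \<rho>' \<tau>' where p': "p = (\<rho>', \<tau>')" by (cases p)
      show "?t p = (if p = (\<rho>, \<tau>) then g (chop \<mu> (prepend \<alpha> x)) else \<zero>)"
      proof (cases "\<rho>' \<in> x")
        case True
        then have "\<rho>' = \<rho>" "\<tau>' = \<tau>" using m(4) p unfolding p' by blast+
        then show ?thesis using x(1) L(2) m(3) by (simp add: p')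
      next
        case False
        then show ?thesis using L(2) by (auto simp: p')
      qed
    qed (simp_all add: g)
    also have "\<dots> = g (chop \<mu> (prepend \<alpha> x))"
      using add.finprod_singleton_swap[OF L(1) finitely_aligned[OF M], of "\<lambda>_. g (chop \<mu> (prepend \<alpha> x))"] g
      by simp
    finally show ?thesis using x by simp
  next
    case False
    have "?t p = \<zero>" if p: "p \<in> ?L" for p
    proof -
      obtain \<rho> \<tau> where p': "p = (\<rho>, \<tau>)" by (cases p)
      \<comment> \<open>A contributing \<rho> would put its range, the source of \<alpha>, into
        \<open>x\<close>, and \<open>prepend_meets\<close> would then put \<mu> into
        \<open>prepend \<alpha> x\<close>.\<close>
      have False if c: "x \<in> boundary" "\<rho> \<in> x"
      proof -
        have L: "(\<rho>, \<tau>) \<in> ?L" using p p' by simp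
        then have "\<rho> \<in> Mor \<Lambda>" "Src \<Lambda> \<alpha> = Rng \<Lambda> \<rho>" by (simp_all add: Lmin_iff[OF M])
        then have s: "Src \<Lambda> \<alpha> \<in> x" using boundary_prefix[OF c] Rng_prefix[of \<rho>] by simp
        show False using prepend_meets(1)[OF c(1) M s L c(2)] \<open>\<not> _\<close> s c(1) by simp
      qed
      then show ?thesis by (auto simp: p')
    qed
    then have "finsum R ?t ?L = \<zero>" by (rule add.finprod_one_eqI)
    then show ?thesis unfolding if_not_P[OF False] .
  qed
  also have "\<dots> = (ghost_op \<alpha> \<otimes>\<^bsub>OA\<^esub> path_op \<mu>) f x"
    unfolding path_op_def ghost_op_def pullback_mult pb
    using prepend_boundary[OF _ M(1)] by simp
  finally show "(ghost_op \<alpha> \<otimes>\<^bsub>OA\<^esub> path_op \<mu>) f x =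
    finsum OA (\<lambda>(\<rho>, \<tau>). path_op \<rho> \<otimes>\<^bsub>OA\<^esub> ghost_op \<tau>) ?L f x" by (rule sym)
qed

lemma gap_op:
  assumes v: "v \<in> vertices \<Lambda>" and \<alpha>: "\<alpha> \<in> Mor \<Lambda>"
  shows "(path_op v \<ominus>\<^bsub>OA\<^esub> path_op \<alpha> \<otimes>\<^bsub>OA\<^esub> ghost_op \<alpha>) f x =
    pullback R {x \<in> boundary. v \<in> x} (\<lambda>x. x) f x \<ominus> pullback R {x \<in> boundary. \<alpha> \<in> x} (\<lambda>x. x) f x"
  using operator_minus[OF pullback_carrier pullback_carrier]
  by (simp add: vertex_op[OF v] path_ghost_self[OF \<alpha>])

lemma boundary_family: "kumjian_pask_family \<Lambda> R OA boundary_rep"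
proof -
  interpret O: nonunital_algebra R "OA :: ('r, ('a set \<Rightarrow> 'r) \<Rightarrow> 'a set \<Rightarrow> 'r) module"
    by (rule operator_nonunital_algebra)
  show ?thesis
  proof unfold_locales
    show "boundary_rep \<in> symbols \<Lambda> \<rightarrow> carrier OA"
    proof
      fix s show "boundary_rep s \<in> carrier OA" by (cases s) (simp_all add: op_carrier)
    qed
  next
    fix v w assume v: "v \<in> vertices \<Lambda>" and w: "w \<in> vertices \<Lambda>"
    show "boundary_rep (Path v) \<otimes>\<^bsub>OA\<^esub> boundary_rep (Path w) = (if v = w then boundary_rep (Path v) else \<zero>\<^bsub>OA\<^esub>)"
    proof (cases "v = w")
      case True
      then show ?thesis
        by (simp add: vertex_op[OF w] pullback_mult)
    next
      case False
      then have no: "v \<notin> x \<or> w \<notin> x" if "x \<in> boundary" for x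
        using boundary_vertex_iff[OF that v, of w] vertex_simps[OF w] by auto
      have "pullback R {x \<in> {x \<in> boundary. v \<in> x}. x \<in> {x \<in> boundary. w \<in> x}} (\<lambda>x. x) = \<zero>\<^bsub>OA\<^esub>"
        using no by (auto simp: pullback_def operator_zero fun_eq_iff)
      then show ?thesis
        using False by (simp add: vertex_op[OF w] vertex_op[OF v] pullback_mult)
    qed
  next
    fix v E \<alpha>s assume v: "v \<in> vertices \<Lambda>" and E: "E \<in> FE \<Lambda> v" and \<alpha>s: "distinct \<alpha>s" "set \<alpha>s = E"
    have EM: "E \<subseteq> Mor \<Lambda>" "finite E" "exhaustive \<Lambda> v E" "\<And>\<alpha>. \<alpha> \<in> E \<Longrightarrow> Rng \<Lambda> \<alpha> = v"
      using E by (auto simp: FE_def paths_to_def)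
    have "v \<in> paths_to \<Lambda> v" using vertex_simps[OF v] by (simp add: paths_to_def)
    then have ne: "\<alpha>s \<noteq> []" using EM(3) \<alpha>s by (auto simp: exhaustive_def)
    let ?D = "\<lambda>\<alpha>. boundary_rep (Path v) \<ominus>\<^bsub>OA\<^esub> boundary_rep (Path \<alpha>) \<otimes>\<^bsub>OA\<^esub> boundary_rep (star \<Lambda> \<alpha>)"
    have D: "?D \<alpha> f x = pullback R {x \<in> boundary. v \<in> x} (\<lambda>x. x) f x \<ominus> pullback R {x \<in> boundary. \<alpha> \<in> x} (\<lambda>x. x) f x"
      if "\<alpha> \<in> E" for \<alpha> f x
      using gap_op[OF v, of \<alpha>] that EM(1) by (auto simp: boundary_rep_star)
    show "list_product OA (map ?D \<alpha>s) = \<zero>\<^bsub>OA\<^esub>"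
    proof (intro ext)
      fix f x
      have "list_product OA (map ?D \<alpha>s) f x = \<zero>"
      proof (rule list_product_vanishes)
        show "map ?D \<alpha>s \<noteq> []" using ne by simp
      next
        fix T f assume "T \<in> set (map ?D \<alpha>s)" and "f x = \<zero>"
        then show "T f x = \<zero>"
          using D \<alpha>s by (auto simp: pullback_def a_minus_def)
      next
        \<comment> \<open>If the boundary set \<open>x\<close> passes through \<open>v\<close>,
          exhaustiveness gives a member of \<open>E\<close> in \<open>x\<close>. Otherwise any
          member of the nonempty set \<open>E\<close> serves, because both projections are zero at
          \<open>x\<close>.\<close>
        have "\<exists>\<alpha>\<in>E. x \<in> boundary \<and> v \<in> x \<longrightarrow> \<alpha> \<in> x"
        proof (cases "x \<in> boundary \<and> v \<in> x")
          case True
          then show ?thesis using boundary_exhaustive[OF _ v _ EM(2,3)] by blast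
        next
          case False
          then show ?thesis using ne \<alpha>s(2) by (cases \<alpha>s) auto
        qed
        then obtain \<alpha> where \<alpha>: "\<alpha> \<in> E" "x \<in> boundary \<and> v \<in> x \<longrightarrow> \<alpha> \<in> x" by blast
        have iff: "x \<in> boundary \<and> v \<in> x \<longleftrightarrow> x \<in> boundary \<and> \<alpha> \<in> x"
          using \<alpha> boundary_vertex_iff[OF _ v, of x \<alpha>] EM(4) by blast
        have "pullback R {x \<in> boundary. v \<in> x} (\<lambda>x. x) f x = pullback R {x \<in> boundary. \<alpha> \<in> x} (\<lambda>x. x) f x" for f
          using iff by (simp add: pullback_def)
        then have "?D \<alpha> f x = \<zero>" for f
          unfolding D[OF \<alpha>(1)] by (simp only: a_minus_def r_neg[OF pullback_closed])
        then show "\<exists>T\<in>set (map ?D \<alpha>s). \<forall>f. T f x = \<zero>" using \<alpha>(1) \<alpha>s by auto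
      qed
      then show "list_product OA (map ?D \<alpha>s) f x = \<zero>\<^bsub>OA\<^esub> f x" by (simp add: operator_zero)
    qed
  qed (simp_all add: boundary_rep_star path_op_Comp ghost_op_Comp ghost_path)
qed

lemma boundary_rep_vertex:
  assumes r: "r \<in> carrier R" "r \<noteq> \<zero>" and v: "v \<in> vertices \<Lambda>"
  shows "r \<odot>\<^bsub>OA\<^esub> boundary_rep (Path v) \<noteq> \<zero>\<^bsub>OA\<^esub>"
proof
  assume z: "r \<odot>\<^bsub>OA\<^esub> boundary_rep (Path v) = \<zero>\<^bsub>OA\<^esub>"
  obtain x where x: "x \<in> boundary" "v \<in> x" using boundary_through[OF v] by blast
  \<comment> \<open>Evaluating at the constant function one, at a boundary set through
    \<open>v\<close>, recovers the scalar.\<close>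
  have "(r \<odot>\<^bsub>OA\<^esub> boundary_rep (Path v)) (\<lambda>_. \<one>) x = r"
    using x r by (auto simp: operator_smult vertex_op[OF v] pullback_def)
  then show False using z r by (simp add: operator_zero)
qed

end


section \<open>Reduction of words in a Kumjian-Pask family\<close>

context kgraph
begin

lemma Path_symbols: "\<alpha> \<in> Mor \<Lambda> \<Longrightarrow> Path \<alpha> \<in> symbols \<Lambda>"
  by (simp add: symbols_def)

lemma star_symbols: "\<alpha> \<in> Mor \<Lambda> \<Longrightarrow> star \<Lambda> \<alpha> \<in> symbols \<Lambda>"
  by (auto simp: symbols_def star_def)

lemma symbols_cases:
  assumes "x \<in> symbols \<Lambda>"
  obtains \<alpha> where "\<alpha> \<in> Mor \<Lambda>" "x = Path \<alpha>" | \<alpha> where "\<alpha> \<in> Mor \<Lambda>" "\<alpha> \<notin> vertices \<Lambda>" "x = star \<Lambda> \<alpha>"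
  using assms by (auto simp: symbols_def star_def)

lemma star_vertex: "v \<in> vertices \<Lambda> \<Longrightarrow> star \<Lambda> v = Path v"
  by (simp add: star_def)

lemma FE_nonempty:
  assumes "v \<in> vertices \<Lambda>" "E \<in> FE \<Lambda> v"
  shows "E \<noteq> {}" "E \<subseteq> Mor \<Lambda>"
proof -
  have "v \<in> paths_to \<Lambda> v" using vertex_simps[OF assms(1)] by (simp add: paths_to_def)
  then show "E \<noteq> {}" using assms(2) by (auto simp: FE_def exhaustive_def)
  show "E \<subseteq> Mor \<Lambda>" using assms(2) by (auto simp: FE_def paths_to_def)
qed

lemma int_deg_Comp:
  assumes "\<alpha> \<in> Mor \<Lambda>" "\<mu> \<in> Mor \<Lambda>" "Src \<Lambda> \<alpha> = Rng \<Lambda> \<mu>"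
  shows "int_deg \<Lambda> (Comp \<Lambda> \<alpha> \<mu>) = int_deg \<Lambda> \<alpha> + int_deg \<Lambda> \<mu>"
  by (simp add: int_deg_def Deg_Comp[OF assms] vec_eq_iff)

lemma int_deg_vertex: "v \<in> vertices \<Lambda> \<Longrightarrow> int_deg \<Lambda> v = 0"
  by (simp add: int_deg_def vertex_simps vec_eq_iff)

fun symbol_deg :: "'a symbol \<Rightarrow> int ^ 'k" where
  "symbol_deg (Path \<alpha>) = int_deg \<Lambda> \<alpha>"
| "symbol_deg (Ghost \<alpha>) = - int_deg \<Lambda> \<alpha>"

definition word_deg :: "'a symbol list \<Rightarrow> int ^ 'k" where
  "word_deg w = sum_list (map symbol_deg w)"

lemma symbol_deg_star: "symbol_deg (star \<Lambda> \<alpha>) = - int_deg \<Lambda> \<alpha>"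
  by (auto simp: star_def int_deg_vertex)

end

context kumjian_pask_family
begin

lemma S_Path [simp]: "\<alpha> \<in> Mor \<Lambda> \<Longrightarrow> S (Path \<alpha>) \<in> carrier A"
  using S_closed Path_symbols by auto

lemma S_star [simp]: "\<alpha> \<in> Mor \<Lambda> \<Longrightarrow> S (star \<Lambda> \<alpha>) \<in> carrier A"
  using S_closed star_symbols by auto

text \<open>This is \<open>KP_component\<close> for an arbitrary family. The reduction of words uses
  the relations only, and is applied at the end to the universal family.\<close>

definition homogeneous_span where
  "homogeneous_span n = linear_span R A {S (Path \<alpha>) \<otimes>\<^bsub>A\<^esub> S (star \<Lambda> \<mu>) | \<alpha> \<mu>.
     \<alpha> \<in> Mor \<Lambda> \<and> \<mu> \<in> Mor \<Lambda> \<and> int_deg \<Lambda> \<alpha> - int_deg \<Lambda> \<mu> = n}"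

lemma homogeneous_span_submodule: "submodule (homogeneous_span n) R A"
  unfolding homogeneous_span_def by (rule linear_span_submodule) (auto simp: mult_closed)

lemma homogeneous_span_gen:
  assumes "\<alpha> \<in> Mor \<Lambda>" "\<mu> \<in> Mor \<Lambda>" "int_deg \<Lambda> \<alpha> - int_deg \<Lambda> \<mu> = n"
  shows "S (Path \<alpha>) \<otimes>\<^bsub>A\<^esub> S (star \<Lambda> \<mu>) \<in> homogeneous_span n"
  unfolding homogeneous_span_def by (rule linear_span_incl) (use assms in \<open>auto simp: mult_closed\<close>)

lemma homogeneous_span_zero: "\<zero>\<^bsub>A\<^esub> \<in> homogeneous_span n"
  using submodule_zero[OF homogeneous_span_submodule] .

lemma S_Path_Src:
  assumes "\<alpha> \<in> Mor \<Lambda>"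
  shows "S (Path \<alpha>) \<otimes>\<^bsub>A\<^esub> S (Path (Src \<Lambda> \<alpha>)) = S (Path \<alpha>)"
  using KP2_path[OF assms Src_closed[OF assms]] assms by (simp add: Rng_Src Comp_Src_right)

lemma S_Rng_Path:
  assumes "\<alpha> \<in> Mor \<Lambda>"
  shows "S (Path (Rng \<Lambda> \<alpha>)) \<otimes>\<^bsub>A\<^esub> S (Path \<alpha>) = S (Path \<alpha>)"
  using KP2_path[OF Rng_closed[OF assms] assms] assms by (simp add: Src_Rng Comp_Rng_left)

lemma S_Src_star:
  assumes "\<alpha> \<in> Mor \<Lambda>"
  shows "S (Path (Src \<Lambda> \<alpha>)) \<otimes>\<^bsub>A\<^esub> S (star \<Lambda> \<alpha>) = S (star \<Lambda> \<alpha>)"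
  using KP2_ghost[OF assms Src_closed[OF assms]] assms star_vertex[OF Src_vertex[OF assms]]
  by (simp add: Rng_Src Comp_Src_right)

lemma S_star_Rng:
  assumes "\<alpha> \<in> Mor \<Lambda>"
  shows "S (star \<Lambda> \<alpha>) \<otimes>\<^bsub>A\<^esub> S (Path (Rng \<Lambda> \<alpha>)) = S (star \<Lambda> \<alpha>)"
  using KP2_ghost[OF Rng_closed[OF assms] assms] assms star_vertex[OF Rng_vertex[OF assms]]
  by (simp add: Src_Rng Comp_Rng_left)

text \<open>Insert the two vertex idempotents between the factors and use (KP1). It supplies what
  (KP2) leaves open: products of paths, or of ghosts, that cannot be composed are zero.\<close>

lemma orthogonal_at_vertices:
  assumes x: "x \<in> carrier A" "x \<otimes>\<^bsub>A\<^esub> S (Path v) = x" and y: "y \<in> carrier A" "S (Path w) \<otimes>\<^bsub>A\<^esub> y = y"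
    and vw: "v \<in> vertices \<Lambda>" "w \<in> vertices \<Lambda>" "v \<noteq> w"
  shows "x \<otimes>\<^bsub>A\<^esub> y = \<zero>\<^bsub>A\<^esub>"
proof -
  have c: "S (Path v) \<in> carrier A" "S (Path w) \<in> carrier A"
    using vw vertex_simps(1) by auto
  have "x \<otimes>\<^bsub>A\<^esub> y = (x \<otimes>\<^bsub>A\<^esub> S (Path v)) \<otimes>\<^bsub>A\<^esub> (S (Path w) \<otimes>\<^bsub>A\<^esub> y)" using x(2) y(2) by simp
  also have "\<dots> = x \<otimes>\<^bsub>A\<^esub> ((S (Path v) \<otimes>\<^bsub>A\<^esub> S (Path w)) \<otimes>\<^bsub>A\<^esub> y)"
    using x(1) y(1) c by (simp add: mult_assoc mult_closed)
  finally show ?thesis using KP1[OF vw(1,2)] vw(3) x(1) y(1) by simp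
qed

lemma path_mult_term:
  assumes M: "\<nu> \<in> Mor \<Lambda>" "\<alpha> \<in> Mor \<Lambda>" "\<mu> \<in> Mor \<Lambda>"
    and n: "int_deg \<Lambda> \<nu> + int_deg \<Lambda> \<alpha> - int_deg \<Lambda> \<mu> = n"
  shows "S (Path \<nu>) \<otimes>\<^bsub>A\<^esub> (S (Path \<alpha>) \<otimes>\<^bsub>A\<^esub> S (star \<Lambda> \<mu>)) \<in> homogeneous_span n"
proof -
  have e: "S (Path \<nu>) \<otimes>\<^bsub>A\<^esub> (S (Path \<alpha>) \<otimes>\<^bsub>A\<^esub> S (star \<Lambda> \<mu>)) = (S (Path \<nu>) \<otimes>\<^bsub>A\<^esub> S (Path \<alpha>)) \<otimes>\<^bsub>A\<^esub> S (star \<Lambda> \<mu>)"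
    using M by (simp add: mult_assoc)
  show ?thesis
  proof (cases "Src \<Lambda> \<nu> = Rng \<Lambda> \<alpha>")
    case True
    then show ?thesis
      unfolding e KP2_path[OF M(1,2) True]
      using M n by (intro homogeneous_span_gen Comp_closed) (simp_all add: int_deg_Comp)
  next
    case False
    have "S (Path \<nu>) \<otimes>\<^bsub>A\<^esub> S (Path \<alpha>) = \<zero>\<^bsub>A\<^esub>"
      using M False S_Path_Src[OF M(1)] S_Rng_Path[OF M(2)] Src_vertex Rng_vertex
      by (intro orthogonal_at_vertices) auto
    then show ?thesis unfolding e using M homogeneous_span_zero by simp
  qed
qed

text \<open>(KP3) replaces the ghost of \<nu> times \<alpha> by terms \<rho> times the ghost of
  \<tau>. The ghosts of \<tau> and \<mu> merge into that of \<mu>\<tau>, or their product is zero.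
  Since \<nu>\<rho> = \<alpha>\<tau>, the degrees of \<rho> and \<tau> differ by the same vector as
  those of \<alpha> and \<nu>.\<close>

lemma ghost_mult_term:
  assumes M: "\<nu> \<in> Mor \<Lambda>" "\<alpha> \<in> Mor \<Lambda>" "\<mu> \<in> Mor \<Lambda>"
    and n: "int_deg \<Lambda> \<alpha> - int_deg \<Lambda> \<nu> - int_deg \<Lambda> \<mu> = n"
  shows "S (star \<Lambda> \<nu>) \<otimes>\<^bsub>A\<^esub> (S (Path \<alpha>) \<otimes>\<^bsub>A\<^esub> S (star \<Lambda> \<mu>)) \<in> homogeneous_span n"
proof -
  let ?L = "Lmin \<Lambda> \<nu> \<alpha>"
  let ?t = "\<lambda>(\<rho>, \<tau>). S (Path \<rho>) \<otimes>\<^bsub>A\<^esub> S (star \<Lambda> \<tau>)"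
  have t: "?t \<in> ?L \<rightarrow> carrier A" using M by (auto simp: Lmin_iff mult_closed)
  have "S (star \<Lambda> \<nu>) \<otimes>\<^bsub>A\<^esub> (S (Path \<alpha>) \<otimes>\<^bsub>A\<^esub> S (star \<Lambda> \<mu>)) = finsum A ?t ?L \<otimes>\<^bsub>A\<^esub> S (star \<Lambda> \<mu>)"
    using M KP3[OF M(1,2)] mult_assoc[of "S (star \<Lambda> \<nu>)" "S (Path \<alpha>)" "S (star \<Lambda> \<mu>)"] by simp
  also have "\<dots> = finsum A (\<lambda>p. ?t p \<otimes>\<^bsub>A\<^esub> S (star \<Lambda> \<mu>)) ?L"
    using M t by (intro mult_finsum_left finitely_aligned) auto
  also have "\<dots> \<in> homogeneous_span n"
  proof (rule submodule_finsum[OF homogeneous_span_submodule], rule)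
    fix p assume p: "p \<in> ?L"
    obtain \<rho> \<tau> where p': "p = (\<rho>, \<tau>)" by (cases p)
    have l: "\<rho> \<in> Mor \<Lambda>" "\<tau> \<in> Mor \<Lambda>" "Src \<Lambda> \<nu> = Rng \<Lambda> \<rho>" "Src \<Lambda> \<alpha> = Rng \<Lambda> \<tau>" "Comp \<Lambda> \<nu> \<rho> = Comp \<Lambda> \<alpha> \<tau>"
      using p by (simp_all add: p' Lmin_iff[OF M(1,2)])
    have "int_deg \<Lambda> \<nu> + int_deg \<Lambda> \<rho> = int_deg \<Lambda> \<alpha> + int_deg \<Lambda> \<tau>"
      using int_deg_Comp[OF M(1) l(1,3)] int_deg_Comp[OF M(2) l(2,4)] l(5) by simp
    then have d: "int_deg \<Lambda> \<rho> - (int_deg \<Lambda> \<mu> + int_deg \<Lambda> \<tau>) = n"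
      unfolding n[symmetric] by (simp add: algebra_simps)
    have e: "?t p \<otimes>\<^bsub>A\<^esub> S (star \<Lambda> \<mu>) = S (Path \<rho>) \<otimes>\<^bsub>A\<^esub> (S (star \<Lambda> \<tau>) \<otimes>\<^bsub>A\<^esub> S (star \<Lambda> \<mu>))"
      using l(1,2) M by (simp add: p' mult_assoc)
    show "?t p \<otimes>\<^bsub>A\<^esub> S (star \<Lambda> \<mu>) \<in> homogeneous_span n"
    proof (cases "Src \<Lambda> \<mu> = Rng \<Lambda> \<tau>")
      case True
      show ?thesis
        unfolding e KP2_ghost[OF M(3) l(2) True]
        using homogeneous_span_gen[OF l(1) Comp_closed[OF M(3) l(2) True]] int_deg_Comp[OF M(3) l(2) True] d
        by simp
    next
      case False
      have "S (star \<Lambda> \<tau>) \<otimes>\<^bsub>A\<^esub> S (star \<Lambda> \<mu>) = \<zero>\<^bsub>A\<^esub>"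
        using M l(2) False S_star_Rng[OF l(2)] S_Src_star[OF M(3)] Src_vertex[OF M(3)] Rng_vertex[OF l(2)]
        by (intro orthogonal_at_vertices[of _ "Rng \<Lambda> \<tau>" _ "Src \<Lambda> \<mu>"]) auto
      then show ?thesis unfolding e using l(1) homogeneous_span_zero by simp
    qed
  qed
  finally show ?thesis .
qed

text \<open>The elements that \<open>s\<close> carries into the target span form a submodule, so
  testing the spanning products is enough.\<close>

lemma left_mult_span:
  assumes s: "s \<in> carrier A" and x: "x \<in> homogeneous_span n"
    and gen: "\<And>\<alpha> \<mu>. \<lbrakk>\<alpha> \<in> Mor \<Lambda>; \<mu> \<in> Mor \<Lambda>; int_deg \<Lambda> \<alpha> - int_deg \<Lambda> \<mu> = n\<rbrakk>
      \<Longrightarrow> s \<otimes>\<^bsub>A\<^esub> (S (Path \<alpha>) \<otimes>\<^bsub>A\<^esub> S (star \<Lambda> \<mu>)) \<in> homogeneous_span m"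
  shows "s \<otimes>\<^bsub>A\<^esub> x \<in> homogeneous_span m"
proof -
  note H = submoduleE[OF homogeneous_span_submodule[of m]]
  let ?B = "{x \<in> carrier A. s \<otimes>\<^bsub>A\<^esub> x \<in> homogeneous_span m}"
  have smult: "r \<odot>\<^bsub>A\<^esub> x \<in> ?B" if "r \<in> carrier R" "x \<in> ?B" for r x
    using that s H(4) by (simp add: smult_mult_right)
  have "submodule ?B R A"
  proof (rule submoduleI)
    show "\<ominus>\<^bsub>A\<^esub> x \<in> ?B" if "x \<in> ?B" for x
      using smult[of "\<ominus> \<one>" x] that by (simp add: smult_l_minus)
  qed (use s smult homogeneous_span_zero H(5) in \<open>auto simp: mult_distrib_left\<close>)
  then have "homogeneous_span n \<subseteq> ?B"
    unfolding homogeneous_span_def[of n]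
    by (rule linear_span_minimal) (use gen in \<open>auto simp: mult_closed\<close>)
  then show ?thesis using x by auto
qed

lemma S_Path_span:
  assumes "\<alpha> \<in> Mor \<Lambda>" shows "S (Path \<alpha>) \<in> homogeneous_span (int_deg \<Lambda> \<alpha>)"
  using homogeneous_span_gen[OF assms Src_closed[OF assms] refl] S_Path_Src[OF assms]
    star_vertex[OF Src_vertex[OF assms]] int_deg_vertex[OF Src_vertex[OF assms]] by simp

lemma S_star_span:
  assumes "\<alpha> \<in> Mor \<Lambda>" shows "S (star \<Lambda> \<alpha>) \<in> homogeneous_span (- int_deg \<Lambda> \<alpha>)"
  using homogeneous_span_gen[OF Src_closed[OF assms] assms refl] S_Src_star[OF assms]
    int_deg_vertex[OF Src_vertex[OF assms]] by simp

text \<open>Each symbol added on the left maps one span into another and shifts the degree by its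
  own. A single symbol becomes a spanning product when the vertex at its source is inserted as the
  missing path or ghost.\<close>

lemma list_product_span:
  "\<lbrakk>w \<noteq> []; set w \<subseteq> symbols \<Lambda>\<rbrakk> \<Longrightarrow> list_product A (map S w) \<in> homogeneous_span (word_deg w)"
proof (induction w)
  case (Cons x w)
  have x: "x \<in> symbols \<Lambda>" using Cons.prems by simp
  show ?case
  proof (cases "w = []")
    case True
    from x show ?thesis
      by (cases rule: symbols_cases)
         (simp_all add: True word_deg_def symbol_deg_star S_Path_span S_star_span)
  next
    case False
    then have w: "list_product A (map S w) \<in> homogeneous_span (word_deg w)"
      using Cons by simp
    have "S x \<otimes>\<^bsub>A\<^esub> list_product A (map S w) \<in> homogeneous_span (word_deg (x # w))"
      using x
    proof (cases rule: symbols_cases)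
      case (1 \<alpha>)
      then show ?thesis
        using S_Path[OF 1(1)] by (intro left_mult_span[OF _ w])
          (auto intro!: path_mult_term simp: word_deg_def)
    next
      case (2 \<alpha>)
      then show ?thesis
        using S_star[OF 2(1)] by (intro left_mult_span[OF _ w])
          (auto intro!: ghost_mult_term simp: word_deg_def symbol_deg_star)
    qed
    then show ?thesis using False by (simp add: list_product_Cons)
  qed
qed simp

end


section \<open>Homomorphisms from the free algebra and the relators\<close>

context nonunital_algebra
begin

lemma diff_eq_zero_iff:
  assumes "x \<in> carrier A" "y \<in> carrier A"
  shows "x \<ominus>\<^bsub>A\<^esub> y = \<zero>\<^bsub>A\<^esub> \<longleftrightarrow> x = y"
  using assms M.add.inv_equality M.minus_equality M.r_neg by (metis M.minus_minus M.a_inv_closed a_minus_def)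

end

text \<open>One transfer of (KP1)-(KP4) along \<open>h\<close> serves three instances: the identity,
  which shows that the relators lie in the free algebra; the quotient map; and the lift of a given
  family. In each, \<open>S\<close> is a family if \<open>h\<close> kills the relators, and
  conversely.\<close>

locale symbol_morphism = finitely_aligned_kgraph \<Lambda> + alg_morphism R "free_alg R (symbols \<Lambda>)" A h
  for \<Lambda> :: "('a, 'k::finite) kgraph" and R (structure) and A and h +
  fixes S
  assumes map_gen: "x \<in> symbols \<Lambda> \<Longrightarrow> h (free_gen R x) = S x"
begin

sublocale free_algebra R "symbols \<Lambda>" ..

abbreviation gen where "gen \<equiv> free_gen R"

abbreviation gap where
  "gap v \<equiv> \<lambda>\<alpha>. gen (Path v) \<ominus>\<^bsub>FA\<^esub> gen (Path \<alpha>) \<otimes>\<^bsub>FA\<^esub> gen (star \<Lambda> \<alpha>)"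

lemma gen_Path: "\<alpha> \<in> Mor \<Lambda> \<Longrightarrow> gen (Path \<alpha>) \<in> carrier FA"
  and gen_star: "\<alpha> \<in> Mor \<Lambda> \<Longrightarrow> gen (star \<Lambda> \<alpha>) \<in> carrier FA"
  by (simp_all add: free_gen_closed Path_symbols star_symbols)

lemma map_Path: "\<alpha> \<in> Mor \<Lambda> \<Longrightarrow> h (gen (Path \<alpha>)) = S (Path \<alpha>)"
  and map_star: "\<alpha> \<in> Mor \<Lambda> \<Longrightarrow> h (gen (star \<Lambda> \<alpha>)) = S (star \<Lambda> \<alpha>)"
  by (simp_all add: map_gen Path_symbols star_symbols)

lemma gen_image_closed: "x \<in> symbols \<Lambda> \<Longrightarrow> S x \<in> carrier A"
  using map_closed[OF free_gen_closed] map_gen by metis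

lemma gen_image_Path: "\<alpha> \<in> Mor \<Lambda> \<Longrightarrow> S (Path \<alpha>) \<in> carrier A"
  and gen_image_star: "\<alpha> \<in> Mor \<Lambda> \<Longrightarrow> S (star \<Lambda> \<alpha>) \<in> carrier A"
  by (simp_all add: gen_image_closed Path_symbols star_symbols)

lemmas closed_simps = gen_Path gen_star map_Path map_star gen_image_Path gen_image_star A.mult_closed B.mult_closed
  map_minus map_mult map_add

lemma KP3_sum_closed:
  assumes "\<alpha> \<in> Mor \<Lambda>" "\<mu> \<in> Mor \<Lambda>"
  shows "(\<lambda>(\<rho>, \<tau>). gen (Path \<rho>) \<otimes>\<^bsub>FA\<^esub> gen (star \<Lambda> \<tau>)) \<in> Lmin \<Lambda> \<alpha> \<mu> \<rightarrow> carrier FA"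
  using assms by (auto simp: Lmin_iff closed_simps)

lemma KP3_sum:
  assumes "\<alpha> \<in> Mor \<Lambda>" "\<mu> \<in> Mor \<Lambda>"
  shows "h (finsum FA (\<lambda>(\<rho>, \<tau>). gen (Path \<rho>) \<otimes>\<^bsub>FA\<^esub> gen (star \<Lambda> \<tau>)) (Lmin \<Lambda> \<alpha> \<mu>)) =
    finsum A (\<lambda>(\<rho>, \<tau>). S (Path \<rho>) \<otimes>\<^bsub>A\<^esub> S (star \<Lambda> \<tau>)) (Lmin \<Lambda> \<alpha> \<mu>)"
proof -
  have "h (finsum FA (\<lambda>(\<rho>, \<tau>). gen (Path \<rho>) \<otimes>\<^bsub>FA\<^esub> gen (star \<Lambda> \<tau>)) (Lmin \<Lambda> \<alpha> \<mu>)) =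
    finsum A (\<lambda>p. h (case p of (\<rho>, \<tau>) \<Rightarrow> gen (Path \<rho>) \<otimes>\<^bsub>FA\<^esub> gen (star \<Lambda> \<tau>))) (Lmin \<Lambda> \<alpha> \<mu>)"
    by (rule map_finsum[OF KP3_sum_closed[OF assms]])
  also have "\<dots> = finsum A (\<lambda>(\<rho>, \<tau>). S (Path \<rho>) \<otimes>\<^bsub>A\<^esub> S (star \<Lambda> \<tau>)) (Lmin \<Lambda> \<alpha> \<mu>)"
    by (rule B.finsum_cong') (use assms in \<open>auto simp: Lmin_iff closed_simps\<close>)
  finally show ?thesis .
qed

lemma KP3_sum_image_closed:
  assumes "\<alpha> \<in> Mor \<Lambda>" "\<mu> \<in> Mor \<Lambda>"
  shows "finsum A (\<lambda>(\<rho>, \<tau>). S (Path \<rho>) \<otimes>\<^bsub>A\<^esub> S (star \<Lambda> \<tau>)) (Lmin \<Lambda> \<alpha> \<mu>) \<in> carrier A"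
  by (rule B.finsum_closed) (use assms in \<open>auto simp: Lmin_iff closed_simps\<close>)

lemma gap_closed: "\<lbrakk>v \<in> vertices \<Lambda>; \<alpha> \<in> Mor \<Lambda>\<rbrakk> \<Longrightarrow> gap v \<alpha> \<in> carrier FA"
  using vertex_simps(1)[of v] by (simp add: closed_simps)

lemma map_gap:
  assumes "v \<in> vertices \<Lambda>" "set \<alpha>s \<in> FE \<Lambda> v"
  shows "h (list_product FA (map (gap v) \<alpha>s)) =
    list_product A (map (\<lambda>\<alpha>. S (Path v) \<ominus>\<^bsub>A\<^esub> S (Path \<alpha>) \<otimes>\<^bsub>A\<^esub> S (star \<Lambda> \<alpha>)) \<alpha>s)"
    and "list_product FA (map (gap v) \<alpha>s) \<in> carrier FA"
proof -
  \<comment> \<open>Homomorphisms commute with \<open>list_product\<close> only on nonempty lists,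
    so the nonemptiness of exhaustive sets matters here.\<close>
  note ne = FE_nonempty[OF assms]
  have v: "v \<in> Mor \<Lambda>" using assms vertex_simps by auto
  have c: "map (gap v) \<alpha>s \<noteq> []" "set (map (gap v) \<alpha>s) \<subseteq> carrier FA"
    using ne gap_closed[OF assms(1)] by auto
  show "list_product FA (map (gap v) \<alpha>s) \<in> carrier FA"
    using c by (rule A.list_product_closed)
  have e: "map h (map (gap v) \<alpha>s) = map (\<lambda>\<alpha>. S (Path v) \<ominus>\<^bsub>A\<^esub> S (Path \<alpha>) \<otimes>\<^bsub>A\<^esub> S (star \<Lambda> \<alpha>)) \<alpha>s"
    using ne v by (auto simp: closed_simps subset_iff)
  show "h (list_product FA (map (gap v) \<alpha>s)) =
    list_product A (map (\<lambda>\<alpha>. S (Path v) \<ominus>\<^bsub>A\<^esub> S (Path \<alpha>) \<otimes>\<^bsub>A\<^esub> S (star \<Lambda> \<alpha>)) \<alpha>s)"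
    unfolding map_list_product[OF c] e ..
qed

lemma relators_closed: "kp_relators \<Lambda> FA gen \<subseteq> carrier FA"
proof
  fix \<rho> assume "\<rho> \<in> kp_relators \<Lambda> FA gen"
  then show "\<rho> \<in> carrier FA"
  proof (cases rule: kp_relators.cases)
    case (KP1 v w)
    then show ?thesis using vertex_simps(1) by (simp add: closed_simps)
  next
    case (KP3 \<alpha> \<mu>)
    then show ?thesis using A.finsum_closed[OF KP3_sum_closed[of \<alpha> \<mu>]] by (simp add: closed_simps)
  next
    case (KP4 v E \<alpha>s)
    then show ?thesis using map_gap(2)[of v \<alpha>s] by simp
  qed (simp_all add: closed_simps Comp_closed)
qed

lemma kills_relators:
  assumes "kumjian_pask_family \<Lambda> R A S"
  shows "kp_relators \<Lambda> FA gen \<subseteq> {x \<in> carrier FA. h x = \<zero>\<^bsub>A\<^esub>}"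
proof
  interpret K: kumjian_pask_family \<Lambda> R A S by fact
  fix \<rho> assume \<rho>: "\<rho> \<in> kp_relators \<Lambda> FA gen"
  then have "h \<rho> = \<zero>\<^bsub>A\<^esub>"
  proof (cases rule: kp_relators.cases)
    case (KP1 v w)
    then show ?thesis using vertex_simps(1) K.KP1[of v w]
      by (simp add: closed_simps B.diff_eq_zero_iff)
  next
    case (KP2_path \<alpha> \<mu>)
    then show ?thesis using K.KP2_path[of \<alpha> \<mu>]
      by (simp add: closed_simps Comp_closed B.diff_eq_zero_iff)
  next
    case (KP2_ghost \<alpha> \<mu>)
    then show ?thesis using K.KP2_ghost[of \<alpha> \<mu>]
      by (simp add: closed_simps Comp_closed B.diff_eq_zero_iff)
  next
    case (KP3 \<alpha> \<mu>)
    then show ?thesis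
      using K.KP3[of \<alpha> \<mu>] A.finsum_closed[OF KP3_sum_closed[of \<alpha> \<mu>]] KP3_sum[of \<alpha> \<mu>] KP3_sum_image_closed[of \<alpha> \<mu>]
      by (simp add: closed_simps B.diff_eq_zero_iff)
  next
    case (KP4 v E \<alpha>s)
    then show ?thesis using map_gap[of v \<alpha>s] K.KP4[of v E \<alpha>s] by simp
  qed
  then show "\<rho> \<in> {x \<in> carrier FA. h x = \<zero>\<^bsub>A\<^esub>}" using relators_closed \<rho> by auto
qed

lemma family_if_kills_relators:
  assumes kill: "\<And>\<rho>. \<rho> \<in> kp_relators \<Lambda> FA gen \<Longrightarrow> h \<rho> = \<zero>\<^bsub>A\<^esub>"
  shows "kumjian_pask_family \<Lambda> R A S"
proof (unfold_locales)
  show "S \<in> symbols \<Lambda> \<rightarrow> carrier A" using gen_image_closed by auto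
next
  fix v w assume vw: "v \<in> vertices \<Lambda>" "w \<in> vertices \<Lambda>"
  then show "S (Path v) \<otimes>\<^bsub>A\<^esub> S (Path w) = (if v = w then S (Path v) else \<zero>\<^bsub>A\<^esub>)"
    using kill[OF kp_relators.KP1[OF vw]] vertex_simps(1)
    by (cases "v = w") (simp_all add: closed_simps B.diff_eq_zero_iff)
next
  fix \<alpha> \<mu> assume c: "\<alpha> \<in> Mor \<Lambda>" "\<mu> \<in> Mor \<Lambda>" "Src \<Lambda> \<alpha> = Rng \<Lambda> \<mu>"
  show "S (Path \<alpha>) \<otimes>\<^bsub>A\<^esub> S (Path \<mu>) = S (Path (Comp \<Lambda> \<alpha> \<mu>))"
    using kill[OF kp_relators.KP2_path[OF c]] c(1,2) Comp_closed[OF c]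
    by (simp add: closed_simps B.diff_eq_zero_iff)
  show "S (star \<Lambda> \<mu>) \<otimes>\<^bsub>A\<^esub> S (star \<Lambda> \<alpha>) = S (star \<Lambda> (Comp \<Lambda> \<alpha> \<mu>))"
    using kill[OF kp_relators.KP2_ghost[OF c]] c(1,2) Comp_closed[OF c]
    by (simp add: closed_simps B.diff_eq_zero_iff)
next
  fix \<alpha> \<mu> assume c: "\<alpha> \<in> Mor \<Lambda>" "\<mu> \<in> Mor \<Lambda>"
  show "S (star \<Lambda> \<alpha>) \<otimes>\<^bsub>A\<^esub> S (Path \<mu>) = finsum A (\<lambda>(\<rho>, \<tau>). S (Path \<rho>) \<otimes>\<^bsub>A\<^esub> S (star \<Lambda> \<tau>)) (Lmin \<Lambda> \<alpha> \<mu>)"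
    using kill[OF kp_relators.KP3[OF c]] c A.finsum_closed[OF KP3_sum_closed[OF c]] KP3_sum[OF c] KP3_sum_image_closed[OF c]
    by (simp add: closed_simps B.diff_eq_zero_iff)
next
  fix v E \<alpha>s assume "v \<in> vertices \<Lambda>" "E \<in> FE \<Lambda> v" "distinct \<alpha>s" "set \<alpha>s = E"
  then show "list_product A (map (\<lambda>\<alpha>. S (Path v) \<ominus>\<^bsub>A\<^esub> S (Path \<alpha>) \<otimes>\<^bsub>A\<^esub> S (star \<Lambda> \<alpha>)) \<alpha>s) = \<zero>\<^bsub>A\<^esub>"
    using kill[OF kp_relators.KP4[of v _ E \<alpha>s]] map_gap(1)[of v \<alpha>s] by simp
qed

end


section \<open>The Kumjian-Pask algebra\<close>

context free_algebra
begin

lemma free_finsum_coeff: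
  "F \<in> I \<rightarrow> carrier FA \<Longrightarrow> finsum FA F I w = finsum R (\<lambda>i. F i w) I"
  by (induction I rule: infinite_finite_induct) (simp_all add: free_zero free_add Pi_iff)

end

locale kumjian_pask_algebra = finitely_aligned_kgraph \<Lambda> + cring R
  for \<Lambda> :: "('a, 'k::finite) kgraph" and R :: "('r, 'm) ring_scheme" (structure)
begin

sublocale free_algebra R "symbols \<Lambda>" ..

abbreviation J where "J \<equiv> KP_ideal R \<Lambda>"
abbreviation K where "K \<equiv> KP R \<Lambda>"

section \<open>The quotient by the relators and its universal property\<close>

definition quot :: "('a symbol list \<Rightarrow> 'r) \<Rightarrow> ('a symbol list \<Rightarrow> 'r) set" where
  "quot f = J +>\<^bsub>FA\<^esub> f"

lemma relators_carrier: "kp_relators \<Lambda> FA (free_gen R) \<subseteq> carrier FA"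
proof -
  interpret symbol_morphism \<Lambda> R FA "\<lambda>x. x" "free_gen R"
    by unfold_locales (auto simp: alg_hom_def hom_def)
  show ?thesis by (rule relators_closed)
qed

lemma J_alg_ideal: "alg_ideal R FA J"
  unfolding KP_ideal_def by (rule F.alg_ideal_generated_alg_ideal[OF relators_carrier])

lemma relators_J: "kp_relators \<Lambda> FA (free_gen R) \<subseteq> J"
  unfolding KP_ideal_def by (rule F.alg_ideal_generated_incl)

lemma J_minimal:
  assumes "alg_ideal R FA I" "kp_relators \<Lambda> FA (free_gen R) \<subseteq> I"
  shows "J \<subseteq> I"
  unfolding KP_ideal_def by (rule F.alg_ideal_generated_minimal[OF assms])

lemma K_algebra: "nonunital_algebra R K"
  and quot_hom: "quot \<in> alg_hom R FA K"
  and K_carrier: "carrier K = quot ` carrier FA"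
  and quot_zero_iff: "x \<in> carrier FA \<Longrightarrow> quot x = \<zero>\<^bsub>K\<^esub> \<longleftrightarrow> x \<in> J"
  unfolding KP_def quot_def[abs_def] using F.quotient_alg_ideal[OF J_alg_ideal] by auto

sublocale Q: symbol_morphism \<Lambda> R K quot "KP_gen R \<Lambda>"
proof (intro symbol_morphism.intro alg_morphism.intro alg_morphism_axioms.intro symbol_morphism_axioms.intro)
  show "quot (free_gen R x) = KP_gen R \<Lambda> x" for x
    by (simp add: quot_def KP_gen_def)
qed (use K_algebra quot_hom F.nonunital_algebra_axioms in \<open>auto intro: finitely_aligned_kgraph_axioms\<close>)

lemma quot_eq_iff:
  assumes "f \<in> carrier FA" "g \<in> carrier FA"
  shows "quot f = quot g \<longleftrightarrow> f \<ominus>\<^bsub>FA\<^esub> g \<in> J"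
  using assms quot_zero_iff[of "f \<ominus>\<^bsub>FA\<^esub> g"] Q.B.diff_eq_zero_iff[of "quot f" "quot g"] by (simp add: Q.map_minus)

lemma KP_family: "kumjian_pask_family \<Lambda> R K (KP_gen R \<Lambda>)"
proof (rule Q.family_if_kills_relators)
  fix \<rho> assume "\<rho> \<in> kp_relators \<Lambda> FA (free_gen R)"
  then show "quot \<rho> = \<zero>\<^bsub>K\<^esub>" using relators_J relators_carrier quot_zero_iff by blast
qed

lemma KP_generated:
  assumes B: "subalg R K B" and gen: "KP_gen R \<Lambda> ` symbols \<Lambda> \<subseteq> B"
  shows "carrier K \<subseteq> B"
proof -
  have "submodule {f \<in> carrier FA. quot f \<in> B} R FA"
    using B by (intro Q.vimage_submodule) (simp add: subalg_def)
  then have "subalg R FA {f \<in> carrier FA. quot f \<in> B}"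
    using B by (simp add: subalg_def F.mult_closed Q.map_mult)
  moreover have "free_gen R ` symbols \<Lambda> \<subseteq> {f \<in> carrier FA. quot f \<in> B}"
    using gen Q.map_gen free_gen_closed by auto
  ultimately have "carrier FA \<subseteq> {f \<in> carrier FA. quot f \<in> B}" by (rule free_generated)
  then show ?thesis by (auto simp: K_carrier)
qed

lemma KP_subalg_generated: "subalg_generated R K (KP_gen R \<Lambda> ` symbols \<Lambda>) = carrier K"
proof
  have "subalg R K (carrier K)" by (rule Q.B.subalg_carrier)
  then show "subalg_generated R K (KP_gen R \<Lambda> ` symbols \<Lambda>) \<subseteq> carrier K"
    using Q.gen_image_closed by (auto simp: subalg_generated_def)
  show "carrier K \<subseteq> subalg_generated R K (KP_gen R \<Lambda> ` symbols \<Lambda>)"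
    using KP_generated by (auto simp: subalg_generated_def)
qed

lemma KP_hom_exists:
  assumes fam: "kumjian_pask_family \<Lambda> R A S"
  shows "\<exists>\<pi>\<in>alg_hom R K A. \<pi> \<in> extensional (carrier K) \<and> (\<forall>x\<in>symbols \<Lambda>. \<pi> (KP_gen R \<Lambda> x) = S x)"
proof -
  interpret A: kumjian_pask_family \<Lambda> R A S by fact
  interpret L: free_algebra_lift R A "symbols \<Lambda>" S
    by unfold_locales (rule A.S_closed)
  interpret L: symbol_morphism \<Lambda> R A L.lift S
    by unfold_locales (use L.lift_alg_hom L.lift_gen in auto)
  have "J \<subseteq> {f \<in> carrier FA. L.lift f = \<zero>\<^bsub>A\<^esub>}"
    using L.kills_relators[OF fam] by (intro J_minimal L.kernel_alg_ideal)
  then have wd: "L.lift f = L.lift g" if "f \<in> carrier FA" "g \<in> carrier FA" "quot f = quot g" for f g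
    using that quot_eq_iff[of f g] A.diff_eq_zero_iff[of "L.lift f" "L.lift g"] by (auto simp: L.map_minus)
  \<comment> \<open>The value at a coset is the lift of a chosen representative, and
    \<open>wd\<close> makes the choice immaterial. Restricting to the carrier fixes the values
    elsewhere, so that uniqueness holds for \<pi> as a total function.\<close>
  define \<pi> where "\<pi> = restrict (\<lambda>X. L.lift (inv_into (carrier FA) quot X)) (carrier K)"
  have \<pi>: "\<pi> (quot f) = L.lift f" if f: "f \<in> carrier FA" for f
  proof -
    have "quot f \<in> quot ` carrier FA" using f by simp
    then have "L.lift (inv_into (carrier FA) quot (quot f)) = L.lift f"
      using f by (intro wd inv_into_into f_inv_into_f[of _ quot "carrier FA"])
    then show ?thesis using f by (simp add: \<pi>_def)
  qed
  have mult_add: "\<pi> (X \<otimes>\<^bsub>K\<^esub> Y) = \<pi> X \<otimes>\<^bsub>A\<^esub> \<pi> Y" "\<pi> (X \<oplus>\<^bsub>K\<^esub> Y) = \<pi> X \<oplus>\<^bsub>A\<^esub> \<pi> Y"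
    if XY: "X \<in> carrier K" "Y \<in> carrier K" for X Y
  proof -
    obtain f g where f: "f \<in> carrier FA" "X = quot f" and g: "g \<in> carrier FA" "Y = quot g"
      using XY by (auto simp: K_carrier)
    show "\<pi> (X \<otimes>\<^bsub>K\<^esub> Y) = \<pi> X \<otimes>\<^bsub>A\<^esub> \<pi> Y"
      using f g \<pi>[OF F.mult_closed[OF f(1) g(1)]] by (simp add: \<pi> Q.map_mult L.map_mult)
    show "\<pi> (X \<oplus>\<^bsub>K\<^esub> Y) = \<pi> X \<oplus>\<^bsub>A\<^esub> \<pi> Y"
      using f g \<pi>[OF F.M.a_closed[OF f(1) g(1)]] by (simp add: \<pi> Q.map_add L.map_add)
  qed
  have smult: "\<pi> (r \<odot>\<^bsub>K\<^esub> X) = r \<odot>\<^bsub>A\<^esub> \<pi> X" if r: "r \<in> carrier R" and X: "X \<in> carrier K" for r X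
  proof -
    obtain f where f: "f \<in> carrier FA" "X = quot f" using X by (auto simp: K_carrier)
    then show ?thesis
      using r \<pi>[OF F.smult_closed[OF r f(1)]] by (simp add: \<pi> Q.map_smult L.map_smult)
  qed
  have closed: "\<pi> X \<in> carrier A" if "X \<in> carrier K" for X
    using that by (auto simp: K_carrier \<pi>)
  have "\<pi> \<in> alg_hom R K A"
    by (simp add: alg_hom_def hom_def mult_add smult closed)
  moreover have "\<pi> (KP_gen R \<Lambda> x) = S x" if "x \<in> symbols \<Lambda>" for x
    using \<pi>[OF free_gen_closed[OF that]] L.map_gen[OF that] Q.map_gen[OF that] by simp
  moreover have "\<pi> \<in> extensional (carrier K)" by (simp add: \<pi>_def)
  ultimately show ?thesis by blast
qed

text \<open>The elements on which two homomorphisms agree form a subalgebra, and this one contains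
  the generators.\<close>

lemma KP_hom_unique:
  assumes A: "nonunital_algebra R A" and \<pi>: "\<pi> \<in> alg_hom R K A" and \<pi>': "\<pi>' \<in> alg_hom R K A"
    and eq: "\<And>x. x \<in> symbols \<Lambda> \<Longrightarrow> \<pi> (KP_gen R \<Lambda> x) = \<pi>' (KP_gen R \<Lambda> x)" and X: "X \<in> carrier K"
  shows "\<pi> X = \<pi>' X"
proof -
  interpret A: nonunital_algebra R A by fact
  interpret P: alg_morphism R K A \<pi>
    using A \<pi> K_algebra by (intro alg_morphism.intro alg_morphism_axioms.intro)
  interpret P': alg_morphism R K A \<pi>'
    using A \<pi>' K_algebra by (intro alg_morphism.intro alg_morphism_axioms.intro)
  let ?B = "{X \<in> carrier K. \<pi> X = \<pi>' X}"
  have "submodule ?B R K"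
    by (rule Q.B.submoduleI)
       (auto simp: P.map_neg P'.map_neg P.map_add P'.map_add P.map_smult P'.map_smult)
  then have "subalg R K ?B"
    by (auto simp: subalg_def P.map_mult P'.map_mult Q.B.mult_closed)
  moreover have "KP_gen R \<Lambda> ` symbols \<Lambda> \<subseteq> ?B" using eq Q.gen_image_closed by auto
  ultimately show ?thesis using KP_generated X by blast
qed

lemma KP_universal:
  assumes fam: "kumjian_pask_family \<Lambda> R A S"
  shows "\<exists>!\<pi>. \<pi> \<in> alg_hom R K A \<and> \<pi> \<in> extensional (carrier K) \<and>
    (\<forall>\<alpha>\<in>Mor \<Lambda>. \<pi> (KP_gen R \<Lambda> (Path \<alpha>)) = S (Path \<alpha>)) \<and>
    (\<forall>\<mu>\<in>Mor \<Lambda>. \<pi> (KP_gen R \<Lambda> (star \<Lambda> \<mu>)) = S (star \<Lambda> \<mu>))"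
    (is "\<exists>!\<pi>. ?P \<pi>")
proof -
  obtain \<pi> where \<pi>: "\<pi> \<in> alg_hom R K A" "\<pi> \<in> extensional (carrier K)"
    "\<And>x. x \<in> symbols \<Lambda> \<Longrightarrow> \<pi> (KP_gen R \<Lambda> x) = S x"
    using KP_hom_exists[OF fam] by blast
  have P: "?P \<pi>" using \<pi> Path_symbols star_symbols by blast
  have uniq: "\<pi>' = \<pi>" if P': "?P \<pi>'" for \<pi>'
  proof (rule extensionalityI)
    show "\<pi>' \<in> extensional (carrier K)" "\<pi> \<in> extensional (carrier K)" using P' \<pi> by auto
    fix X assume X: "X \<in> carrier K"
    show "\<pi>' X = \<pi> X"
    proof (rule KP_hom_unique[OF _ _ \<pi>(1) _ X])
      show "nonunital_algebra R A" using fam by (simp add: kumjian_pask_family_def)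
      show "\<pi>' \<in> alg_hom R K A" using P' by blast
      fix x assume x: "x \<in> symbols \<Lambda>"
      then have "\<pi>' (KP_gen R \<Lambda> x) = S x"
        using P' by (cases rule: symbols_cases) auto
      then show "\<pi>' (KP_gen R \<Lambda> x) = \<pi> (KP_gen R \<Lambda> x)" using \<pi>(3)[OF x] by simp
    qed
  qed
  show ?thesis using P uniq by (rule ex1I)
qed

text \<open>The homomorphism onto the operators of the boundary representation would carry a
  vanishing multiple of a vertex to zero, but a boundary set through that vertex detects the
  scalar.\<close>

lemma KP_vertex_nonzero:
  assumes r: "r \<in> carrier R" "r \<noteq> \<zero>" and v: "v \<in> vertices \<Lambda>"
  shows "r \<odot>\<^bsub>K\<^esub> KP_gen R \<Lambda> (Path v) \<noteq> \<zero>\<^bsub>K\<^esub>"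
proof
  interpret boundary_representation \<Lambda> R ..
  assume z: "r \<odot>\<^bsub>K\<^esub> KP_gen R \<Lambda> (Path v) = \<zero>\<^bsub>K\<^esub>"
  obtain \<pi> where \<pi>: "\<pi> \<in> alg_hom R K OA" "\<And>x. x \<in> symbols \<Lambda> \<Longrightarrow> \<pi> (KP_gen R \<Lambda> x) = boundary_rep x"
    using KP_hom_exists[OF boundary_family] by blast
  interpret P: alg_morphism R K OA \<pi>
    using operator_nonunital_algebra \<pi>(1) K_algebra by (intro alg_morphism.intro alg_morphism_axioms.intro)
  have s: "Path v \<in> symbols \<Lambda>" using vertex_simps(1)[OF v] Path_symbols by blast
  have "r \<odot>\<^bsub>OA\<^esub> boundary_rep (Path v) = \<pi> (r \<odot>\<^bsub>K\<^esub> KP_gen R \<Lambda> (Path v))"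
    using P.map_smult[OF r(1) Q.gen_image_closed[OF s]] \<pi>(2)[OF s] by simp
  then show False using z boundary_rep_vertex[OF r v] by simp
qed

section \<open>The grading by the degree of words\<close>

definition homogeneous :: "int ^ 'k \<Rightarrow> ('a symbol list \<Rightarrow> 'r) set" where
  "homogeneous n = {f \<in> carrier FA. \<forall>w. f w \<noteq> \<zero> \<longrightarrow> word_deg w = n}"

definition part :: "int ^ 'k \<Rightarrow> ('a symbol list \<Rightarrow> 'r) \<Rightarrow> 'a symbol list \<Rightarrow> 'r" where
  "part n f = (\<lambda>w. if word_deg w = n then f w else \<zero>)"

lemma word_deg_append: "word_deg (u @ v) = word_deg u + word_deg v"
  by (simp add: word_deg_def)

lemma part_closed: "f \<in> carrier FA \<Longrightarrow> part n f \<in> carrier FA"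
proof -
  assume f: "f \<in> carrier FA"
  have "finite {w. part n f w \<noteq> \<zero>}"
    by (rule finite_subset[of _ "{w. f w \<noteq> \<zero>}"]) (use f in \<open>auto simp: part_def free_carrier_iff\<close>)
  then show ?thesis using f by (auto simp: free_carrier_iff part_def)
qed

lemma part_homogeneous: "f \<in> carrier FA \<Longrightarrow> part n f \<in> homogeneous n"
  by (simp add: homogeneous_def part_closed) (simp add: part_def)

lemma part_of_homogeneous:
  assumes "f \<in> homogeneous n"
  shows "part m f = (if m = n then f else \<zero>\<^bsub>FA\<^esub>)"
proof
  fix w show "part m f w = (if m = n then f else \<zero>\<^bsub>FA\<^esub>) w"
    using assms by (cases "f w = \<zero>") (auto simp: homogeneous_def part_def free_zero)
qed

lemma part_add: "part n (f \<oplus>\<^bsub>FA\<^esub> g) = part n f \<oplus>\<^bsub>FA\<^esub> part n g"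
  by (auto simp: part_def free_add)

lemma part_smult: "r \<in> carrier R \<Longrightarrow> part n (r \<odot>\<^bsub>FA\<^esub> f) = r \<odot>\<^bsub>FA\<^esub> part n f"
  by (auto simp: part_def free_smult)

lemma part_zero: "part n \<zero>\<^bsub>FA\<^esub> = \<zero>\<^bsub>FA\<^esub>"
  by (auto simp: part_def free_zero)

lemma part_word: "part n (word_elem R w) = (if word_deg w = n then word_elem R w else \<zero>\<^bsub>FA\<^esub>)"
  by (auto simp: part_def word_elem_def free_zero fun_eq_iff)

lemma part_minus:
  assumes "f \<in> carrier FA" "g \<in> carrier FA"
  shows "part n (f \<ominus>\<^bsub>FA\<^esub> g) = part n f \<ominus>\<^bsub>FA\<^esub> part n g"
proof -
  have e: "\<ominus>\<^bsub>FA\<^esub> h = (\<ominus> \<one>) \<odot>\<^bsub>FA\<^esub> h" if "h \<in> carrier FA" for h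
    using that by (simp add: F.smult_l_minus)
  show ?thesis using assms by (simp add: a_minus_def part_add part_smult e part_closed)
qed

lemma homogeneous_submodule: "submodule (homogeneous n) R FA"
proof (rule F.submoduleI)
  show "f \<oplus>\<^bsub>FA\<^esub> g \<in> homogeneous n" if "f \<in> homogeneous n" "g \<in> homogeneous n" for f g
  proof -
    have "word_deg w = n" if "f w \<oplus> g w \<noteq> \<zero>" for w
      using that \<open>f \<in> homogeneous n\<close> \<open>g \<in> homogeneous n\<close>
      by (cases "f w = \<zero>"; cases "g w = \<zero>") (auto simp: homogeneous_def)
    then show ?thesis
      using that by (simp add: homogeneous_def) (simp add: free_add)
  qed
  show smult: "r \<odot>\<^bsub>FA\<^esub> f \<in> homogeneous n" if "r \<in> carrier R" "f \<in> homogeneous n" for r f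
  proof -
    have "word_deg w = n" if "r \<otimes> f w \<noteq> \<zero>" for w
      using that \<open>r \<in> carrier R\<close> \<open>f \<in> homogeneous n\<close>
      by (cases "f w = \<zero>") (auto simp: homogeneous_def)
    then show ?thesis
      using that by (simp add: homogeneous_def) (simp add: free_smult)
  qed
  show "\<ominus>\<^bsub>FA\<^esub> f \<in> homogeneous n" if "f \<in> homogeneous n" for f
    using smult[of "\<ominus> \<one>" f] that by (simp add: F.smult_l_minus homogeneous_def)
qed (auto simp: homogeneous_def free_zero free_zero_closed)

lemma homogeneous_mult:
  assumes f: "f \<in> homogeneous m" and g: "g \<in> homogeneous n"
  shows "f \<otimes>\<^bsub>FA\<^esub> g \<in> homogeneous (m + n)"
proof -
  have c: "f \<in> carrier FA" "g \<in> carrier FA" using f g by (auto simp: homogeneous_def)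
  have "word_deg w = m + n" if "(f \<otimes>\<^bsub>FA\<^esub> g) w \<noteq> \<zero>" for w
    using free_mult_nonzero[OF c that] f g by (auto simp: homogeneous_def word_deg_append)
  then show ?thesis using c by (simp add: homogeneous_def F.mult_closed)
qed

lemma homogeneous_gen: "x \<in> symbols \<Lambda> \<Longrightarrow> free_gen R x \<in> homogeneous (symbol_deg x)"
  by (auto simp: homogeneous_def free_gen_closed) (auto simp: free_gen_def word_deg_def split: if_splits)

lemma homogeneous_Path: "\<alpha> \<in> Mor \<Lambda> \<Longrightarrow> free_gen R (Path \<alpha>) \<in> homogeneous (int_deg \<Lambda> \<alpha>)"
  and homogeneous_star: "\<alpha> \<in> Mor \<Lambda> \<Longrightarrow> free_gen R (star \<Lambda> \<alpha>) \<in> homogeneous (- int_deg \<Lambda> \<alpha>)"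
  using homogeneous_gen[OF Path_symbols] homogeneous_gen[OF star_symbols] symbol_deg_star by auto

lemma homogeneous_path_star:
  assumes "\<alpha> \<in> Mor \<Lambda>" "\<mu> \<in> Mor \<Lambda>"
  shows "free_gen R (Path \<alpha>) \<otimes>\<^bsub>FA\<^esub> free_gen R (star \<Lambda> \<mu>) \<in> homogeneous (int_deg \<Lambda> \<alpha> - int_deg \<Lambda> \<mu>)"
  using homogeneous_mult[OF homogeneous_Path[OF assms(1)] homogeneous_star[OF assms(2)]] by simp

lemma homogeneous_list_product:
  "\<lbrakk>fs \<noteq> []; set fs \<subseteq> homogeneous 0\<rbrakk> \<Longrightarrow> list_product FA fs \<in> homogeneous 0"
proof (induction fs)
  case (Cons f fs)
  then show ?case
    using homogeneous_mult[of f 0 "list_product FA fs" 0] by (cases "fs = []") (auto simp: F.list_product_Cons)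
qed simp

text \<open>The content is in (KP3): for \<alpha>\<nu> = \<mu>\<tau> the degrees of \<nu> and \<tau>
  differ as those of \<mu> and \<alpha> do, so every summand has the degree of the product it
  replaces. In (KP1) and (KP4) everything has degree zero.\<close>

lemma relator_homogeneous:
  assumes "\<rho> \<in> kp_relators \<Lambda> FA (free_gen R)"
  shows "\<exists>n. \<rho> \<in> homogeneous n"
  using assms
proof (cases rule: kp_relators.cases)
  note diff = F.submodule_diff[OF homogeneous_submodule]
  {
    case (KP1 v w)
    have vw: "free_gen R (Path v) \<in> homogeneous 0" "free_gen R (Path w) \<in> homogeneous 0"
      using homogeneous_Path[of v] homogeneous_Path[of w] KP1 vertex_simps(1) int_deg_vertex by auto
    have "\<rho> \<in> homogeneous 0"
      unfolding KP1(1) using homogeneous_mult[OF vw] vw F.submodule_zero[OF homogeneous_submodule]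
      by (intro diff) auto
    then show ?thesis ..
  next
    case (KP2_path \<alpha> \<mu>)
    have "\<rho> \<in> homogeneous (int_deg \<Lambda> \<alpha> + int_deg \<Lambda> \<mu>)"
      unfolding KP2_path(1)
      using homogeneous_mult[OF homogeneous_Path[OF KP2_path(2)] homogeneous_Path[OF KP2_path(3)]]
        homogeneous_Path[OF Comp_closed[OF KP2_path(2-4)]] int_deg_Comp[OF KP2_path(2-4)]
      by (intro diff) auto
    then show ?thesis ..
  next
    case (KP2_ghost \<alpha> \<mu>)
    have "- int_deg \<Lambda> \<mu> + - int_deg \<Lambda> \<alpha> = - int_deg \<Lambda> (Comp \<Lambda> \<alpha> \<mu>)"
      using int_deg_Comp[OF KP2_ghost(2-4)] by simp
    then have "\<rho> \<in> homogeneous (- int_deg \<Lambda> \<mu> + - int_deg \<Lambda> \<alpha>)"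
      unfolding KP2_ghost(1)
      using homogeneous_mult[OF homogeneous_star[OF KP2_ghost(3)] homogeneous_star[OF KP2_ghost(2)]]
        homogeneous_star[OF Comp_closed[OF KP2_ghost(2-4)]]
      by (intro diff) auto
    then show ?thesis ..
  next
    case (KP3 \<alpha> \<mu>)
    have "(\<lambda>(\<nu>, \<tau>). free_gen R (Path \<nu>) \<otimes>\<^bsub>FA\<^esub> free_gen R (star \<Lambda> \<tau>)) p
        \<in> homogeneous (- int_deg \<Lambda> \<alpha> + int_deg \<Lambda> \<mu>)" if p: "p \<in> Lmin \<Lambda> \<alpha> \<mu>" for p
    proof -
      obtain \<nu> \<tau> where p': "p = (\<nu>, \<tau>)" by (cases p)
      have l: "\<nu> \<in> Mor \<Lambda>" "\<tau> \<in> Mor \<Lambda>" "Src \<Lambda> \<alpha> = Rng \<Lambda> \<nu>" "Src \<Lambda> \<mu> = Rng \<Lambda> \<tau>" "Comp \<Lambda> \<alpha> \<nu> = Comp \<Lambda> \<mu> \<tau>"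
        using p by (simp_all add: p' Lmin_iff[OF KP3(2,3)])
      have "int_deg \<Lambda> \<alpha> + int_deg \<Lambda> \<nu> = int_deg \<Lambda> \<mu> + int_deg \<Lambda> \<tau>"
        using int_deg_Comp[OF KP3(2) l(1,3)] int_deg_Comp[OF KP3(3) l(2,4)] l(5) by simp
      then have "int_deg \<Lambda> \<nu> - int_deg \<Lambda> \<tau> = - int_deg \<Lambda> \<alpha> + int_deg \<Lambda> \<mu>"
        by (simp add: algebra_simps)
      then show ?thesis using homogeneous_path_star[OF l(1,2)] by (simp add: p')
    qed
    then have "\<rho> \<in> homogeneous (- int_deg \<Lambda> \<alpha> + int_deg \<Lambda> \<mu>)"
      unfolding KP3(1)
      using homogeneous_mult[OF homogeneous_star[OF KP3(2)] homogeneous_Path[OF KP3(3)]]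
      by (intro diff F.submodule_finsum[OF homogeneous_submodule]) auto
    then show ?thesis ..
  next
    case (KP4 v E \<alpha>s)
    have "free_gen R (Path v) \<in> homogeneous 0"
      using homogeneous_Path[of v] KP4 vertex_simps(1) int_deg_vertex by auto
    moreover have "free_gen R (Path \<alpha>) \<otimes>\<^bsub>FA\<^esub> free_gen R (star \<Lambda> \<alpha>) \<in> homogeneous 0" if "\<alpha> \<in> E" for \<alpha>
      using homogeneous_path_star[of \<alpha> \<alpha>] FE_nonempty(2)[OF KP4(2,3)] that by auto
    ultimately have "\<rho> \<in> homogeneous 0"
      unfolding KP4(1) using FE_nonempty(1)[OF KP4(2,3)] KP4(5)
      by (intro homogeneous_list_product) (auto intro!: diff)
    then show ?thesis ..
  }
qed

text \<open>Multiplication by a word shifts all degrees by that of the word. This is the case to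
  which stability of the ideal in \<open>part_J\<close> is reduced, since a general multiplier is a
  combination of words.\<close>

lemma part_mult_word:
  assumes f: "f \<in> carrier FA" and u: "u \<noteq> []" "set u \<subseteq> symbols \<Lambda>"
  shows "part n (word_elem R u \<otimes>\<^bsub>FA\<^esub> f) = word_elem R u \<otimes>\<^bsub>FA\<^esub> part (n - word_deg u) f"
    and "part n (f \<otimes>\<^bsub>FA\<^esub> word_elem R u) = part (n - word_deg u) f \<otimes>\<^bsub>FA\<^esub> word_elem R u"
proof -
  note simps = part_add part_smult part_zero part_closed word_elem_closed F.mult_closed
    F.mult_distrib_left F.mult_distrib_right F.smult_mult_left F.smult_mult_right
  show "part n (word_elem R u \<otimes>\<^bsub>FA\<^esub> f) = word_elem R u \<otimes>\<^bsub>FA\<^esub> part (n - word_deg u) f"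
    using f
  proof (induction f rule: free_induct)
    case (word w)
    have "word_deg u + word_deg w = n \<longleftrightarrow> word_deg w = n - word_deg u" by (auto simp: algebra_simps)
    then show ?case using u by (simp add: word_elem_mult part_word word_deg_append word_elem_closed)
  qed (use u in \<open>simp_all add: simps\<close>)
  show "part n (f \<otimes>\<^bsub>FA\<^esub> word_elem R u) = part (n - word_deg u) f \<otimes>\<^bsub>FA\<^esub> word_elem R u"
    using f
  proof (induction f rule: free_induct)
    case (word w)
    have "word_deg w + word_deg u = n \<longleftrightarrow> word_deg w = n - word_deg u" by (auto simp: algebra_simps)
    then show ?case using u by (simp add: word_elem_mult part_word word_deg_append word_elem_closed)
  qed (use u in \<open>simp_all add: simps\<close>)
qed

text \<open>The elements all of whose homogeneous parts lie in \<open>J\<close> form an ideal that contains the relators.\<close>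

lemma part_J:
  assumes "f \<in> J"
  shows "part n f \<in> J"
proof -
  note JI = F.alg_idealD[OF J_alg_ideal]
  note JS = F.submoduleE[OF JI(1)]
  note J0 = F.submodule_zero[OF JI(1)]
  let ?I = "{f \<in> carrier FA. \<forall>n. part n f \<in> J}"
  have smult: "r \<odot>\<^bsub>FA\<^esub> f \<in> ?I" if "r \<in> carrier R" "f \<in> ?I" for r f
    using that JS(4) by (simp add: part_smult)
  have sub: "submodule ?I R FA"
  proof (rule F.submoduleI)
    show "\<ominus>\<^bsub>FA\<^esub> f \<in> ?I" if "f \<in> ?I" for f
      using smult[of "\<ominus> \<one>" f] that by (simp add: F.smult_l_minus)
  qed (use smult J0 JS(5) in \<open>auto simp: part_add part_zero\<close>)
  have "a \<otimes>\<^bsub>FA\<^esub> f \<in> ?I \<and> f \<otimes>\<^bsub>FA\<^esub> a \<in> ?I" if f: "f \<in> ?I" and a: "a \<in> carrier FA" for f a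
    using a
  proof (induction a rule: free_induct)
    case zero
    then show ?case using f F.submodule_zero[OF sub] by simp
  next
    case (word u)
    then show ?case
      using f JI(2,3) by (simp add: part_mult_word F.mult_closed word_elem_closed)
  next
    case (add a b)
    then show ?case
      using f F.submoduleE(5)[OF sub] by (simp add: F.mult_distrib_left F.mult_distrib_right)
  next
    case (smult r a)
    then show ?case
      using f F.submoduleE(4)[OF sub] by (simp add: F.smult_mult_left F.smult_mult_right)
  qed
  then have "alg_ideal R FA ?I" using sub by (auto simp: alg_ideal_def)
  moreover have "kp_relators \<Lambda> FA (free_gen R) \<subseteq> ?I"
  proof
    fix \<rho> assume \<rho>: "\<rho> \<in> kp_relators \<Lambda> FA (free_gen R)"
    then obtain m where "\<rho> \<in> homogeneous m" using relator_homogeneous by blast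
    \<comment> \<open>The part of a homogeneous relator is the relator itself or zero.\<close>
    then have "part n \<rho> \<in> J" for n
      using relators_J \<rho> J0 by (auto simp: part_of_homogeneous)
    then show "\<rho> \<in> ?I" using \<rho> relators_carrier by auto
  qed
  ultimately have "J \<subseteq> ?I" by (rule J_minimal)
  then show ?thesis using assms by auto
qed

lemma finsum_parts:
  assumes f: "f \<in> carrier FA" and D: "finite D" "word_deg ` {w. f w \<noteq> \<zero>} \<subseteq> D"
  shows "f = finsum FA (\<lambda>n. part n f) D"
proof
  fix w
  have "finsum FA (\<lambda>n. part n f) D w = finsum R (\<lambda>n. part n f w) D"
    using f part_closed by (intro free_finsum_coeff) auto
  also have "\<dots> = finsum R (\<lambda>n. if n = word_deg w then f w else \<zero>) D"
    using f by (intro finsum_cong') (auto simp: part_def)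
  also have "\<dots> = f w"
  proof (cases "word_deg w \<in> D")
    case True
    then show ?thesis using add.finprod_singleton_swap[OF True D(1), of "\<lambda>_. f w"] f by simp
  next
    case False
    then have z: "f w = \<zero>" using D by auto
    then have "finsum R (\<lambda>n. if n = word_deg w then f w else \<zero>) D = \<zero>"
      by (intro add.finprod_one_eqI) auto
    then show ?thesis using z by simp
  qed
  finally show "f w = finsum FA (\<lambda>n. part n f) D w" by simp
qed

text \<open>A spanning product is the image of a homogeneous word. Conversely a homogeneous element
  is its own part, and the parts of a combination of words are handled by
  \<open>list_product_span\<close>. The right side is where multiplicativity and uniqueness of
  components become visible.\<close>

lemma KP_component_eq: "KP_component R \<Lambda> n = quot ` homogeneous n"
proof
  interpret fam: kumjian_pask_family \<Lambda> R K "KP_gen R \<Lambda>" by (rule KP_family)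
  have C: "KP_component R \<Lambda> n = fam.homogeneous_span n" for n
    by (simp add: KP_component_def fam.homogeneous_span_def)
  show "KP_component R \<Lambda> n \<subseteq> quot ` homogeneous n"
    unfolding KP_component_def
  proof (rule Q.B.linear_span_minimal[OF Q.image_submodule[OF homogeneous_submodule]], rule)
    fix X assume "X \<in> {KP_gen R \<Lambda> (Path \<alpha>) \<otimes>\<^bsub>K\<^esub> KP_gen R \<Lambda> (star \<Lambda> \<mu>) |\<alpha> \<mu>.
      \<alpha> \<in> Mor \<Lambda> \<and> \<mu> \<in> Mor \<Lambda> \<and> int_deg \<Lambda> \<alpha> - int_deg \<Lambda> \<mu> = n}"
    then obtain \<alpha> \<mu> where *: "\<alpha> \<in> Mor \<Lambda>" "\<mu> \<in> Mor \<Lambda>" "int_deg \<Lambda> \<alpha> - int_deg \<Lambda> \<mu> = n"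
      "X = KP_gen R \<Lambda> (Path \<alpha>) \<otimes>\<^bsub>K\<^esub> KP_gen R \<Lambda> (star \<Lambda> \<mu>)" by auto
    then have "X = quot (free_gen R (Path \<alpha>) \<otimes>\<^bsub>FA\<^esub> free_gen R (star \<Lambda> \<mu>))"
      by (simp add: Q.map_mult Q.map_Path Q.map_star Q.gen_Path Q.gen_star)
    then show "X \<in> quot ` homogeneous n" using homogeneous_path_star[OF *(1,2)] *(3) by blast
  qed
  note H = Q.B.submoduleE[OF fam.homogeneous_span_submodule]
  \<comment> \<open>Stated for all elements and all degrees, since the induction passes through sums
    that are not homogeneous.\<close>
  have part: "\<forall>n. quot (part n f) \<in> fam.homogeneous_span n" if "f \<in> carrier FA" for f
    using that
  proof (induction f rule: free_induct)
    case (word w)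
    have "quot (word_elem R w) = list_product K (map (KP_gen R \<Lambda>) w)"
    proof -
      have c: "map (free_gen R) w \<noteq> []" "set (map (free_gen R) w) \<subseteq> carrier FA"
        using word free_gen_closed by auto
      have e: "map quot (map (free_gen R) w) = map (KP_gen R \<Lambda>) w"
        using word Q.map_gen by auto
      show ?thesis
        unfolding word_elem_list_product[OF word] Q.map_list_product[OF c] e ..
    qed
    then show ?case
      using fam.list_product_span[OF word] fam.homogeneous_span_zero by (auto simp: part_word)
  qed (use fam.homogeneous_span_zero H(4,5) in
      \<open>auto simp: part_zero part_add part_smult part_closed Q.map_add Q.map_smult\<close>)
  show "quot ` homogeneous n \<subseteq> KP_component R \<Lambda> n"
  proof
    fix X assume "X \<in> quot ` homogeneous n"
    then obtain f where f: "f \<in> homogeneous n" "X = quot f" by blast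
    then show "X \<in> KP_component R \<Lambda> n"
      using part[of f] part_of_homogeneous[OF f(1), of n] unfolding C
      by (auto simp: homogeneous_def dest: spec[of _ n])
  qed
qed

text \<open>Lift each \<open>G n\<close> to a homogeneous \<open>g n\<close>. Their sum
  \<open>s\<close> differs from \<open>f\<close> by an element of \<open>J\<close>. Taking parts of
  degree \<open>m\<close>, which \<open>part_J\<close> keeps inside \<open>J\<close>, isolates
  \<open>g m\<close> on one side and \<open>part m f\<close> on the other.\<close>

lemma component_determined:
  assumes f: "f \<in> carrier FA" and G: "\<And>n. G n \<in> KP_component R \<Lambda> n" "finite {n. G n \<noteq> \<zero>\<^bsub>K\<^esub>}"
    and sum: "quot f = finsum K G {n. G n \<noteq> \<zero>\<^bsub>K\<^esub>}"
  shows "G m = quot (part m f)"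
proof -
  let ?D = "{n. G n \<noteq> \<zero>\<^bsub>K\<^esub>}"
  have "\<forall>n. \<exists>g. g \<in> homogeneous n \<and> quot g = G n"
    using G(1) unfolding KP_component_eq by (metis imageE)
  then obtain g where g: "\<And>n. g n \<in> homogeneous n" "\<And>n. quot (g n) = G n" by metis
  have gc: "g n \<in> carrier FA" for n using g(1)[of n] by (simp add: homogeneous_def)
  define s where "s = finsum FA g ?D"
  have s: "s \<in> carrier FA" unfolding s_def using gc by (intro F.M.finsum_closed) auto
  have "quot s = quot f"
    unfolding s_def sum using gc g(2) by (subst Q.map_finsum) (auto intro: Q.B.M.finsum_cong')
  \<comment> \<open>The \<open>g n\<close> have disjoint supports, so only the term
    \<open>n = m\<close> contributes to words of degree \<open>m\<close>. Outside the index set the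
    value is zero, which agrees with \<open>G m\<close> there.\<close>
  have ps: "part m s = (if m \<in> ?D then g m else \<zero>\<^bsub>FA\<^esub>)"
  proof
    fix w
    have "part m s w = (if word_deg w = m then finsum R (\<lambda>n. g n w) ?D else \<zero>)"
      unfolding part_def s_def using gc by (subst free_finsum_coeff) auto
    also have "\<dots> = (if m \<in> ?D then g m else \<zero>\<^bsub>FA\<^esub>) w"
    proof (cases "word_deg w = m")
      case True
      have "finsum R (\<lambda>n. g n w) ?D = finsum R (\<lambda>n. if n = m then g n w else \<zero>) ?D"
        using gc g(1) True by (intro finsum_cong') (auto simp: homogeneous_def)
      also have "\<dots> = (if m \<in> ?D then g m w else \<zero>)"
      proof (cases "m \<in> ?D")
        case mD: True
        then show ?thesis using add.finprod_singleton_swap[OF mD G(2), of "\<lambda>n. g n w"] gc by simp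
      next
        case False
        have "finsum R (\<lambda>n. if n = m then g n w else \<zero>) ?D = \<zero>"
          using False by (intro add.finprod_one_eqI) auto
        then show ?thesis using False by simp
      qed
      finally show ?thesis using True by (simp add: free_zero)
    next
      case False
      then show ?thesis using g(1)[of m] by (auto simp: homogeneous_def free_zero)
    qed
    finally show "part m s w = (if m \<in> ?D then g m else \<zero>\<^bsub>FA\<^esub>) w" .
  qed
  have "s \<ominus>\<^bsub>FA\<^esub> f \<in> J" using \<open>quot s = quot f\<close> quot_eq_iff[OF s f] by simp
  then have "part m s \<ominus>\<^bsub>FA\<^esub> part m f \<in> J" using part_J[of "s \<ominus>\<^bsub>FA\<^esub> f" m] part_minus[OF s f] by simp
  then have "quot (part m s) = quot (part m f)" using quot_eq_iff part_closed s f by simp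
  moreover have "quot (part m s) = G m" unfolding ps using g(2) by simp
  ultimately show ?thesis by simp
qed

lemma KP_grading: "is_grading K (KP_component R \<Lambda>)"
  unfolding is_grading_def
proof (intro conjI allI ballI)
  fix n show "additive_subgroup (KP_component R \<Lambda> n) K"
    unfolding KP_component_eq using Q.image_submodule[OF homogeneous_submodule]
    by (intro additive_subgroupI) (simp add: submodule_def)
next
  fix m n X Y assume "X \<in> KP_component R \<Lambda> m" "Y \<in> KP_component R \<Lambda> n"
  then obtain f g where f: "f \<in> homogeneous m" "X = quot f" and g: "g \<in> homogeneous n" "Y = quot g"
    unfolding KP_component_eq by blast
  then have "X \<otimes>\<^bsub>K\<^esub> Y = quot (f \<otimes>\<^bsub>FA\<^esub> g)" by (simp add: Q.map_mult homogeneous_def)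
  then show "X \<otimes>\<^bsub>K\<^esub> Y \<in> KP_component R \<Lambda> (m + n)"
    unfolding KP_component_eq using homogeneous_mult[OF f(1) g(1)] by blast
next
  fix X assume "X \<in> carrier K"
  then obtain f where f: "f \<in> carrier FA" "X = quot f" by (auto simp: K_carrier)
  let ?G = "\<lambda>n. quot (part n f)"
  let ?D = "word_deg ` {w. f w \<noteq> \<zero>}"
  have D: "finite ?D" using f by (auto simp: free_carrier_iff)
  have Gc: "?G n \<in> carrier K" for n using part_closed[OF f(1)] by simp
  \<comment> \<open>A nonzero part of \<open>f\<close> may lie in \<open>J\<close> and vanish in the
    quotient, so the support of the components can be smaller than the set of degrees in
    \<open>f\<close>; the surplus terms are zero.\<close>
  have sub: "{n. ?G n \<noteq> \<zero>\<^bsub>K\<^esub>} \<subseteq> ?D"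
  proof (rule subsetI, rule ccontr)
    fix n assume n: "n \<in> {n. ?G n \<noteq> \<zero>\<^bsub>K\<^esub>}" "n \<notin> ?D"
    then have "part n f = \<zero>\<^bsub>FA\<^esub>" by (auto simp: part_def free_zero fun_eq_iff)
    then show False using n by simp
  qed
  have "X = quot (finsum FA (\<lambda>n. part n f) ?D)" using f finsum_parts[OF f(1) D order_refl] by simp
  also have "\<dots> = finsum K ?G ?D" using part_closed[OF f(1)] by (intro Q.map_finsum) auto
  also have "\<dots> = finsum K ?G {n. ?G n \<noteq> \<zero>\<^bsub>K\<^esub>}"
    by (rule Q.B.M.add.finprod_mono_neutral_cong_right[OF D sub]) (use Gc in auto)
  finally have X: "X = finsum K ?G {n. ?G n \<noteq> \<zero>\<^bsub>K\<^esub>}" .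
  show "\<exists>!G. (\<forall>n. G n \<in> KP_component R \<Lambda> n) \<and> finite {n. G n \<noteq> \<zero>\<^bsub>K\<^esub>} \<and>
      X = finsum K G {n. G n \<noteq> \<zero>\<^bsub>K\<^esub>}"
  proof (rule ex1I[of _ ?G])
    show "(\<forall>n. ?G n \<in> KP_component R \<Lambda> n) \<and> finite {n. ?G n \<noteq> \<zero>\<^bsub>K\<^esub>} \<and>
      X = finsum K ?G {n. ?G n \<noteq> \<zero>\<^bsub>K\<^esub>}"
      using X finite_subset[OF sub D] part_homogeneous[OF f(1)] unfolding KP_component_eq by blast
  next
    fix G assume "(\<forall>n. G n \<in> KP_component R \<Lambda> n) \<and> finite {n. G n \<noteq> \<zero>\<^bsub>K\<^esub>} \<and>
      X = finsum K G {n. G n \<noteq> \<zero>\<^bsub>K\<^esub>}"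
    then show "G = ?G" using component_determined[OF f(1)] f(2) by (intro ext) blast
  qed
qed

end

theorem theorem3p7:
  fixes \<Lambda> :: "('a, 'k::finite) kgraph" and R :: "('r, 'm) ring_scheme"
  assumes "finitely_aligned_kgraph \<Lambda>" and "cring R"
  shows
    "(kumjian_pask_family \<Lambda> R (KP R \<Lambda>) (KP_gen R \<Lambda>) \<and>
      subalg_generated R (KP R \<Lambda>) (KP_gen R \<Lambda> ` symbols \<Lambda>) = carrier (KP R \<Lambda>) \<and>
      (\<forall>(A :: ('r, 'c, 'e) module_scheme) S. kumjian_pask_family \<Lambda> R A S \<longrightarrow>
        (\<exists>!\<pi>. \<pi> \<in> alg_hom R (KP R \<Lambda>) A \<and> \<pi> \<in> extensional (carrier (KP R \<Lambda>)) \<and>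
          (\<forall>\<alpha> \<in> Mor \<Lambda>. \<pi> (KP_gen R \<Lambda> (Path \<alpha>)) = S (Path \<alpha>)) \<and>
          (\<forall>\<mu> \<in> Mor \<Lambda>. \<pi> (KP_gen R \<Lambda> (star \<Lambda> \<mu>)) = S (star \<Lambda> \<mu>))))) \<and>
     (\<forall>r \<in> carrier R - {\<zero>\<^bsub>R\<^esub>}. \<forall>v \<in> vertices \<Lambda>.
        r \<odot>\<^bsub>KP R \<Lambda>\<^esub> KP_gen R \<Lambda> (Path v) \<noteq> \<zero>\<^bsub>KP R \<Lambda>\<^esub>) \<and>
     is_grading (KP R \<Lambda>) (KP_component R \<Lambda>)"
proof -
  interpret kumjian_pask_algebra \<Lambda> R
    using assms by (intro kumjian_pask_algebra.intro)
  show ?thesis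
    using KP_family KP_subalg_generated KP_universal KP_vertex_nonzero KP_grading by blast
qed

end
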